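(* Let $V$ be a $2$-dimensional vector space over $\mathbb{F}_p$ and $G\subseteq\mathrm{GL}(V)$ a subgroup. The following are equivalent. (1) (i) $V$ and $\mathrm{End}(V)$ have no common irreducible factor (composition factor) as $G$-modules, and (ii) $\mathrm{H}^1(G,V)=0$. (2) (i) $G$ is not contained in any subgroup of $\mathrm{GL}(V)$ isomorphic to the symmetric group $S_3$ (in particular $p>2$), and (ii) if $V$ is a reducible $G$-module, i.e. an extension $0\to\chi_1\to V\to\chi_2\to0$ of characters $\chi_i:G\to\mathbb{F}_p^\ast$, then $\chi_1\neq\mathbf{1}$, $\chi_1\neq\chi_2^2$, $\chi_2\neq\mathbf{1}$ and $\chi_2\neq\chi_1^2$.
   Context: $\mathrm{End}(V)$ carries the conjugation action of $G$; $\mathbf{1}$ denotes the trivial character. *)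

theory Defs
  imports
    "Berlekamp_Zassenhaus.Finite_Field"
    "HOL-Algebra.Sym_Groups"
    "HOL-Algebra.Elementary_Groups"
begin

text \<open>
  A module over a group algebra \<open>k[\<Gamma>]\<close>, with explicit carrier so that submodules and quotients are
  again of this form. The underlying abelian group is an ordinary HOL-Algebra group and is therefore
  written multiplicatively: \<open>\<otimes>\<close>, \<open>\<one>\<close>, \<open>inv\<close> are the addition, zero and negation of the module.
\<close>

record ('a, 'k, 'g) gmodule = "'a monoid" +
  scal :: "'k \<Rightarrow> 'a \<Rightarrow> 'a"
  act :: "'g \<Rightarrow> 'a \<Rightarrow> 'a"

definition gmodule_hom ::
  "('g, 'r) monoid_scheme \<Rightarrow> ('a, 'k, 'g) gmodule \<Rightarrow> ('b, 'k, 'g) gmodule \<Rightarrow> ('a \<Rightarrow> 'b) set" where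
  "gmodule_hom \<Gamma> M N =
    {\<phi> \<in> hom M N.
       (\<forall>c. \<forall>x\<in>carrier M. \<phi> (scal M c x) = scal N c (\<phi> x)) \<and>
       (\<forall>g\<in>carrier \<Gamma>. \<forall>x\<in>carrier M. \<phi> (act M g x) = act N g (\<phi> x))}"

definition gmodule_isomorphic ::
  "('g, 'r) monoid_scheme \<Rightarrow> ('a, 'k, 'g) gmodule \<Rightarrow> ('b, 'k, 'g) gmodule \<Rightarrow> bool" where
  "gmodule_isomorphic \<Gamma> M N \<longleftrightarrow>
    (\<exists>\<phi>\<in>gmodule_hom \<Gamma> M N. bij_betw \<phi> (carrier M) (carrier N))"

definition submod ::
  "('g, 'r) monoid_scheme \<Rightarrow> 'a set \<Rightarrow> ('a, 'k, 'g) gmodule \<Rightarrow> bool" where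
  "submod \<Gamma> N M \<longleftrightarrow> subgroup N M \<and>
     (\<forall>c. \<forall>x\<in>N. scal M c x \<in> N) \<and> (\<forall>g\<in>carrier \<Gamma>. \<forall>x\<in>N. act M g x \<in> N)"

definition irreducible_gmodule ::
  "('g, 'r) monoid_scheme \<Rightarrow> ('a, 'k, 'g) gmodule \<Rightarrow> bool" where
  "irreducible_gmodule \<Gamma> M \<longleftrightarrow> carrier M \<noteq> {\<one>\<^bsub>M\<^esub>} \<and>
     (\<forall>N. submod \<Gamma> N M \<longrightarrow> N = {\<one>\<^bsub>M\<^esub>} \<or> N = carrier M)"

text \<open>
  The quotient has the cosets of \<open>N\<close> as elements. The unions below are the cosets of \<open>c x\<close> and of
  \<open>g x\<close> for any representative \<open>x\<close>; the plain image of a coset under \<open>c = 0\<close> would not be a coset.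
\<close>

definition quot_gmodule ::
  "('a, 'k, 'g) gmodule \<Rightarrow> 'a set \<Rightarrow> ('a set, 'k, 'g) gmodule" where
  "quot_gmodule M N =
    \<lparr>carrier = carrier (M Mod N), monoid.mult = monoid.mult (M Mod N), one = one (M Mod N),
     scal = (\<lambda>c X. \<Union>x\<in>X. N #>\<^bsub>M\<^esub> scal M c x),
     act = (\<lambda>g X. \<Union>x\<in>X. N #>\<^bsub>M\<^esub> act M g x)\<rparr>"

definition composition_series ::
  "('g, 'r) monoid_scheme \<Rightarrow> ('a, 'k, 'g) gmodule \<Rightarrow> 'a set list \<Rightarrow> bool" where
  "composition_series \<Gamma> M Ns \<longleftrightarrow>
     Ns \<noteq> [] \<and> hd Ns = {\<one>\<^bsub>M\<^esub>} \<and> last Ns = carrier M \<and>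
     (\<forall>N\<in>set Ns. submod \<Gamma> N M) \<and>
     (\<forall>i. Suc i < length Ns \<longrightarrow> Ns ! i \<subseteq> Ns ! Suc i \<and>
        irreducible_gmodule \<Gamma> (quot_gmodule (M\<lparr>carrier := Ns ! Suc i\<rparr>) (Ns ! i)))"

definition composition_factor ::
  "('g, 'r) monoid_scheme \<Rightarrow> ('a, 'k, 'g) gmodule \<Rightarrow> ('a set, 'k, 'g) gmodule \<Rightarrow> bool" where
  "composition_factor \<Gamma> M Q \<longleftrightarrow>
     (\<exists>Ns i. composition_series \<Gamma> M Ns \<and> Suc i < length Ns \<and>
        Q = quot_gmodule (M\<lparr>carrier := Ns ! Suc i\<rparr>) (Ns ! i))"

definition common_composition_factor ::
  "('g, 'r) monoid_scheme \<Rightarrow> ('a, 'k, 'g) gmodule \<Rightarrow> ('b, 'k, 'g) gmodule \<Rightarrow> bool" where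
  "common_composition_factor \<Gamma> M M' \<longleftrightarrow>
     (\<exists>Q Q'. composition_factor \<Gamma> M Q \<and> composition_factor \<Gamma> M' Q' \<and> gmodule_isomorphic \<Gamma> Q Q')"

definition cocycles ::
  "('g, 'r) monoid_scheme \<Rightarrow> ('a, 'k, 'g) gmodule \<Rightarrow> ('g \<Rightarrow> 'a) monoid" where
  "cocycles \<Gamma> M =
    \<lparr>carrier = {f \<in> carrier \<Gamma> \<rightarrow>\<^sub>E carrier M. \<forall>g\<in>carrier \<Gamma>. \<forall>h\<in>carrier \<Gamma>.
        f (g \<otimes>\<^bsub>\<Gamma>\<^esub> h) = f g \<otimes>\<^bsub>M\<^esub> act M g (f h)},
     monoid.mult = (\<lambda>f f'. \<lambda>g\<in>carrier \<Gamma>. f g \<otimes>\<^bsub>M\<^esub> f' g),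
     one = (\<lambda>g\<in>carrier \<Gamma>. \<one>\<^bsub>M\<^esub>)\<rparr>"

definition coboundaries ::
  "('g, 'r) monoid_scheme \<Rightarrow> ('a, 'k, 'g) gmodule \<Rightarrow> ('g \<Rightarrow> 'a) set" where
  "coboundaries \<Gamma> M =
    (\<lambda>v. \<lambda>g\<in>carrier \<Gamma>. act M g v \<otimes>\<^bsub>M\<^esub> inv\<^bsub>M\<^esub> v) ` carrier M"

definition H1 ::
  "('g, 'r) monoid_scheme \<Rightarrow> ('a, 'k, 'g) gmodule \<Rightarrow> ('g \<Rightarrow> 'a) set monoid" where
  "H1 \<Gamma> M = cocycles \<Gamma> M Mod coboundaries \<Gamma> M"

definition GL :: "('k::field \<Rightarrow> 'v::ab_group_add \<Rightarrow> 'v) \<Rightarrow> ('v \<Rightarrow> 'v) monoid" where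
  "GL scale = \<lparr>carrier = {f. Vector_Spaces.linear scale scale f \<and> bij f}, monoid.mult = (\<circ>), one = id\<rparr>"

abbreviation restr_GL ::
  "('k::field \<Rightarrow> 'v::ab_group_add \<Rightarrow> 'v) \<Rightarrow> ('v \<Rightarrow> 'v) set \<Rightarrow> ('v \<Rightarrow> 'v) monoid" where
  "restr_GL scale G \<equiv> (GL scale)\<lparr>carrier := G\<rparr>"

definition std_gmodule ::
  "('k::field \<Rightarrow> 'v::ab_group_add \<Rightarrow> 'v) \<Rightarrow> ('v, 'k, 'v \<Rightarrow> 'v) gmodule" where
  "std_gmodule scale =
    \<lparr>carrier = UNIV, monoid.mult = (+), one = 0, scal = scale, act = (\<lambda>g v. g v)\<rparr>"

definition End_gmodule ::
  "('k::field \<Rightarrow> 'v::ab_group_add \<Rightarrow> 'v) \<Rightarrow> ('v \<Rightarrow> 'v, 'k, 'v \<Rightarrow> 'v) gmodule" where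
  "End_gmodule scale =
    \<lparr>carrier = {f. Vector_Spaces.linear scale scale f},
     monoid.mult = (\<lambda>f h v. f v + h v), one = (\<lambda>v. 0),
     scal = (\<lambda>c f v. scale c (f v)),
     act = (\<lambda>g f. g \<circ> f \<circ> inv_into UNIV g)\<rparr>"

definition characters :: "('g, 'r) monoid_scheme \<Rightarrow> ('g \<Rightarrow> 'k::field) set" where
  "characters \<Gamma> = hom \<Gamma> \<lparr>carrier = UNIV - {0}, monoid.mult = (*), one = 1\<rparr>"

definition char_gmodule :: "('g \<Rightarrow> 'k::field) \<Rightarrow> ('k, 'k, 'g) gmodule" where
  "char_gmodule \<chi> =
    \<lparr>carrier = UNIV, monoid.mult = (+), one = 0, scal = (*), act = (\<lambda>g x. \<chi> g * x)\<rparr>"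

text \<open>\<open>M\<close> sits in a short exact sequence \<open>0 \<rightarrow> A \<rightarrow> M \<rightarrow> B \<rightarrow> 0\<close>.\<close>

definition is_extension ::
  "('g, 'r) monoid_scheme \<Rightarrow> ('a, 'k, 'g) gmodule \<Rightarrow> ('m, 'k, 'g) gmodule \<Rightarrow>
   ('b, 'k, 'g) gmodule \<Rightarrow> bool" where
  "is_extension \<Gamma> A M B \<longleftrightarrow>
     (\<exists>\<iota>\<in>gmodule_hom \<Gamma> A M. \<exists>\<pi>\<in>gmodule_hom \<Gamma> M B.
        inj_on \<iota> (carrier A) \<and> \<pi> ` carrier M = carrier B \<and> \<iota> ` carrier A = kernel M B \<pi>)"

end

theory Submission
  imports Defs "HOL-Algebra.Sylow" "HOL-Algebra.Multiplicative_Group"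
begin

text \<open>
  If \<open>V\<close> has a stable line, then \<open>V\<close> has factors \<open>\<chi>\<^sub>1, \<chi>\<^sub>2\<close> and \<open>End(V)\<close> has factors
  \<open>1, 1, \<chi>\<^sub>1/\<chi>\<^sub>2, \<chi>\<^sub>2/\<chi>\<^sub>1\<close>, so the absence of a common factor is exactly the condition on characters.
  That condition also kills \<open>H\<^sup>1\<close>: on a unipotent element a cocycle with values in a character \<open>\<psi>\<close> can only
  be nonzero if \<open>\<psi> = \<chi>\<^sub>1/\<chi>\<^sub>2\<close>, and it is a coboundary once it vanishes on commutators.

  If \<open>G\<close> lies in a copy of \<open>S\<^sub>3\<close>, then either \<open>G\<close> fixes a nonzero vector, or it permutes vectors
  \<open>w\<^sub>1, w\<^sub>2, w\<^sub>3\<close> with sum \<open>0\<close> that span \<open>V\<close>; in the latter case the product with \<open>w\<^sub>i w\<^sub>i = w\<^sub>i\<close> and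
  \<open>w\<^sub>i w\<^sub>j = w\<^sub>k\<close> embeds \<open>V\<close> into \<open>End(V)\<close>. This works in every characteristic.

  If \<open>V\<close> is irreducible and \<open>p\<close> is odd, a nontrivial unipotent element and a suitable conjugate generate
  a group containing \<open>-1\<close>, which acts as \<open>-1\<close> on \<open>V\<close> and trivially on \<open>End(V)\<close>, and both claims follow.
  Otherwise \<open>p\<close> does not divide the order of \<open>G\<close>, and \<open>H\<^sup>1\<close> vanishes by averaging. A common factor
  then forces every \<open>g\<close> to have eigenvalue \<open>1\<close> or to satisfy \<open>g\<^sup>2 + g + 1 = 0\<close>; hence \<open>G \<inter> SL(V)\<close> has at
  most three elements, its centraliser in \<open>G\<close> is no larger, and \<open>G\<close> permutes three vectors as above.
\<close>

section \<open>Modules over a group and their composition factors\<close>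

text \<open>Factors are told apart by polynomials: if a polynomial in some \<open>g\<close> kills a
  factor, it kills every isomorphic one. Linear polynomials suffice when \<open>V\<close> has a
  stable line. For irreducible \<open>V\<close> a cubic with the eigenvalues of \<open>g\<close> on
  End(V) as roots is reduced modulo the characteristic polynomial of \<open>g\<close>. Uniqueness of
  composition factors is never invoked, because every simple subquotient of a finite module occurs
  in some composition series. That the field is prime is used through one fact: a scalar is a
  natural number, so multiplying the off-diagonal entry of a transvection by a scalar amounts to
  taking a power of it. This ties cocycles on unipotent elements to
  \<open>\<chi>\<^sub>1 / \<chi>\<^sub>2\<close>. It also produces -1: a suitable product of an
  upper and a lower transvection has trace -2 and determinant 1, so it is minus a unipotent element,
  and its p-th power is -1 for odd p. Characteristic 3 needs care: there an element with
  \<open>g\<^sup>2 + g + 1 = 0\<close> is itself unipotent.\<close>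

locale gmod = comm_group M
  for \<Gamma> :: "('g, 'r) monoid_scheme" and M :: "('a, 'k::field, 'g) gmodule" (structure) +
  assumes scal_closed [simp]: "x \<in> carrier M \<Longrightarrow> scal M c x \<in> carrier M"
    and act_closed [simp]: "g \<in> carrier \<Gamma> \<Longrightarrow> x \<in> carrier M \<Longrightarrow> act M g x \<in> carrier M"
    and scal_mult: "x \<in> carrier M \<Longrightarrow> y \<in> carrier M \<Longrightarrow>
      scal M c (x \<otimes> y) = scal M c x \<otimes> scal M c y"
    and scal_plus: "x \<in> carrier M \<Longrightarrow> scal M (c + d) x = scal M c x \<otimes> scal M d x"
    and scal_scal: "x \<in> carrier M \<Longrightarrow> scal M c (scal M d x) = scal M (c * d) x"
    and scal_1 [simp]: "x \<in> carrier M \<Longrightarrow> scal M 1 x = x"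
    and act_mult: "g \<in> carrier \<Gamma> \<Longrightarrow> x \<in> carrier M \<Longrightarrow> y \<in> carrier M \<Longrightarrow>
      act M g (x \<otimes> y) = act M g x \<otimes> act M g y"
    and act_scal: "g \<in> carrier \<Gamma> \<Longrightarrow> x \<in> carrier M \<Longrightarrow>
      act M g (scal M c x) = scal M c (act M g x)"
begin

lemma scal_one [simp]: "scal M c \<one> = \<one>"
proof -
  have "scal M c \<one> \<otimes> scal M c \<one> = scal M c \<one>"
    using scal_mult[of \<one> \<one> c] by simp
  then show ?thesis by (metis one_closed scal_closed r_cancel_one)
qed

lemma scal_0 [simp]: "x \<in> carrier M \<Longrightarrow> scal M 0 x = \<one>"
  using scal_plus[of x 0 0] by (metis add_0 r_cancel_one scal_closed)

lemma inv_eq_scal: "x \<in> carrier M \<Longrightarrow> inv x = scal M (-1) x"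
  using scal_plus[of x "-1" 1] by (simp add: inv_equality)

lemma act_one [simp]: "g \<in> carrier \<Gamma> \<Longrightarrow> act M g \<one> = \<one>"
  using act_scal[of g \<one> 0] by simp

lemma submodI:
  assumes "N \<subseteq> carrier M" "\<one> \<in> N" "\<And>x y. x \<in> N \<Longrightarrow> y \<in> N \<Longrightarrow> x \<otimes> y \<in> N"
    "\<And>c x. x \<in> N \<Longrightarrow> scal M c x \<in> N" "\<And>g x. g \<in> carrier \<Gamma> \<Longrightarrow> x \<in> N \<Longrightarrow> act M g x \<in> N"
  shows "submod \<Gamma> N M"
  unfolding submod_def using assms by (auto intro!: subgroup.intro simp: inv_eq_scal subset_iff)

lemma submodD:
  assumes "submod \<Gamma> N M"
  shows "N \<subseteq> carrier M" "\<one> \<in> N" "\<And>x y. x \<in> N \<Longrightarrow> y \<in> N \<Longrightarrow> x \<otimes> y \<in> N"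
    "\<And>c x. x \<in> N \<Longrightarrow> scal M c x \<in> N" "\<And>g x. g \<in> carrier \<Gamma> \<Longrightarrow> x \<in> N \<Longrightarrow> act M g x \<in> N"
    "\<And>x. x \<in> N \<Longrightarrow> inv x \<in> N" "subgroup N M" "\<And>x. x \<in> N \<Longrightarrow> x \<in> carrier M"
  using assms unfolding submod_def
  by (auto simp: subgroup.m_closed subgroup.one_closed subgroup.m_inv_closed dest: subgroup.subset)

lemma submod_carrier: "submod \<Gamma> (carrier M) M"
  by (rule submodI) auto

lemma submod_one: "submod \<Gamma> {\<one>} M"
  by (rule submodI) auto

lemma submod_Int: "submod \<Gamma> A M \<Longrightarrow> submod \<Gamma> B M \<Longrightarrow> submod \<Gamma> (A \<inter> B) M"
  by (rule submodI) (auto dest: submodD)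

lemma gmod_sub:
  assumes "submod \<Gamma> N M"
  shows "gmod \<Gamma> (M\<lparr>carrier := N\<rparr>)"
proof -
  note N = submodD[OF assms]
  interpret G: group "M\<lparr>carrier := N\<rparr>"
    using N(7) by (rule subgroup_imp_group)
  show ?thesis
    by unfold_locales
      (auto simp: N scal_mult scal_plus scal_scal act_mult act_scal m_comm subsetD[OF N(1)])
qed

lemma submod_sub_iff:
  assumes "submod \<Gamma> N M"
  shows "submod \<Gamma> K (M\<lparr>carrier := N\<rparr>) \<longleftrightarrow> submod \<Gamma> K M \<and> K \<subseteq> N"
proof -
  interpret S: gmod \<Gamma> "M\<lparr>carrier := N\<rparr>" by (rule gmod_sub[OF assms])
  show ?thesis
  proof
    assume "submod \<Gamma> K (M\<lparr>carrier := N\<rparr>)"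
    note K = S.submodD[OF this]
    show "submod \<Gamma> K M \<and> K \<subseteq> N"
      using K submodD(1)[OF assms] by (auto intro!: submodI)
  next
    assume K: "submod \<Gamma> K M \<and> K \<subseteq> N"
    then show "submod \<Gamma> K (M\<lparr>carrier := N\<rparr>)"
      by (intro S.submodI) (auto dest: submodD)
  qed
qed

lemma coset_eq_iff:
  assumes "submod \<Gamma> N M" "x \<in> carrier M" "y \<in> carrier M"
  shows "N #> x = N #> y \<longleftrightarrow> x \<otimes> inv y \<in> N"
proof -
  note N = submodD[OF assms(1)]
  interpret N: subgroup N M by (rule N(7))
  have "x \<otimes> inv y \<in> N \<longleftrightarrow> x \<in> N #> y"
    using N.rcos_module[OF is_group assms(3,2)] by simp
  then show ?thesis
    using repr_independence[OF _ assms(3) N(7)] rcos_self[OF assms(2) N(7)] by auto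
qed

lemma carrier_quot: "carrier (quot_gmodule M N) = (\<lambda>x. N #> x) ` carrier M"
  by (simp add: quot_gmodule_def carrier_FactGroup)

lemma one_quot: "\<one>\<^bsub>quot_gmodule M N\<^esub> = N"
  by (simp add: quot_gmodule_def)

lemma mult_quot:
  assumes "submod \<Gamma> N M" "x \<in> carrier M" "y \<in> carrier M"
  shows "(N #> x) \<otimes>\<^bsub>quot_gmodule M N\<^esub> (N #> y) = N #> (x \<otimes> y)"
  using normal.rcos_sum[OF subgroup_imp_normal[OF submodD(7)[OF assms(1)]] assms(2,3)]
  by (simp add: quot_gmodule_def)

text \<open>Changing the representative by an element n of \<open>N\<close> changes
  \<open>h x\<close> by \<open>h n\<close>, again in \<open>N\<close>. So all sets in the union
  agree, and the unions in \<open>quot_gmodule\<close> are single cosets.\<close>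

lemma coset_Un_eq:
  assumes N: "submod \<Gamma> N M" and x: "x \<in> carrier M"
    and h: "\<And>x. x \<in> carrier M \<Longrightarrow> h x \<in> carrier M"
    and hm: "\<And>x y. x \<in> carrier M \<Longrightarrow> y \<in> carrier M \<Longrightarrow> h (x \<otimes> y) = h x \<otimes> h y"
    and hN: "\<And>x. x \<in> N \<Longrightarrow> h x \<in> N"
  shows "(\<Union>y\<in>N #> x. N #> h y) = N #> h x"
proof -
  note ND = submodD[OF N]
  have "N #> h y = N #> h x" if y: "y \<in> N #> x" for y
  proof -
    obtain n where n: "n \<in> N" "y = n \<otimes> x" using y unfolding r_coset_def by auto
    have "h y \<otimes> inv (h x) = h n"
      using n ND(8) x h hm by (simp add: m_assoc)
    then show ?thesis
      using coset_eq_iff[OF N, of "h y" "h x"] h hN n ND(8) x by simp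
  qed
  moreover have "x \<in> N #> x" using rcos_self[OF x ND(7)] .
  ultimately show ?thesis by blast
qed

lemma scal_quot:
  assumes "submod \<Gamma> N M" "x \<in> carrier M"
  shows "scal (quot_gmodule M N) c (N #> x) = N #> scal M c x"
  using coset_Un_eq[OF assms, of "scal M c"] submodD[OF assms(1)]
  by (simp add: quot_gmodule_def scal_mult)

lemma act_quot:
  assumes "submod \<Gamma> N M" "x \<in> carrier M" "g \<in> carrier \<Gamma>"
  shows "act (quot_gmodule M N) g (N #> x) = N #> act M g x"
  using coset_Un_eq[OF assms(1,2), of "act M g"] submodD[OF assms(1)] assms(3)
  by (simp add: quot_gmodule_def act_mult)

lemma gmod_quot:
  assumes N: "submod \<Gamma> N M"
  shows "gmod \<Gamma> (quot_gmodule M N)"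
proof -
  let ?Q = "quot_gmodule M N"
  have cl: "N #> x \<in> carrier ?Q" if "x \<in> carrier M" for x
    using that by (simp add: carrier_quot)
  have one: "\<one>\<^bsub>?Q\<^esub> = N #> \<one>" using submodD(1)[OF N] by (simp add: one_quot)
  note s = mult_quot[OF N] scal_quot[OF N] act_quot[OF N]
  have "comm_group ?Q"
  proof (rule comm_groupI)
    fix X assume "X \<in> carrier ?Q"
    then obtain x where x: "x \<in> carrier M" "X = N #> x" by (auto simp: carrier_quot)
    have "(N #> inv x) \<otimes>\<^bsub>?Q\<^esub> X = \<one>\<^bsub>?Q\<^esub>" using x by (simp add: s one)
    then show "\<exists>Y\<in>carrier ?Q. Y \<otimes>\<^bsub>?Q\<^esub> X = \<one>\<^bsub>?Q\<^esub>" using x cl inv_closed by blast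
  qed (auto simp: carrier_quot one s m_ac)
  then interpret Q: comm_group ?Q .
  show ?thesis
    by unfold_locales
      (auto simp: carrier_quot s scal_mult scal_plus scal_scal act_mult act_scal)
qed

text \<open>The correspondence theorem, which turns simplicity of a quotient into a statement about
  submodules of \<open>M\<close> alone; \<open>down\<close> passes to images, \<open>up\<close> to
  preimages.\<close>

lemma irreducible_quot_iff:
  assumes N: "submod \<Gamma> N M"
  shows "irreducible_gmodule \<Gamma> (quot_gmodule M N) \<longleftrightarrow>
    N \<noteq> carrier M \<and> (\<forall>K. submod \<Gamma> K M \<and> N \<subseteq> K \<longrightarrow> K = N \<or> K = carrier M)"
proof -
  let ?Q = "quot_gmodule M N"
  note ND = submodD[OF N]
  interpret Q: gmod \<Gamma> ?Q by (rule gmod_quot[OF N])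
  note s = mult_quot[OF N] scal_quot[OF N] act_quot[OF N]
  have inN: "N #> x = N \<longleftrightarrow> x \<in> N" if "x \<in> carrier M" for x
    using coset_eq_iff[OF N that one_closed] that ND(1) by simp
  have triv: "carrier ?Q = {\<one>\<^bsub>?Q\<^esub>} \<longleftrightarrow> N = carrier M"
  proof
    assume "carrier ?Q = {\<one>\<^bsub>?Q\<^esub>}"
    then have "\<forall>x\<in>carrier M. N #> x = N" by (auto simp: carrier_quot one_quot)
    then show "N = carrier M" using inN ND(1) by blast
  next
    assume "N = carrier M"
    then have "\<forall>x\<in>carrier M. N #> x = N" using inN by blast
    then show "carrier ?Q = {\<one>\<^bsub>?Q\<^esub>}" unfolding carrier_quot one_quot using one_closed by blast
  qed
  have down: "K = N \<or> K = carrier M"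
    if irr: "\<And>\<K>. submod \<Gamma> \<K> ?Q \<Longrightarrow> \<K> = {\<one>\<^bsub>?Q\<^esub>} \<or> \<K> = carrier ?Q"
      and K: "submod \<Gamma> K M" "N \<subseteq> K" for K
  proof -
    note KD = submodD[OF K(1)]
    let ?K = "(\<lambda>x. N #> x) ` K"
    \<comment> \<open>Because \<open>N\<close> lies in \<open>K\<close>, membership in
      \<open>K\<close> can be read off the coset.\<close>
    have mem: "x \<in> K" if "x \<in> carrier M" "N #> x \<in> ?K" for x
    proof -
      obtain k where k: "k \<in> K" "N #> x = N #> k" using \<open>N #> x \<in> ?K\<close> by blast
      then have "x \<otimes> inv k \<in> K" using coset_eq_iff[OF N that(1), of k] KD(8) K(2) by blast
      then have "x \<otimes> inv k \<otimes> k \<in> K" using k KD(3) by blast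
      then show "x \<in> K" using that(1) KD(8)[OF k(1)] by (simp add: m_assoc)
    qed
    have "submod \<Gamma> ?K ?Q"
    proof (rule Q.submodI)
      show "?K \<subseteq> carrier ?Q" using KD(1) by (auto simp: carrier_quot)
      show "\<one>\<^bsub>?Q\<^esub> \<in> ?K" using inN[of \<one>] ND(2) KD(2) by (auto simp: one_quot intro!: image_eqI[of _ _ \<one>])
    qed (auto simp: s KD)
    from irr[OF this] show ?thesis
    proof
      assume "?K = {\<one>\<^bsub>?Q\<^esub>}"
      then have "N #> k = N" if "k \<in> K" for k using that by (auto simp: one_quot)
      then show ?thesis using inN KD(8) K(2) by blast
    next
      assume "?K = carrier ?Q"
      then have "x \<in> K" if "x \<in> carrier M" for x using mem[OF that] that by (simp add: carrier_quot)
      then show ?thesis using KD(1) by blast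
    qed
  qed
  have up: "\<K> = {\<one>\<^bsub>?Q\<^esub>} \<or> \<K> = carrier ?Q"
    if irr: "\<And>K. submod \<Gamma> K M \<Longrightarrow> N \<subseteq> K \<Longrightarrow> K = N \<or> K = carrier M" and K: "submod \<Gamma> \<K> ?Q" for \<K>
  proof -
    note KD = Q.submodD[OF K]
    let ?K = "{x \<in> carrier M. N #> x \<in> \<K>}"
    have "submod \<Gamma> ?K M"
    proof (rule submodI)
      show "\<one> \<in> ?K" using KD(2) ND(1) by (simp add: one_quot)
      show "x \<otimes> y \<in> ?K" if "x \<in> ?K" "y \<in> ?K" for x y
        using that KD(3)[of "N #> x" "N #> y"] by (simp add: s)
      show "scal M c x \<in> ?K" if "x \<in> ?K" for c x
        using that KD(4)[of "N #> x" c] by (simp add: s)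
      show "act M g x \<in> ?K" if "g \<in> carrier \<Gamma>" "x \<in> ?K" for g x
        using that KD(5)[of g "N #> x"] by (simp add: s)
    qed auto
    moreover have "N \<subseteq> ?K"
    proof
      fix x assume x: "x \<in> N"
      then have "N #> x = N" using inN ND(8) by blast
      then show "x \<in> ?K" using x ND(8) KD(2) by (simp add: one_quot)
    qed
    ultimately have "?K = N \<or> ?K = carrier M" by (rule irr)
    moreover have eq: "\<K> = (\<lambda>x. N #> x) ` ?K" using KD(1) by (auto simp: carrier_quot)
    ultimately show ?thesis
    proof (elim disjE)
      assume "?K = N"
      then have "\<K> = (\<lambda>x. N #> x) ` N" using eq by simp
      moreover have "\<And>x. x \<in> N \<Longrightarrow> N #> x = N" using inN ND(8) by blast
      ultimately have "\<K> = {N}" using ND(2) by auto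
      then show ?thesis by (simp add: one_quot)
    next
      assume "?K = carrier M"
      then have "\<K> = (\<lambda>x. N #> x) ` carrier M" using eq by simp
      then show ?thesis by (simp add: carrier_quot)
    qed
  qed
  show ?thesis
  proof
    assume "irreducible_gmodule \<Gamma> ?Q"
    then show "N \<noteq> carrier M \<and> (\<forall>K. submod \<Gamma> K M \<and> N \<subseteq> K \<longrightarrow> K = N \<or> K = carrier M)"
      unfolding irreducible_gmodule_def triv using down by blast
  next
    assume "N \<noteq> carrier M \<and> (\<forall>K. submod \<Gamma> K M \<and> N \<subseteq> K \<longrightarrow> K = N \<or> K = carrier M)"
    then show "irreducible_gmodule \<Gamma> ?Q"
      unfolding irreducible_gmodule_def triv using up by blast
  qed
qed

text \<open>A simple subquotient seen as a covering pair in the lattice of submodules, which keeps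
  later arguments inside \<open>M\<close>.\<close>

definition simple_section :: "'a set \<Rightarrow> 'a set \<Rightarrow> bool" where
  "simple_section N\<^sub>1 N\<^sub>2 \<longleftrightarrow> submod \<Gamma> N\<^sub>1 M \<and> submod \<Gamma> N\<^sub>2 M \<and> N\<^sub>1 \<subset> N\<^sub>2 \<and>
     (\<forall>K. submod \<Gamma> K M \<and> N\<^sub>1 \<subseteq> K \<and> K \<subseteq> N\<^sub>2 \<longrightarrow> K = N\<^sub>1 \<or> K = N\<^sub>2)"

lemma simple_section_iff:
  assumes "submod \<Gamma> N\<^sub>1 M" "submod \<Gamma> N\<^sub>2 M"
  shows "simple_section N\<^sub>1 N\<^sub>2 \<longleftrightarrow>
    N\<^sub>1 \<subseteq> N\<^sub>2 \<and> irreducible_gmodule \<Gamma> (quot_gmodule (M\<lparr>carrier := N\<^sub>2\<rparr>) N\<^sub>1)"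
proof (cases "N\<^sub>1 \<subseteq> N\<^sub>2")
  case True
  interpret S: gmod \<Gamma> "M\<lparr>carrier := N\<^sub>2\<rparr>" by (rule gmod_sub[OF assms(2)])
  have "submod \<Gamma> N\<^sub>1 (M\<lparr>carrier := N\<^sub>2\<rparr>)" using assms True submod_sub_iff by blast
  from S.irreducible_quot_iff[OF this] show ?thesis
    unfolding simple_section_def submod_sub_iff[OF assms(2)] using assms True by auto
qed (auto simp: simple_section_def)

lemma composition_series_iff:
  "composition_series \<Gamma> M Ns \<longleftrightarrow> Ns \<noteq> [] \<and> hd Ns = {\<one>} \<and> last Ns = carrier M \<and>
     (\<forall>N\<in>set Ns. submod \<Gamma> N M) \<and> successively simple_section Ns"
proof -
  have *: "successively P xs \<longleftrightarrow> (\<forall>i. Suc i < length xs \<longrightarrow> P (xs ! i) (xs ! Suc i))"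
    for P :: "'x \<Rightarrow> 'x \<Rightarrow> bool" and xs
  proof (induction P xs rule: successively.induct)
    case (3 P x y xs)
    have "(\<forall>i. Suc i < length (x # y # xs) \<longrightarrow> P ((x # y # xs) ! i) ((x # y # xs) ! Suc i)) \<longleftrightarrow>
        P x y \<and> (\<forall>i. Suc i < length (y # xs) \<longrightarrow> P ((y # xs) ! i) ((y # xs) ! Suc i))"
      by (auto simp: less_Suc_eq_0_disj nth_Cons split: nat.splits)
    then show ?case using 3 by simp
  qed auto
  show ?thesis
    unfolding composition_series_def * using simple_section_iff
    by (meson Suc_lessD nth_mem)
qed

text \<open>A submodule of least cardinality among those strictly above \<open>A\<close> and inside
  \<open>B\<close> covers \<open>A\<close>; induction on the size of \<open>B - A\<close> supplies
  the rest of the chain.\<close>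

lemma simple_sections_between:
  assumes "finite (carrier M)" "submod \<Gamma> A M" "submod \<Gamma> B M" "A \<subseteq> B"
  shows "\<exists>Ns. Ns \<noteq> [] \<and> hd Ns = A \<and> last Ns = B \<and> (\<forall>N\<in>set Ns. submod \<Gamma> N M) \<and>
    successively simple_section Ns"
  using assms(2,4)
proof (induction "card (B - A)" arbitrary: A rule: less_induct)
  case less
  have finB: "finite B" using assms(1) submodD(1)[OF assms(3)] finite_subset by blast
  show ?case
  proof (cases "A = B")
    case True
    then show ?thesis using less by (intro exI[of _ "[A]"]) auto
  next
    case False
    define P where "P = (\<lambda>K. submod \<Gamma> K M \<and> A \<subset> K \<and> K \<subseteq> B)"
    have "P B" using False less assms(3) by (auto simp: P_def)
    then obtain K where K: "P K" "\<And>L. P L \<Longrightarrow> card K \<le> card L"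
      using ex_has_least_nat[of P B card] by blast
    have ss: "simple_section A K"
      unfolding simple_section_def
    proof (intro conjI allI impI)
      fix L assume L: "submod \<Gamma> L M \<and> A \<subseteq> L \<and> L \<subseteq> K"
      show "L = A \<or> L = K"
      proof (cases "L = A")
        case False
        then have "P L" using L K(1) by (auto simp: P_def)
        then have "card K \<le> card L" by (rule K)
        moreover have "finite K" using K(1) finB finite_subset by (auto simp: P_def)
        ultimately show ?thesis using L card_seteq by blast
      qed simp
    qed (use K less in \<open>auto simp: P_def\<close>)
    have "card (B - K) < card (B - A)"
      using K(1) finB by (intro psubset_card_mono) (auto simp: P_def)
    then obtain Ns where Ns: "Ns \<noteq> []" "hd Ns = K" "last Ns = B" "\<forall>N\<in>set Ns. submod \<Gamma> N M"
      "successively simple_section Ns"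
      using less(1)[of K] K(1) by (auto simp: P_def)
    then show ?thesis
      using less ss by (intro exI[of _ "A # Ns"]) (auto simp: successively_Cons)
  qed
qed

text \<open>Chains from zero to the lower submodule and from the upper one to \<open>M\<close>
  complete a simple section to a composition series, so the series itself can be forgotten.\<close>

lemma composition_factor_iff:
  assumes "finite (carrier M)"
  shows "composition_factor \<Gamma> M Q \<longleftrightarrow>
    (\<exists>N\<^sub>1 N\<^sub>2. simple_section N\<^sub>1 N\<^sub>2 \<and> Q = quot_gmodule (M\<lparr>carrier := N\<^sub>2\<rparr>) N\<^sub>1)"
proof
  assume "composition_factor \<Gamma> M Q"
  then obtain Ns i where *: "composition_series \<Gamma> M Ns" "Suc i < length Ns"
    "Q = quot_gmodule (M\<lparr>carrier := Ns ! Suc i\<rparr>) (Ns ! i)"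
    by (auto simp: composition_factor_def)
  then have "simple_section (Ns ! i) (Ns ! Suc i)"
    by (subst simple_section_iff) (auto simp: composition_series_def)
  then show "\<exists>N\<^sub>1 N\<^sub>2. simple_section N\<^sub>1 N\<^sub>2 \<and> Q = quot_gmodule (M\<lparr>carrier := N\<^sub>2\<rparr>) N\<^sub>1"
    using * by blast
next
  assume "\<exists>N\<^sub>1 N\<^sub>2. simple_section N\<^sub>1 N\<^sub>2 \<and> Q = quot_gmodule (M\<lparr>carrier := N\<^sub>2\<rparr>) N\<^sub>1"
  then obtain N1 N2 where N: "simple_section N1 N2" "Q = quot_gmodule (M\<lparr>carrier := N2\<rparr>) N1"
    by blast
  have sub: "submod \<Gamma> N1 M" "submod \<Gamma> N2 M" using N by (auto simp: simple_section_def)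
  obtain As where As: "As \<noteq> []" "hd As = {\<one>}" "last As = N1" "\<forall>N\<in>set As. submod \<Gamma> N M"
    "successively simple_section As"
    using simple_sections_between[OF assms submod_one sub(1)] submodD(2)[OF sub(1)] by auto
  obtain Bs where Bs: "Bs \<noteq> []" "hd Bs = N2" "last Bs = carrier M" "\<forall>N\<in>set Bs. submod \<Gamma> N M"
    "successively simple_section Bs"
    using simple_sections_between[OF assms sub(2) submod_carrier] submodD(1)[OF sub(2)] by auto
  have "composition_series \<Gamma> M (As @ Bs)"
    unfolding composition_series_iff using As Bs N by (auto simp: successively_append_iff)
  \<comment> \<open>The section sits where the lists meet: the last entry of \<open>As\<close> and
    the first of \<open>Bs\<close>.\<close>
  moreover have "(As @ Bs) ! (length As - 1) = N1" "(As @ Bs) ! Suc (length As - 1) = N2"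
    "Suc (length As - 1) < length (As @ Bs)"
    using As Bs by (auto simp: nth_append last_conv_nth hd_conv_nth)
  ultimately show "composition_factor \<Gamma> M Q"
    unfolding composition_factor_def using N by metis
qed

end

section \<open>Homomorphisms, isomorphisms and factors obtained from them\<close>

lemma gmodule_homD:
  assumes "\<phi> \<in> gmodule_hom \<Gamma> A B" "gmod \<Gamma> A" "gmod \<Gamma> B"
  shows "\<And>x. x \<in> carrier A \<Longrightarrow> \<phi> x \<in> carrier B"
    "\<And>x y. x \<in> carrier A \<Longrightarrow> y \<in> carrier A \<Longrightarrow> \<phi> (x \<otimes>\<^bsub>A\<^esub> y) = \<phi> x \<otimes>\<^bsub>B\<^esub> \<phi> y"
    "\<And>c x. x \<in> carrier A \<Longrightarrow> \<phi> (scal A c x) = scal B c (\<phi> x)"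
    "\<And>g x. g \<in> carrier \<Gamma> \<Longrightarrow> x \<in> carrier A \<Longrightarrow> \<phi> (act A g x) = act B g (\<phi> x)"
    "\<phi> \<one>\<^bsub>A\<^esub> = \<one>\<^bsub>B\<^esub>"
proof -
  interpret A: gmod \<Gamma> A by fact
  interpret B: gmod \<Gamma> B by fact
  have h: "\<phi> \<in> hom A B" using assms(1) by (simp add: gmodule_hom_def)
  then show "\<And>x. x \<in> carrier A \<Longrightarrow> \<phi> x \<in> carrier B"
    "\<And>x y. x \<in> carrier A \<Longrightarrow> y \<in> carrier A \<Longrightarrow> \<phi> (x \<otimes>\<^bsub>A\<^esub> y) = \<phi> x \<otimes>\<^bsub>B\<^esub> \<phi> y"
    by (auto simp: hom_def)
  show "\<And>c x. x \<in> carrier A \<Longrightarrow> \<phi> (scal A c x) = scal B c (\<phi> x)"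
    "\<And>g x. g \<in> carrier \<Gamma> \<Longrightarrow> x \<in> carrier A \<Longrightarrow> \<phi> (act A g x) = act B g (\<phi> x)"
    using assms(1) by (simp_all add: gmodule_hom_def)
  show "\<phi> \<one>\<^bsub>A\<^esub> = \<one>\<^bsub>B\<^esub>"
    by (rule hom_one[OF h A.is_group B.is_group])
qed

lemma gmodule_homI:
  assumes "\<And>x. x \<in> carrier A \<Longrightarrow> \<phi> x \<in> carrier B"
    "\<And>x y. x \<in> carrier A \<Longrightarrow> y \<in> carrier A \<Longrightarrow> \<phi> (x \<otimes>\<^bsub>A\<^esub> y) = \<phi> x \<otimes>\<^bsub>B\<^esub> \<phi> y"
    "\<And>c x. x \<in> carrier A \<Longrightarrow> \<phi> (scal A c x) = scal B c (\<phi> x)"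
    "\<And>g x. g \<in> carrier \<Gamma> \<Longrightarrow> x \<in> carrier A \<Longrightarrow> \<phi> (act A g x) = act B g (\<phi> x)"
  shows "\<phi> \<in> gmodule_hom \<Gamma> A B"
  using assms by (auto simp: gmodule_hom_def hom_def)

lemma gmodule_isomorphic_sym:
  assumes "gmodule_isomorphic \<Gamma> A B" "gmod \<Gamma> A" "gmod \<Gamma> B"
  shows "gmodule_isomorphic \<Gamma> B A"
proof -
  interpret A: gmod \<Gamma> A by fact
  interpret B: gmod \<Gamma> B by fact
  obtain \<phi> where \<phi>: "\<phi> \<in> gmodule_hom \<Gamma> A B" "bij_betw \<phi> (carrier A) (carrier B)"
    using assms(1) by (auto simp: gmodule_isomorphic_def)
  note h = gmodule_homD[OF \<phi>(1) assms(2,3)]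
  define \<psi> where "\<psi> = inv_into (carrier A) \<phi>"
  have inj: "inj_on \<phi> (carrier A)" and img: "\<phi> ` carrier A = carrier B"
    using \<phi>(2) by (auto simp: bij_betw_def)
  have cl: "\<psi> y \<in> carrier A" if "y \<in> carrier B" for y
    using that unfolding \<psi>_def img[symmetric] by (rule inv_into_into)
  have r: "\<phi> (\<psi> y) = y" if "y \<in> carrier B" for y
    using that unfolding \<psi>_def img[symmetric] by (rule f_inv_into_f)
  have eqI: "x = x'" if "x \<in> carrier A" "x' \<in> carrier A" "\<phi> x = \<phi> x'" for x x'
    using inj that by (auto dest: inj_onD)
  have "\<psi> \<in> gmodule_hom \<Gamma> B A"
    by (rule gmodule_homI; (intro eqI)?) (simp_all add: cl r h)
  moreover have "bij_betw \<psi> (carrier B) (carrier A)"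
    unfolding \<psi>_def using \<phi>(2) by (rule bij_betw_inv_into)
  ultimately show ?thesis by (auto simp: gmodule_isomorphic_def)
qed

lemma gmodule_isomorphic_trans:
  assumes "gmodule_isomorphic \<Gamma> A B" "gmodule_isomorphic \<Gamma> B C"
    "gmod \<Gamma> A" "gmod \<Gamma> B" "gmod \<Gamma> C"
  shows "gmodule_isomorphic \<Gamma> A C"
proof -
  obtain \<phi> where \<phi>: "\<phi> \<in> gmodule_hom \<Gamma> A B" "bij_betw \<phi> (carrier A) (carrier B)"
    using assms(1) by (auto simp: gmodule_isomorphic_def)
  obtain \<psi> where \<psi>: "\<psi> \<in> gmodule_hom \<Gamma> B C" "bij_betw \<psi> (carrier B) (carrier C)"
    using assms(2) by (auto simp: gmodule_isomorphic_def)
  have "\<psi> \<circ> \<phi> \<in> gmodule_hom \<Gamma> A C"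
    by (rule gmodule_homI)
      (simp_all add: gmodule_homD[OF \<phi>(1) assms(3,4)] gmodule_homD[OF \<psi>(1) assms(4,5)])
  then show ?thesis
    using bij_betw_trans[OF \<phi>(2) \<psi>(2)] by (auto simp: gmodule_isomorphic_def)
qed

lemma irreducible_gmodule_iso:
  assumes "gmodule_isomorphic \<Gamma> A B" "gmod \<Gamma> A" "gmod \<Gamma> B" "irreducible_gmodule \<Gamma> B"
  shows "irreducible_gmodule \<Gamma> A"
proof -
  interpret A: gmod \<Gamma> A by fact
  interpret B: gmod \<Gamma> B by fact
  obtain \<phi> where \<phi>: "\<phi> \<in> gmodule_hom \<Gamma> A B" "bij_betw \<phi> (carrier A) (carrier B)"
    using assms(1) by (auto simp: gmodule_isomorphic_def)
  note h = gmodule_homD[OF \<phi>(1) assms(2,3)]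
  have inj: "inj_on \<phi> (carrier A)" and img: "\<phi> ` carrier A = carrier B"
    using \<phi>(2) by (auto simp: bij_betw_def)
  have irr: "carrier B \<noteq> {\<one>\<^bsub>B\<^esub>}" "\<And>N. submod \<Gamma> N B \<Longrightarrow> N = {\<one>\<^bsub>B\<^esub>} \<or> N = carrier B"
    using assms(4) by (auto simp: irreducible_gmodule_def)
  have "carrier A \<noteq> {\<one>\<^bsub>A\<^esub>}" using irr(1) img h(5) by auto
  moreover have "N = {\<one>\<^bsub>A\<^esub>} \<or> N = carrier A" if N: "submod \<Gamma> N A" for N
  proof -
    note ND = A.submodD[OF N]
    have "submod \<Gamma> (\<phi> ` N) B"
    proof (rule B.submodI)
      show "\<one>\<^bsub>B\<^esub> \<in> \<phi> ` N" using h(5) ND(2) by (metis imageI)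
    qed (use ND h in \<open>auto simp: h(2-4)[symmetric] ND(8)\<close>)
    then have "\<phi> ` N = {\<one>\<^bsub>B\<^esub>} \<or> \<phi> ` N = carrier B" by (rule irr)
    then have "\<phi> ` N = \<phi> ` {\<one>\<^bsub>A\<^esub>} \<or> \<phi> ` N = \<phi> ` carrier A" using h(5) img by auto
    then show ?thesis
      using inj_on_image_eq_iff[OF inj ND(1), of "{\<one>\<^bsub>A\<^esub>}"] inj_on_image_eq_iff[OF inj ND(1) subset_refl]
      by blast
  qed
  ultimately show ?thesis by (auto simp: irreducible_gmodule_def)
qed

context gmod
begin

lemma quot_hom:
  assumes "submod \<Gamma> N M"
  shows "(\<lambda>x. N #> x) \<in> gmodule_hom \<Gamma> M (quot_gmodule M N)"
  by (rule gmodule_homI) (simp_all add: carrier_quot mult_quot scal_quot act_quot assms)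

text \<open>\<open>f\<close> is constant on the cosets of its kernel, so the image of a coset is a
  singleton and \<open>the_elem\<close> extracts the induced value.\<close>

lemma first_iso:
  assumes X: "gmod \<Gamma> X" and f: "f \<in> gmodule_hom \<Gamma> M X" and onto: "f ` carrier M = carrier X"
    and N: "submod \<Gamma> N M" and ker: "N = {x \<in> carrier M. f x = \<one>\<^bsub>X\<^esub>}"
  shows "gmodule_isomorphic \<Gamma> (quot_gmodule M N) X"
proof -
  interpret X: gmod \<Gamma> X by fact
  note h = gmodule_homD[OF f gmod_axioms X]
  define \<phi> where "\<phi> = (\<lambda>C. the_elem (f ` C))"
  have eq: "\<phi> (N #> x) = f x" if x: "x \<in> carrier M" for x
  proof -
    have "f y = f x" if y: "y \<in> N #> x" for y
    proof -
      obtain n where n: "n \<in> N" "y = n \<otimes> x" using y unfolding r_coset_def by auto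
      then have "f n = \<one>\<^bsub>X\<^esub>" "n \<in> carrier M" using ker by auto
      then show ?thesis using n x h by simp
    qed
    then have "f ` (N #> x) = {f x}"
      using rcos_self[OF x submodD(7)[OF N]] by blast
    then show ?thesis by (simp add: \<phi>_def)
  qed
  have "\<phi> \<in> gmodule_hom \<Gamma> (quot_gmodule M N) X"
    by (rule gmodule_homI)
      (auto simp: carrier_quot eq h mult_quot[OF N] scal_quot[OF N] act_quot[OF N])
  moreover have "bij_betw \<phi> (carrier (quot_gmodule M N)) (carrier X)"
    unfolding bij_betw_def
  proof
    show "inj_on \<phi> (carrier (quot_gmodule M N))"
    proof (rule inj_onI, clarsimp simp: carrier_quot)
      fix x y assume xy: "x \<in> carrier M" "y \<in> carrier M" "\<phi> (N #> x) = \<phi> (N #> y)"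
      have "f (inv y) = inv\<^bsub>X\<^esub> f y" using xy h by (simp add: inv_eq_scal X.inv_eq_scal)
      then have "f (x \<otimes> inv y) = \<one>\<^bsub>X\<^esub>" using xy h by (simp add: eq)
      then show "N #> x = N #> y" using xy coset_eq_iff[OF N] ker by simp
    qed
    show "\<phi> ` carrier (quot_gmodule M N) = carrier X"
      unfolding carrier_quot image_image onto[symmetric] by (rule image_cong) (auto simp: eq)
  qed
  ultimately show ?thesis by (auto simp: gmodule_isomorphic_def)
qed

text \<open>To exhibit a factor it is enough to map a submodule onto a known irreducible module: its
  kernel is then maximal in that submodule, and the two form a simple section.\<close>

lemma composition_factor_onto:
  assumes fin: "finite (carrier M)" and X: "gmod \<Gamma> X" "irreducible_gmodule \<Gamma> X"
    and N: "submod \<Gamma> N\<^sub>1 M" "submod \<Gamma> N\<^sub>2 M"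
    and f: "f \<in> gmodule_hom \<Gamma> (M\<lparr>carrier := N\<^sub>2\<rparr>) X" "f ` N\<^sub>2 = carrier X"
    and ker: "N\<^sub>1 = {x \<in> N\<^sub>2. f x = \<one>\<^bsub>X\<^esub>}"
  shows "\<exists>Q. composition_factor \<Gamma> M Q \<and> gmod \<Gamma> Q \<and> gmodule_isomorphic \<Gamma> Q X"
proof -
  interpret S: gmod \<Gamma> "M\<lparr>carrier := N\<^sub>2\<rparr>" by (rule gmod_sub[OF N(2)])
  let ?Q = "quot_gmodule (M\<lparr>carrier := N\<^sub>2\<rparr>) N\<^sub>1"
  have sub: "submod \<Gamma> N\<^sub>1 (M\<lparr>carrier := N\<^sub>2\<rparr>)" using N(1) ker submod_sub_iff[OF N(2)] by blast
  have iso: "gmodule_isomorphic \<Gamma> ?Q X"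
    using S.first_iso[OF X(1) f(1) _ sub] f(2) ker by simp
  have Q: "gmod \<Gamma> ?Q" by (rule S.gmod_quot[OF sub])
  have "simple_section N\<^sub>1 N\<^sub>2"
    using simple_section_iff[OF N] ker irreducible_gmodule_iso[OF iso Q X] by blast
  then show ?thesis using composition_factor_iff[OF fin] iso Q by blast
qed

end

lemma common_composition_factorI:
  assumes "gmod \<Gamma> M" "finite (carrier M)" "gmod \<Gamma> M'" "finite (carrier M')"
    and X: "gmod \<Gamma> X" "irreducible_gmodule \<Gamma> X"
    and N: "submod \<Gamma> N\<^sub>1 M" "submod \<Gamma> N\<^sub>2 M"
    and f: "f \<in> gmodule_hom \<Gamma> (M\<lparr>carrier := N\<^sub>2\<rparr>) X" "f ` N\<^sub>2 = carrier X"
      "N\<^sub>1 = {x \<in> N\<^sub>2. f x = \<one>\<^bsub>X\<^esub>}"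
    and N': "submod \<Gamma> N'\<^sub>1 M'" "submod \<Gamma> N'\<^sub>2 M'"
    and f': "f' \<in> gmodule_hom \<Gamma> (M'\<lparr>carrier := N'\<^sub>2\<rparr>) X" "f' ` N'\<^sub>2 = carrier X"
      "N'\<^sub>1 = {x \<in> N'\<^sub>2. f' x = \<one>\<^bsub>X\<^esub>}"
  shows "common_composition_factor \<Gamma> M M'"
proof -
  obtain Q where Q: "composition_factor \<Gamma> M Q" "gmod \<Gamma> Q" "gmodule_isomorphic \<Gamma> Q X"
    using gmod.composition_factor_onto[OF assms(1,2) X N f] by blast
  obtain Q' where Q': "composition_factor \<Gamma> M' Q'" "gmod \<Gamma> Q'" "gmodule_isomorphic \<Gamma> Q' X"
    using gmod.composition_factor_onto[OF assms(3,4) X N' f'] by blast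
  have "gmodule_isomorphic \<Gamma> Q Q'"
    using gmodule_isomorphic_trans[OF Q(3) gmodule_isomorphic_sym[OF Q'(3,2) X(1)]] Q Q' X by blast
  then show ?thesis using Q Q' by (auto simp: common_composition_factor_def)
qed

text \<open>Horner evaluation of a polynomial at the operator \<open>act M g\<close>, constant
  coefficient first. Whether such an operator is zero is invariant under isomorphism, which makes it
  a test for telling factors apart.\<close>

fun peval :: "('a, 'k, 'g) gmodule \<Rightarrow> 'g \<Rightarrow> 'k list \<Rightarrow> 'a \<Rightarrow> 'a" where
  "peval M g [] x = \<one>\<^bsub>M\<^esub>"
| "peval M g (c # cs) x = scal M c x \<otimes>\<^bsub>M\<^esub> act M g (peval M g cs x)"

lemma peval_sub [simp]: "peval (M\<lparr>carrier := N\<rparr>) g cs x = peval M g cs x"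
  by (induction cs) simp_all

context gmod
begin

lemma peval_submod: "submod \<Gamma> N M \<Longrightarrow> g \<in> carrier \<Gamma> \<Longrightarrow> x \<in> N \<Longrightarrow> peval M g cs x \<in> N"
  by (induction cs) (auto simp: submodD)

lemma peval_closed [simp]: "g \<in> carrier \<Gamma> \<Longrightarrow> x \<in> carrier M \<Longrightarrow> peval M g cs x \<in> carrier M"
  by (rule peval_submod[OF submod_carrier])

lemma peval_mult:
  assumes "g \<in> carrier \<Gamma>" "x \<in> carrier M" "y \<in> carrier M"
  shows "peval M g cs (x \<otimes> y) = peval M g cs x \<otimes> peval M g cs y"
  using assms by (induction cs) (simp_all add: scal_mult act_mult m_ac)

lemma peval_hom:
  assumes "gmod \<Gamma> B" "\<phi> \<in> gmodule_hom \<Gamma> M B" "g \<in> carrier \<Gamma>" "x \<in> carrier M"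
  shows "\<phi> (peval M g cs x) = peval B g cs (\<phi> x)"
  using assms(3,4) by (induction cs) (simp_all add: gmodule_homD[OF assms(2) gmod_axioms assms(1)])

text \<open>Rephrases annihilation of a quotient as a containment in \<open>M\<close>, so later
  arguments never compute with cosets.\<close>

lemma peval_section_iff:
  assumes N: "submod \<Gamma> N\<^sub>1 M" "submod \<Gamma> N\<^sub>2 M" "N\<^sub>1 \<subseteq> N\<^sub>2" and g: "g \<in> carrier \<Gamma>"
  defines "Q \<equiv> quot_gmodule (M\<lparr>carrier := N\<^sub>2\<rparr>) N\<^sub>1"
  shows "(\<forall>x\<in>N\<^sub>2. peval M g cs x \<in> N\<^sub>1) \<longleftrightarrow> (\<forall>x\<in>carrier Q. peval Q g cs x = \<one>\<^bsub>Q\<^esub>)"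
proof -
  interpret S: gmod \<Gamma> "M\<lparr>carrier := N\<^sub>2\<rparr>" by (rule gmod_sub[OF N(2)])
  have sub: "submod \<Gamma> N\<^sub>1 (M\<lparr>carrier := N\<^sub>2\<rparr>)" using N(1,3) submod_sub_iff[OF N(2)] by blast
  have "peval Q g cs (N\<^sub>1 #> x) = \<one>\<^bsub>Q\<^esub> \<longleftrightarrow> peval M g cs x \<in> N\<^sub>1" if x: "x \<in> N\<^sub>2" for x
  proof -
    have "peval Q g cs (N\<^sub>1 #> x) = N\<^sub>1 #> peval M g cs x"
      using S.peval_hom[OF S.gmod_quot[OF sub] S.quot_hom[OF sub] g, of x cs] x by (simp add: Q_def)
    moreover have "\<one>\<^bsub>Q\<^esub> = N\<^sub>1 #> \<one>" unfolding Q_def S.one_quot using submodD(1)[OF N(1)] by simp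
    moreover have "peval M g cs x \<in> carrier M" using x submodD(1)[OF N(2)] g by auto
    ultimately show ?thesis using coset_eq_iff[OF N(1) _ one_closed] by simp
  qed
  then show ?thesis by (auto simp: Q_def S.carrier_quot)
qed

text \<open>The sum of \<open>N\<^sub>1\<close> and \<open>N\<^sub>2 \<inter> K\<close> lies between
  the two ends of the section, hence equals one of them.\<close>

lemma simple_section_cover:
  assumes s: "simple_section N\<^sub>1 N\<^sub>2" and K: "submod \<Gamma> K M"
  shows "N\<^sub>2 \<inter> K \<subseteq> N\<^sub>1 \<or> (\<forall>x\<in>N\<^sub>2. \<exists>n\<in>N\<^sub>1. \<exists>k\<in>N\<^sub>2 \<inter> K. x = n \<otimes> k)"
proof -
  have N: "submod \<Gamma> N\<^sub>1 M" "submod \<Gamma> N\<^sub>2 M" "N\<^sub>1 \<subseteq> N\<^sub>2"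
    using s by (auto simp: simple_section_def)
  note D = submodD[OF N(1)] and E = submodD[OF submod_Int[OF N(2) K]] and N2 = submodD[OF N(2)]
  let ?L = "{n \<otimes> k | n k. n \<in> N\<^sub>1 \<and> k \<in> N\<^sub>2 \<inter> K}"
  have "submod \<Gamma> ?L M"
  proof (rule submodI)
    show "?L \<subseteq> carrier M" using D(8) E(8) by auto
    have "\<one> = \<one> \<otimes> \<one>" by simp
    then show "\<one> \<in> ?L" using D(2) E(2) by blast
    show "x \<otimes> y \<in> ?L" if xy: "x \<in> ?L" "y \<in> ?L" for x y
    proof -
      obtain n k n' k' where nk: "x = n \<otimes> k" "y = n' \<otimes> k'" "n \<in> N\<^sub>1" "n' \<in> N\<^sub>1" "k \<in> N\<^sub>2 \<inter> K" "k' \<in> N\<^sub>2 \<inter> K"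
        using xy by blast
      then have "x \<otimes> y = (n \<otimes> n') \<otimes> (k \<otimes> k')" using D(8) E(8) by (simp add: m_ac)
      then show ?thesis using nk D(3) E(3) by blast
    qed
    show "scal M c x \<in> ?L" if x: "x \<in> ?L" for c x
    proof -
      obtain n k where nk: "x = n \<otimes> k" "n \<in> N\<^sub>1" "k \<in> N\<^sub>2 \<inter> K" using x by blast
      then have "scal M c x = scal M c n \<otimes> scal M c k" using D(8) E(8) by (simp add: scal_mult)
      then show ?thesis using nk D(4) E(4) by blast
    qed
    show "act M g x \<in> ?L" if g: "g \<in> carrier \<Gamma>" and x: "x \<in> ?L" for g x
    proof -
      obtain n k where nk: "x = n \<otimes> k" "n \<in> N\<^sub>1" "k \<in> N\<^sub>2 \<inter> K" using x by blast
      then have "act M g x = act M g n \<otimes> act M g k" using g D(8) E(8) by (simp add: act_mult)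
      then show ?thesis using nk g D(5) E(5) by blast
    qed
  qed
  moreover have "N\<^sub>1 \<subseteq> ?L"
  proof
    fix n assume n: "n \<in> N\<^sub>1"
    then have "n = n \<otimes> \<one>" using D(8) by simp
    then show "n \<in> ?L" using n E(2) by blast
  qed
  moreover have "?L \<subseteq> N\<^sub>2" using N(3) N2(3) by auto
  ultimately have "?L = N\<^sub>1 \<or> ?L = N\<^sub>2" using s unfolding simple_section_def by blast
  moreover have "N\<^sub>2 \<inter> K \<subseteq> ?L"
  proof
    fix k assume k: "k \<in> N\<^sub>2 \<inter> K"
    then have "k = \<one> \<otimes> k" using E(8) by simp
    then show "k \<in> ?L" using k D(2) by blast
  qed
  ultimately show ?thesis by blast
qed

text \<open>One step down a filtration: if \<open>K'\<close> still represents every element of the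
  section, then either the polynomial kills the section or the next term \<open>K\<close> represents
  it too. At the zero submodule nothing is left to represent the section, so some step must kill it.
  The coefficients may vary with \<open>g\<close>, as the values of a character do.\<close>

lemma scalar_section_step:
  assumes s: "simple_section N\<^sub>1 N\<^sub>2" and K: "submod \<Gamma> K M"
    and cov: "\<forall>x\<in>N\<^sub>2. \<exists>n\<in>N\<^sub>1. \<exists>k\<in>N\<^sub>2 \<inter> K'. x = n \<otimes> k"
    and step: "\<forall>g\<in>carrier \<Gamma>. \<forall>x\<in>K'. peval M g (cs g) x \<in> K"
  shows "(\<forall>g\<in>carrier \<Gamma>. \<forall>x\<in>N\<^sub>2. peval M g (cs g) x \<in> N\<^sub>1) \<or>
    (\<forall>x\<in>N\<^sub>2. \<exists>n\<in>N\<^sub>1. \<exists>k\<in>N\<^sub>2 \<inter> K. x = n \<otimes> k)"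
proof (cases "N\<^sub>2 \<inter> K \<subseteq> N\<^sub>1")
  case True
  have N: "submod \<Gamma> N\<^sub>1 M" "submod \<Gamma> N\<^sub>2 M" "N\<^sub>1 \<subseteq> N\<^sub>2"
    using s by (auto simp: simple_section_def)
  have "peval M g (cs g) x \<in> N\<^sub>1" if g: "g \<in> carrier \<Gamma>" and x: "x \<in> N\<^sub>2" for g x
  proof -
    obtain n k where nk: "n \<in> N\<^sub>1" "k \<in> N\<^sub>2" "k \<in> K'" "x = n \<otimes> k" using cov x by blast
    have "peval M g (cs g) x = peval M g (cs g) n \<otimes> peval M g (cs g) k"
      using nk g submodD(8)[OF N(1)] submodD(8)[OF N(2)] by (simp add: peval_mult)
    moreover have "peval M g (cs g) k \<in> N\<^sub>1"
      using True step g nk(3) peval_submod[OF N(2) g nk(2)] by blast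
    ultimately show ?thesis
      using peval_submod[OF N(1) g nk(1)] submodD(3)[OF N(1)] by simp
  qed
  then show ?thesis by blast
next
  case False
  then show ?thesis using simple_section_cover[OF s K] by argo
qed

lemma simple_section_cover_carrier:
  assumes "simple_section N\<^sub>1 N\<^sub>2"
  shows "\<forall>x\<in>N\<^sub>2. \<exists>n\<in>N\<^sub>1. \<exists>k\<in>N\<^sub>2 \<inter> carrier M. x = n \<otimes> k"
proof
  fix x assume x: "x \<in> N\<^sub>2"
  have N: "submod \<Gamma> N\<^sub>1 M" "submod \<Gamma> N\<^sub>2 M" using assms by (auto simp: simple_section_def)
  have "x \<in> carrier M" using submodD(8)[OF N(2) x] .
  then have "x = \<one> \<otimes> x" by simp
  then show "\<exists>n\<in>N\<^sub>1. \<exists>k\<in>N\<^sub>2 \<inter> carrier M. x = n \<otimes> k"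
    using x \<open>x \<in> carrier M\<close> submodD(2)[OF N(1)] by blast
qed

lemma simple_section_not_cover_one:
  assumes "simple_section N\<^sub>1 N\<^sub>2"
  shows "\<not> (\<forall>x\<in>N\<^sub>2. \<exists>n\<in>N\<^sub>1. \<exists>k\<in>N\<^sub>2 \<inter> {\<one>}. x = n \<otimes> k)"
proof
  assume *: "\<forall>x\<in>N\<^sub>2. \<exists>n\<in>N\<^sub>1. \<exists>k\<in>N\<^sub>2 \<inter> {\<one>}. x = n \<otimes> k"
  have N: "submod \<Gamma> N\<^sub>1 M" "N\<^sub>1 \<subset> N\<^sub>2" using assms by (auto simp: simple_section_def)
  have "x \<in> N\<^sub>1" if "x \<in> N\<^sub>2" for x
  proof -
    obtain n where "n \<in> N\<^sub>1" "x = n \<otimes> \<one>" using * \<open>x \<in> N\<^sub>2\<close> by blast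
    then show ?thesis using submodD(8)[OF N(1)] by simp
  qed
  then show False using N(2) by blast
qed

section \<open>Cocycles, coboundaries and the vanishing of the first cohomology group\<close>

lemma group_cocycles:
  assumes cl: "\<And>g h. g \<in> carrier \<Gamma> \<Longrightarrow> h \<in> carrier \<Gamma> \<Longrightarrow> g \<otimes>\<^bsub>\<Gamma>\<^esub> h \<in> carrier \<Gamma>"
  shows "comm_group (cocycles \<Gamma> M)"
proof (rule comm_groupI)
  fix x assume x: "x \<in> carrier (cocycles \<Gamma> M)"
  let ?y = "\<lambda>g\<in>carrier \<Gamma>. inv (x g)"
  have xc: "x g \<in> carrier M" if "g \<in> carrier \<Gamma>" for g using x that by (auto simp: cocycles_def)
  have coc: "x (g \<otimes>\<^bsub>\<Gamma>\<^esub> h) = x g \<otimes> act M g (x h)" if "g \<in> carrier \<Gamma>" "h \<in> carrier \<Gamma>" for g h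
    using x that by (auto simp: cocycles_def)
  have "?y \<in> carrier (cocycles \<Gamma> M)"
    unfolding cocycles_def
    using cl xc coc by (auto simp: inv_eq_scal scal_mult act_scal)
  moreover have "?y \<otimes>\<^bsub>cocycles \<Gamma> M\<^esub> x = \<one>\<^bsub>cocycles \<Gamma> M\<^esub>"
    by (auto simp: cocycles_def xc)
  ultimately show "\<exists>y\<in>carrier (cocycles \<Gamma> M). y \<otimes>\<^bsub>cocycles \<Gamma> M\<^esub> x = \<one>\<^bsub>cocycles \<Gamma> M\<^esub>" by blast
next
  fix x y assume "x \<in> carrier (cocycles \<Gamma> M)" "y \<in> carrier (cocycles \<Gamma> M)"
  then show "x \<otimes>\<^bsub>cocycles \<Gamma> M\<^esub> y \<in> carrier (cocycles \<Gamma> M)"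
    by (auto simp: cocycles_def cl act_mult m_ac Pi_iff PiE_iff)
next
  show "\<one>\<^bsub>cocycles \<Gamma> M\<^esub> \<in> carrier (cocycles \<Gamma> M)"
    by (auto simp: cocycles_def cl)
next
  fix x assume "x \<in> carrier (cocycles \<Gamma> M)"
  then show "\<one>\<^bsub>cocycles \<Gamma> M\<^esub> \<otimes>\<^bsub>cocycles \<Gamma> M\<^esub> x = x"
    by (auto simp: cocycles_def PiE_iff extensional_def fun_eq_iff)
qed (auto simp: cocycles_def m_ac PiE_iff intro!: restrict_ext)

text \<open>Cocycles and coboundaries coincide, so the quotient is that of a group by itself. The
  axioms of \<open>gmod\<close> speak of one element of \<open>\<Gamma>\<close> at a time; that the
  action respects products, which makes coboundaries cocycles, enters as
  \<open>actact\<close>.\<close>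

lemma trivial_H1I:
  assumes cl: "\<And>g h. g \<in> carrier \<Gamma> \<Longrightarrow> h \<in> carrier \<Gamma> \<Longrightarrow> g \<otimes>\<^bsub>\<Gamma>\<^esub> h \<in> carrier \<Gamma>"
    and actact: "\<And>g h x. g \<in> carrier \<Gamma> \<Longrightarrow> h \<in> carrier \<Gamma> \<Longrightarrow> x \<in> carrier M \<Longrightarrow>
      act M (g \<otimes>\<^bsub>\<Gamma>\<^esub> h) x = act M g (act M h x)"
    and cob: "\<And>f. f \<in> carrier \<Gamma> \<rightarrow>\<^sub>E carrier M \<Longrightarrow>
      (\<And>g h. g \<in> carrier \<Gamma> \<Longrightarrow> h \<in> carrier \<Gamma> \<Longrightarrow> f (g \<otimes>\<^bsub>\<Gamma>\<^esub> h) = f g \<otimes> act M g (f h)) \<Longrightarrow>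
      \<exists>v\<in>carrier M. \<forall>g\<in>carrier \<Gamma>. f g = act M g v \<otimes> inv v"
  shows "trivial_group (H1 \<Gamma> M)"
proof -
  interpret Z: comm_group "cocycles \<Gamma> M" by (rule group_cocycles[OF cl])
  have "coboundaries \<Gamma> M = carrier (cocycles \<Gamma> M)"
  proof
    show "coboundaries \<Gamma> M \<subseteq> carrier (cocycles \<Gamma> M)"
    proof
      fix f assume "f \<in> coboundaries \<Gamma> M"
      then obtain v where v: "v \<in> carrier M" "f = (\<lambda>g\<in>carrier \<Gamma>. act M g v \<otimes> inv v)"
        by (auto simp: coboundaries_def)
      have "act M (g \<otimes>\<^bsub>\<Gamma>\<^esub> h) v \<otimes> inv v = act M g v \<otimes> inv v \<otimes> act M g (act M h v \<otimes> inv v)"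
        if gh: "g \<in> carrier \<Gamma>" "h \<in> carrier \<Gamma>" for g h
      proof -
        have i: "act M g (inv v) = inv (act M g v)"
          using gh v by (simp add: inv_eq_scal act_scal)
        have "act M g v \<otimes> inv v \<otimes> act M g (act M h v \<otimes> inv v) =
          (act M g v \<otimes> inv (act M g v)) \<otimes> (act M g (act M h v) \<otimes> inv v)"
          unfolding act_mult[OF gh(1) act_closed[OF gh(2) v(1)] inv_closed[OF v(1)]] i
          using gh v by (simp only: m_ac act_closed inv_closed m_closed)
        then show ?thesis using gh v by (simp add: actact)
      qed
      then show "f \<in> carrier (cocycles \<Gamma> M)" using v by (auto simp: cocycles_def cl)
    qed
    show "carrier (cocycles \<Gamma> M) \<subseteq> coboundaries \<Gamma> M"
    proof
      fix f assume "f \<in> carrier (cocycles \<Gamma> M)"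
      then have f: "f \<in> carrier \<Gamma> \<rightarrow>\<^sub>E carrier M"
        "\<And>g h. g \<in> carrier \<Gamma> \<Longrightarrow> h \<in> carrier \<Gamma> \<Longrightarrow> f (g \<otimes>\<^bsub>\<Gamma>\<^esub> h) = f g \<otimes> act M g (f h)"
        by (auto simp: cocycles_def)
      then obtain v where "v \<in> carrier M" "\<forall>g\<in>carrier \<Gamma>. f g = act M g v \<otimes> inv v"
        using cob by blast
      then show "f \<in> coboundaries \<Gamma> M"
        unfolding coboundaries_def using f(1)
        by (intro image_eqI[of _ _ v]) (auto simp: PiE_iff extensional_def)
    qed
  qed
  moreover have n: "carrier (cocycles \<Gamma> M) \<lhd> cocycles \<Gamma> M"
    using Z.subgroup_imp_normal Z.subgroup_self by blast
  ultimately show ?thesis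
    using normal.factorgroup_is_group[OF n] Z.one_closed
    unfolding trivial_group_def H1_def
    by (simp add: carrier_FactGroup Z.coset_join2 Z.subgroup_self image_constant[OF Z.one_closed])
qed

end

text \<open>Isomorphic factors are annihilated by the same polynomials in each group element. Every
  refutation of a common factor below goes through this invariant.\<close>

lemma common_composition_factor_peval:
  assumes M: "gmod \<Gamma> M" "finite (carrier M)" and M': "gmod \<Gamma> M'" "finite (carrier M')"
    and common: "common_composition_factor \<Gamma> M M'"
  shows "\<exists>A\<^sub>1 A\<^sub>2 B\<^sub>1 B\<^sub>2. gmod.simple_section \<Gamma> M A\<^sub>1 A\<^sub>2 \<and> gmod.simple_section \<Gamma> M' B\<^sub>1 B\<^sub>2 \<and>
    (\<forall>g\<in>carrier \<Gamma>. \<forall>cs. (\<forall>x\<in>A\<^sub>2. peval M g cs x \<in> A\<^sub>1) \<longleftrightarrow> (\<forall>x\<in>B\<^sub>2. peval M' g cs x \<in> B\<^sub>1))"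
proof -
  interpret M: gmod \<Gamma> M by fact
  interpret M': gmod \<Gamma> M' by fact
  obtain A1 A2 B1 B2 where A: "M.simple_section A1 A2" and B: "M'.simple_section B1 B2"
    and iso: "gmodule_isomorphic \<Gamma> (quot_gmodule (M\<lparr>carrier := A2\<rparr>) A1) (quot_gmodule (M'\<lparr>carrier := B2\<rparr>) B1)"
    using common unfolding common_composition_factor_def
      M.composition_factor_iff[OF M(2)] M'.composition_factor_iff[OF M'(2)] by blast
  have A': "submod \<Gamma> A1 M" "submod \<Gamma> A2 M" "A1 \<subseteq> A2" using A by (auto simp: M.simple_section_def)
  have B': "submod \<Gamma> B1 M'" "submod \<Gamma> B2 M'" "B1 \<subseteq> B2" using B by (auto simp: M'.simple_section_def)
  let ?Q = "quot_gmodule (M\<lparr>carrier := A2\<rparr>) A1" and ?R = "quot_gmodule (M'\<lparr>carrier := B2\<rparr>) B1"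
  have gQ: "gmod \<Gamma> ?Q"
    using A' M.submod_sub_iff[OF A'(2)] by (intro gmod.gmod_quot M.gmod_sub) auto
  have gR: "gmod \<Gamma> ?R"
    using B' M'.submod_sub_iff[OF B'(2)] by (intro gmod.gmod_quot M'.gmod_sub) auto
  interpret Q: gmod \<Gamma> ?Q by fact
  interpret R: gmod \<Gamma> ?R by fact
  obtain \<phi> where \<phi>: "\<phi> \<in> gmodule_hom \<Gamma> ?Q ?R" "bij_betw \<phi> (carrier ?Q) (carrier ?R)"
    using iso by (auto simp: gmodule_isomorphic_def)
  note h = gmodule_homD[OF \<phi>(1) gQ gR]
  have "(\<forall>x\<in>carrier ?Q. peval ?Q g cs x = \<one>\<^bsub>?Q\<^esub>) \<longleftrightarrow> (\<forall>x\<in>carrier ?R. peval ?R g cs x = \<one>\<^bsub>?R\<^esub>)"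
    if g: "g \<in> carrier \<Gamma>" for g cs
  proof -
    have *: "peval ?R g cs (\<phi> x) = \<one>\<^bsub>?R\<^esub> \<longleftrightarrow> peval ?Q g cs x = \<one>\<^bsub>?Q\<^esub>" if "x \<in> carrier ?Q" for x
      using Q.peval_hom[OF gR \<phi>(1) g that, of cs] h(5) \<phi>(2) that g
      by (metis Q.one_closed Q.peval_closed bij_betw_def inj_onD)
    have img: "carrier ?R = \<phi> ` carrier ?Q" using \<phi>(2) by (simp add: bij_betw_def)
    show ?thesis unfolding img ball_simps(9) using * by (intro ball_cong) simp_all
  qed
  then have "(\<forall>x\<in>A2. peval M g cs x \<in> A1) \<longleftrightarrow> (\<forall>x\<in>B2. peval M' g cs x \<in> B1)"
    if "g \<in> carrier \<Gamma>" for g cs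
    unfolding M.peval_section_iff[OF A' that] M'.peval_section_iff[OF B' that] using that by simp
  then show ?thesis using A B by blast
qed

section \<open>Coordinates on a plane\<close>

abbreviation finv :: "('a \<Rightarrow> 'b) \<Rightarrow> 'b \<Rightarrow> 'a" where "finv f \<equiv> inv_into UNIV f"

text \<open>A basis is recorded together with its coordinate functions, so that a change of basis is
  one more interpretation and all matrix lemmas become available for it.\<close>

locale frame = vector_space scale
  for scale :: "'k::field \<Rightarrow> 'v::ab_group_add \<Rightarrow> 'v" (infixr "*s" 75) +
  fixes e\<^sub>1 e\<^sub>2 :: 'v and X Y :: "'v \<Rightarrow> 'k"
  assumes decomp: "v = X v *s e\<^sub>1 + Y v *s e\<^sub>2"
    and X_comb: "X (a *s e\<^sub>1 + b *s e\<^sub>2) = a"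
    and Y_comb: "Y (a *s e\<^sub>1 + b *s e\<^sub>2) = b"
begin

lemma add_comb: "u + v = (X u + X v) *s e\<^sub>1 + (Y u + Y v) *s e\<^sub>2"
  using decomp[of u] decomp[of v] by (simp add: scale_left_distrib algebra_simps)

lemma scale_comb: "c *s v = (c * X v) *s e\<^sub>1 + (c * Y v) *s e\<^sub>2"
  by (subst decomp[of v]) (simp add: scale_right_distrib)

lemma coord_simps [simp]:
  "X (u + v) = X u + X v" "Y (u + v) = Y u + Y v"
  "X (c *s v) = c * X v" "Y (c *s v) = c * Y v"
  "X 0 = 0" "Y 0 = 0" "X e\<^sub>1 = 1" "Y e\<^sub>1 = 0" "X e\<^sub>2 = 0" "Y e\<^sub>2 = 1"
proof -
  show "X (u + v) = X u + X v" "Y (u + v) = Y u + Y v"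
    by (simp_all only: add_comb[of u v] X_comb Y_comb)
  show "X (c *s v) = c * X v" "Y (c *s v) = c * Y v"
    by (simp_all only: scale_comb[of c v] X_comb Y_comb)
  show "X 0 = 0" "Y 0 = 0" using X_comb[of 0 0] Y_comb[of 0 0] by simp_all
  show "X e\<^sub>1 = 1" "Y e\<^sub>1 = 0" using X_comb[of 1 0] Y_comb[of 1 0] by simp_all
  show "X e\<^sub>2 = 0" "Y e\<^sub>2 = 1" using X_comb[of 0 1] Y_comb[of 0 1] by simp_all
qed

lemma coord_minus [simp]: "X (- v) = - X v" "Y (- v) = - Y v"
  using coord_simps(1)[of v "- v"] coord_simps(2)[of v "- v"]
  by (simp_all add: eq_neg_iff_add_eq_0 add.commute)

lemma coord_diff [simp]: "X (u - v) = X u - X v" "Y (u - v) = Y u - Y v"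
  using coord_simps(1)[of u "- v"] coord_simps(2)[of u "- v"] by simp_all

lemma vec_eq_iff: "u = v \<longleftrightarrow> X u = X v \<and> Y u = Y v"
  by (metis decomp)

abbreviation "lin \<equiv> Vector_Spaces.linear (*s) (*s)"

lemma lin_iff: "lin f \<longleftrightarrow> (\<forall>u v. f (u + v) = f u + f v) \<and> (\<forall>c v. f (c *s v) = c *s f v)"
  using vector_space_axioms by (auto simp: Vector_Spaces.linear_iff)

lemma linD:
  assumes "lin f"
  shows "f (u + v) = f u + f v" "f (c *s v) = c *s f v" "f 0 = 0" "f (- v) = - f v" "f (u - v) = f u - f v"
proof -
  have *: "f (u + v) = f u + f v" "f (c *s v) = c *s f v" for u v c using assms by (simp_all add: lin_iff)
  show "f (u + v) = f u + f v" "f (c *s v) = c *s f v" by (rule *)+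
  show "f 0 = 0" using *(2)[of 0 0] by simp
  show m: "f (- v) = - f v" for v using *(2)[of "-1" v] by simp
  show "f (u - v) = f u - f v" using *(1)[of u "- v"] m by simp
qed

definition "ent\<^sub>1\<^sub>1 f = X (f e\<^sub>1)"
definition "ent\<^sub>1\<^sub>2 f = X (f e\<^sub>2)"
definition "ent\<^sub>2\<^sub>1 f = Y (f e\<^sub>1)"
definition "ent\<^sub>2\<^sub>2 f = Y (f e\<^sub>2)"

lemmas ent_defs = ent\<^sub>1\<^sub>1_def ent\<^sub>1\<^sub>2_def ent\<^sub>2\<^sub>1_def ent\<^sub>2\<^sub>2_def

lemma coord_lin:
  assumes "lin f"
  shows "X (f v) = ent\<^sub>1\<^sub>1 f * X v + ent\<^sub>1\<^sub>2 f * Y v" "Y (f v) = ent\<^sub>2\<^sub>1 f * X v + ent\<^sub>2\<^sub>2 f * Y v"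
proof -
  have "f v = X v *s f e\<^sub>1 + Y v *s f e\<^sub>2"
    by (subst decomp[of v]) (simp only: linD[OF assms])
  then show "X (f v) = ent\<^sub>1\<^sub>1 f * X v + ent\<^sub>1\<^sub>2 f * Y v" "Y (f v) = ent\<^sub>2\<^sub>1 f * X v + ent\<^sub>2\<^sub>2 f * Y v"
    by (simp_all add: ent_defs mult.commute)
qed

lemma lin_eq_iff:
  assumes "lin f" "lin h"
  shows "f = h \<longleftrightarrow> ent\<^sub>1\<^sub>1 f = ent\<^sub>1\<^sub>1 h \<and> ent\<^sub>1\<^sub>2 f = ent\<^sub>1\<^sub>2 h \<and> ent\<^sub>2\<^sub>1 f = ent\<^sub>2\<^sub>1 h \<and> ent\<^sub>2\<^sub>2 f = ent\<^sub>2\<^sub>2 h"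
proof
  assume "ent\<^sub>1\<^sub>1 f = ent\<^sub>1\<^sub>1 h \<and> ent\<^sub>1\<^sub>2 f = ent\<^sub>1\<^sub>2 h \<and> ent\<^sub>2\<^sub>1 f = ent\<^sub>2\<^sub>1 h \<and> ent\<^sub>2\<^sub>2 f = ent\<^sub>2\<^sub>2 h"
  then show "f = h" by (simp add: fun_eq_iff vec_eq_iff coord_lin[OF assms(1)] coord_lin[OF assms(2)])
qed simp

lemma lin_id [simp]: "lin id" "lin (\<lambda>v. v)"
  by (simp_all add: lin_iff)

lemma lin_comp: "lin f \<Longrightarrow> lin h \<Longrightarrow> lin (f \<circ> h)"
  by (simp add: lin_iff)

lemma lin_inv: "lin f \<Longrightarrow> bij f \<Longrightarrow> lin (finv f)"
  unfolding lin_iff by (metis bij_inv_eq_iff)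

lemma ent_comp:
  assumes "lin f"
  shows "ent\<^sub>1\<^sub>1 (f \<circ> h) = ent\<^sub>1\<^sub>1 f * ent\<^sub>1\<^sub>1 h + ent\<^sub>1\<^sub>2 f * ent\<^sub>2\<^sub>1 h"
    "ent\<^sub>1\<^sub>2 (f \<circ> h) = ent\<^sub>1\<^sub>1 f * ent\<^sub>1\<^sub>2 h + ent\<^sub>1\<^sub>2 f * ent\<^sub>2\<^sub>2 h"
    "ent\<^sub>2\<^sub>1 (f \<circ> h) = ent\<^sub>2\<^sub>1 f * ent\<^sub>1\<^sub>1 h + ent\<^sub>2\<^sub>2 f * ent\<^sub>2\<^sub>1 h"
    "ent\<^sub>2\<^sub>2 (f \<circ> h) = ent\<^sub>2\<^sub>1 f * ent\<^sub>1\<^sub>2 h + ent\<^sub>2\<^sub>2 f * ent\<^sub>2\<^sub>2 h"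
  using coord_lin[OF assms, of "h e\<^sub>1"] coord_lin[OF assms, of "h e\<^sub>2"] by (simp_all add: ent_defs)

lemma ent_id [simp]: "ent\<^sub>1\<^sub>1 id = 1" "ent\<^sub>1\<^sub>2 id = 0" "ent\<^sub>2\<^sub>1 id = 0" "ent\<^sub>2\<^sub>2 id = 1"
  by (simp_all add: ent_defs)

definition "tr f = ent\<^sub>1\<^sub>1 f + ent\<^sub>2\<^sub>2 f"
definition "det f = ent\<^sub>1\<^sub>1 f * ent\<^sub>2\<^sub>2 f - ent\<^sub>1\<^sub>2 f * ent\<^sub>2\<^sub>1 f"

lemma det_comp: "lin f \<Longrightarrow> det (f \<circ> h) = det f * det h"
  by (simp add: det_def ent_comp algebra_simps)

lemma tr_det_id [simp]: "tr id = 2" "det id = 1"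
  by (simp_all add: tr_def det_def)

lemma det_inv: "lin f \<Longrightarrow> bij f \<Longrightarrow> det (finv f) * det f = 1"
  using det_comp[OF lin_inv, of f f] by (simp add: bij_is_inj inv_o_cancel)

lemma det_nonzero: "lin f \<Longrightarrow> bij f \<Longrightarrow> det f \<noteq> 0"
  using det_inv by force

lemma cayley_hamilton: "lin f \<Longrightarrow> f (f v) = tr f *s f v - det f *s v"
  by (simp add: vec_eq_iff coord_lin tr_def det_def algebra_simps)

text \<open>The assumption on the trace says that f - 1 has determinant 0. Up to sign
  \<open>?u\<close> and \<open>?v\<close> are the columns of the adjugate of f - 1, hence in its
  kernel; if both vanish, \<open>f\<close> is the identity.\<close>

lemma ex_fixed_vector:
  assumes "lin f" "tr f = 1 + det f"
  shows "\<exists>v. v \<noteq> 0 \<and> f v = v"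
proof -
  have t: "(ent\<^sub>1\<^sub>1 f - 1) * (ent\<^sub>2\<^sub>2 f - 1) = ent\<^sub>1\<^sub>2 f * ent\<^sub>2\<^sub>1 f"
    using assms(2) by (simp add: tr_def det_def algebra_simps)
  let ?u = "ent\<^sub>1\<^sub>2 f *s e\<^sub>1 + (1 - ent\<^sub>1\<^sub>1 f) *s e\<^sub>2" and ?v = "(1 - ent\<^sub>2\<^sub>2 f) *s e\<^sub>1 + ent\<^sub>2\<^sub>1 f *s e\<^sub>2"
  have "f ?u = ?u" "f ?v = ?v"
    using t by (auto simp: vec_eq_iff coord_lin[OF assms(1)] algebra_simps)
  moreover have "f = id" if "?u = 0" "?v = 0"
    using that assms(1) by (auto simp: lin_eq_iff vec_eq_iff)
  moreover have "e\<^sub>1 \<noteq> 0" by (auto simp: vec_eq_iff)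
  ultimately show ?thesis by (metis id_apply)
qed

text \<open>Cramer's rule, with \<open>d\<close> the determinant of \<open>u\<close> and
  \<open>w\<close>.\<close>

lemma new_frame:
  assumes "X u * Y w - Y u * X w \<noteq> 0"
  shows "\<exists>X' Y'. frame (*s) u w X' Y'"
proof -
  define d where "d = X u * Y w - Y u * X w"
  have d: "d \<noteq> 0" using assms by (simp add: d_def)
  let ?X = "\<lambda>v. (X v * Y w - Y v * X w) / d" and ?Y = "\<lambda>v. (X u * Y v - Y u * X v) / d"
  have "frame (*s) u w ?X ?Y"
  proof unfold_locales
    fix v a b
    show "v = ?X v *s u + ?Y v *s w"
    proof -
      have "(X v * Y w - Y v * X w) * X u + (X u * Y v - Y u * X v) * X w = X v * d"
        "(X v * Y w - Y v * X w) * Y u + (X u * Y v - Y u * X v) * Y w = Y v * d"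
        by (simp_all add: d_def algebra_simps)
      then show ?thesis using d by (simp add: vec_eq_iff field_simps)
    qed
    show "?X (a *s u + b *s w) = a" "?Y (a *s u + b *s w) = b"
      using d by (simp_all add: field_simps) (simp_all add: d_def algebra_simps)
  qed
  then show ?thesis by blast
qed

lemma parallel:
  assumes "X u * Y w - Y u * X w = 0" "u \<noteq> 0"
  shows "\<exists>c. w = c *s u"
proof (cases "X u = 0")
  case True
  then have "Y u \<noteq> 0" using assms(2) by (auto simp: vec_eq_iff)
  then show ?thesis using assms(1) True
    by (intro exI[of _ "Y w / Y u"]) (auto simp: vec_eq_iff)
next
  case False
  then show ?thesis using assms(1)
    by (intro exI[of _ "X w / X u"]) (auto simp: vec_eq_iff field_simps)
qed

lemma finite_lin:
  assumes "finite (UNIV :: 'k set)"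
  shows "finite {f. lin f}" "finite (UNIV :: 'v set)"
proof -
  have "inj_on (\<lambda>f. (ent\<^sub>1\<^sub>1 f, ent\<^sub>1\<^sub>2 f, ent\<^sub>2\<^sub>1 f, ent\<^sub>2\<^sub>2 f)) {f. lin f}"
    by (auto intro!: inj_onI simp: lin_eq_iff)
  moreover have "finite (UNIV :: ('k \<times> 'k \<times> 'k \<times> 'k) set)"
    unfolding UNIV_Times_UNIV[symmetric] by (intro finite_cartesian_product assms)
  ultimately show "finite {f. lin f}" by (meson finite_subset finite_imageD subset_UNIV)
  have "inj (\<lambda>v. (X v, Y v))" by (auto intro!: injI simp: vec_eq_iff)
  moreover have "finite (UNIV :: ('k \<times> 'k) set)"
    unfolding UNIV_Times_UNIV[symmetric] by (intro finite_cartesian_product assms)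
  ultimately show "finite (UNIV :: 'v set)" by (meson finite_subset finite_imageD subset_UNIV)
qed

lemma GL_carrier: "f \<in> carrier (GL (*s)) \<longleftrightarrow> lin f \<and> bij f"
  by (simp add: GL_def)

lemma GL_simps [simp]: "f \<otimes>\<^bsub>GL (*s)\<^esub> h = f \<circ> h" "\<one>\<^bsub>GL (*s)\<^esub> = id"
  by (simp_all add: GL_def)

lemma group_GL: "group (GL (*s))"
proof (rule groupI)
  fix f assume f: "f \<in> carrier (GL (*s))"
  then have "finv f \<in> carrier (GL (*s))" by (simp add: GL_carrier lin_inv bij_imp_bij_inv)
  moreover have "finv f \<otimes>\<^bsub>GL (*s)\<^esub> f = \<one>\<^bsub>GL (*s)\<^esub>"
    using f by (simp add: GL_carrier bij_is_inj)
  ultimately show "\<exists>h\<in>carrier (GL (*s)). h \<otimes>\<^bsub>GL (*s)\<^esub> f = \<one>\<^bsub>GL (*s)\<^esub>" by blast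
qed (auto simp: GL_carrier lin_comp bij_comp comp_assoc)

lemma GL_inv: "f \<in> carrier (GL (*s)) \<Longrightarrow> inv\<^bsub>GL (*s)\<^esub> f = finv f"
  using group.inv_equality[OF group_GL, of "finv f" f]
  by (simp add: GL_carrier lin_inv bij_imp_bij_inv bij_is_inj)

end

section \<open>A group of linear maps acting on the plane and on its endomorphisms\<close>

locale plane_group = frame scale e\<^sub>1 e\<^sub>2 X Y
  for scale :: "'k::{field,finite} \<Rightarrow> 'v::ab_group_add \<Rightarrow> 'v" (infixr "*s" 75)
    and e\<^sub>1 e\<^sub>2 X Y +
  fixes G :: "('v \<Rightarrow> 'v) set"
  assumes subG: "subgroup G (GL scale)"
begin

lemma G_lin: "g \<in> G \<Longrightarrow> lin g" and G_bij: "g \<in> G \<Longrightarrow> bij g"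
  using subgroup.subset[OF subG] GL_carrier by auto

lemma G_id: "id \<in> G" and G_comp: "g \<in> G \<Longrightarrow> h \<in> G \<Longrightarrow> g \<circ> h \<in> G"
  using subgroup.one_closed[OF subG] subgroup.m_closed[OF subG] by simp_all

lemma G_inv: "g \<in> G \<Longrightarrow> finv g \<in> G"
  using subgroup.m_inv_closed[OF subG, of g] subgroup.subset[OF subG] by (auto simp: GL_inv)

lemma G_inv_simps [simp]: "g \<in> G \<Longrightarrow> finv g (g v) = v" "g \<in> G \<Longrightarrow> g (finv g v) = v"
  using G_bij[of g] by (simp_all add: bij_is_inj bij_is_surj surj_f_inv_f)

lemma G_funpow: "g \<in> G \<Longrightarrow> g ^^ n \<in> G"
  by (induction n) (auto simp: G_id G_comp)

abbreviation "V \<equiv> std_gmodule scale"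
abbreviation "E \<equiv> End_gmodule scale"
abbreviation "\<Gamma> \<equiv> restr_GL scale G"

lemma V_simps [simp]: "carrier V = UNIV" "u \<otimes>\<^bsub>V\<^esub> v = u + v" "\<one>\<^bsub>V\<^esub> = 0" "scal V = scale" "act V g v = g v"
  by (simp_all add: std_gmodule_def)

lemma E_simps [simp]: "carrier E = {f. lin f}" "f \<otimes>\<^bsub>E\<^esub> h = (\<lambda>v. f v + h v)" "\<one>\<^bsub>E\<^esub> = (\<lambda>v. 0)"
  "scal E c f = (\<lambda>v. scale c (f v))" "act E g f = g \<circ> f \<circ> finv g"
  by (simp_all add: End_gmodule_def)

lemma finite_V: "finite (carrier V)" and finite_E: "finite (carrier E)"
  using finite_lin by simp_all

sublocale V: gmod \<Gamma> V
proof -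
  have "comm_group V"
    by (rule comm_groupI) (auto simp: algebra_simps intro: exI[of _ "- _"])
  then interpret comm_group V .
  show "gmod \<Gamma> V"
    by unfold_locales (auto simp: scale_left_distrib scale_right_distrib linD[OF G_lin])
qed

sublocale E: gmod \<Gamma> E
proof -
  have "comm_group E"
  proof (rule comm_groupI)
    fix f assume "f \<in> carrier E"
    then have "(\<lambda>v. - f v) \<in> carrier E" "(\<lambda>v. - f v) \<otimes>\<^bsub>E\<^esub> f = \<one>\<^bsub>E\<^esub>"
      by (auto simp: lin_iff algebra_simps)
    then show "\<exists>h\<in>carrier E. h \<otimes>\<^bsub>E\<^esub> f = \<one>\<^bsub>E\<^esub>" by blast
  qed (auto simp: lin_iff algebra_simps)
  then interpret comm_group E .
  show "gmod \<Gamma> E"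
    by unfold_locales
      (auto simp: scale_left_distrib scale_right_distrib linD[OF G_lin] lin_comp G_lin G_inv fun_eq_iff
        lin_iff)
qed

lemma V_inv [simp]: "inv\<^bsub>V\<^esub> v = - v"
  using V.inv_eq_scal[of v] by simp

end

lemma gmod_char: "gmod \<Gamma> (char_gmodule \<psi>)"
proof -
  have "comm_group (char_gmodule \<psi>)"
    by (rule comm_groupI) (auto simp: char_gmodule_def algebra_simps intro: exI[of _ "- _"])
  then interpret comm_group "char_gmodule \<psi>" .
  show ?thesis by unfold_locales (auto simp: char_gmodule_def algebra_simps)
qed

lemma irreducible_char: "irreducible_gmodule \<Gamma> (char_gmodule (\<psi> :: 'g \<Rightarrow> 'k::field))"
proof -
  interpret gmod \<Gamma> "char_gmodule \<psi>" by (rule gmod_char)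
  have "N = {0} \<or> N = UNIV" if N: "submod \<Gamma> N (char_gmodule \<psi>)" for N
  proof (cases "N = {0}")
    case False
    have "0 \<in> N" using submodD(2)[OF N] by (simp add: char_gmodule_def)
    then obtain x where x: "x \<in> N" "x \<noteq> 0" using False by blast
    have "c \<in> N" for c
      using submodD(4)[OF N x(1), of "c / x"] x(2) by (simp add: char_gmodule_def)
    then show ?thesis by blast
  qed simp
  moreover have "(UNIV :: 'k set) \<noteq> {0}" using UNIV_I[of "1::'k"] by (metis singletonD zero_neq_one)
  ultimately show ?thesis unfolding irreducible_gmodule_def by (simp add: char_gmodule_def)
qed

context plane_group
begin

text \<open>Equivariant functionals on \<open>N\<close> and \<open>K\<close> with the same character
  \<psi> give isomorphic one-dimensional factors. Their kernels are the lower ends of the sections,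
  and the normalised vectors \<open>v\<^sub>0\<close> and \<open>k\<^sub>0\<close> make them
  surjective.\<close>

lemma common_charI:
  assumes N: "submod \<Gamma> N V" "\<And>u v. u \<in> N \<Longrightarrow> v \<in> N \<Longrightarrow> f (u + v) = f u + f v"
      "\<And>c v. v \<in> N \<Longrightarrow> f (scale c v) = c * f v" "\<And>g v. g \<in> G \<Longrightarrow> v \<in> N \<Longrightarrow> f (g v) = \<psi> g * f v"
      "v\<^sub>0 \<in> N" "f v\<^sub>0 = 1"
    and K: "submod \<Gamma> K E" "\<And>u v. u \<in> K \<Longrightarrow> v \<in> K \<Longrightarrow> h (\<lambda>x. u x + v x) = h u + h v"
      "\<And>c v. v \<in> K \<Longrightarrow> h (\<lambda>x. scale c (v x)) = c * h v"
      "\<And>g v. g \<in> G \<Longrightarrow> v \<in> K \<Longrightarrow> h (g \<circ> v \<circ> finv g) = \<psi> g * h v"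
      "k\<^sub>0 \<in> K" "h k\<^sub>0 = 1"
  shows "common_composition_factor \<Gamma> V E"
proof (rule common_composition_factorI[OF V.gmod_axioms finite_V E.gmod_axioms finite_E gmod_char
      irreducible_char])
  note D = V.submodD[OF N(1), simplified] and D' = E.submodD[OF K(1), simplified]
  have f0: "f 0 = 0" using N(3)[OF N(5), of 0] by simp
  have h0: "h (\<lambda>v. 0) = 0" using K(3)[OF K(5), of 0] by simp
  show "submod \<Gamma> {v \<in> N. f v = \<one>\<^bsub>char_gmodule \<psi>\<^esub>} V"
    by (rule V.submodI) (auto simp: char_gmodule_def D N f0)
  show "submod \<Gamma> N V" by fact
  show "submod \<Gamma> {v \<in> K. h v = \<one>\<^bsub>char_gmodule \<psi>\<^esub>} E"
    by (rule E.submodI) (auto simp: char_gmodule_def D' K h0)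
  show "submod \<Gamma> K E" by fact
  show "f \<in> gmodule_hom \<Gamma> (V\<lparr>carrier := N\<rparr>) (char_gmodule \<psi>)"
    by (rule gmodule_homI) (auto simp: char_gmodule_def N)
  show "h \<in> gmodule_hom \<Gamma> (E\<lparr>carrier := K\<rparr>) (char_gmodule \<psi>)"
    by (rule gmodule_homI) (auto simp: char_gmodule_def K)
  have "c \<in> f ` N" for c using N(3)[OF N(5), of c] N(6) D(4)[OF N(5), of c] by (metis imageI mult_1_right)
  then show "f ` N = carrier (char_gmodule \<psi>)" by (auto simp: char_gmodule_def)
  have "c \<in> h ` K" for c using K(3)[OF K(5), of c] K(6) D'(4)[OF K(5), of c] by (metis imageI mult_1_right)
  then show "h ` K = carrier (char_gmodule \<psi>)" by (auto simp: char_gmodule_def)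
qed auto

section \<open>Stable lines and common factors\<close>

lemma conj_lin: "g \<in> G \<Longrightarrow> lin f \<Longrightarrow> lin (g \<circ> f \<circ> finv g)"
  by (simp add: lin_comp G_lin G_inv)

text \<open>Comparing the entries of \<open>f' \<circ> g = g \<circ> f\<close> avoids writing down
  an inverse matrix.\<close>

lemma conj_ent:
  assumes g: "g \<in> G" and f: "lin f"
  defines "f' \<equiv> g \<circ> f \<circ> finv g"
  shows "ent\<^sub>1\<^sub>1 f' * ent\<^sub>1\<^sub>1 g + ent\<^sub>1\<^sub>2 f' * ent\<^sub>2\<^sub>1 g = ent\<^sub>1\<^sub>1 g * ent\<^sub>1\<^sub>1 f + ent\<^sub>1\<^sub>2 g * ent\<^sub>2\<^sub>1 f"
    "ent\<^sub>1\<^sub>1 f' * ent\<^sub>1\<^sub>2 g + ent\<^sub>1\<^sub>2 f' * ent\<^sub>2\<^sub>2 g = ent\<^sub>1\<^sub>1 g * ent\<^sub>1\<^sub>2 f + ent\<^sub>1\<^sub>2 g * ent\<^sub>2\<^sub>2 f"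
    "ent\<^sub>2\<^sub>1 f' * ent\<^sub>1\<^sub>1 g + ent\<^sub>2\<^sub>2 f' * ent\<^sub>2\<^sub>1 g = ent\<^sub>2\<^sub>1 g * ent\<^sub>1\<^sub>1 f + ent\<^sub>2\<^sub>2 g * ent\<^sub>2\<^sub>1 f"
    "ent\<^sub>2\<^sub>1 f' * ent\<^sub>1\<^sub>2 g + ent\<^sub>2\<^sub>2 f' * ent\<^sub>2\<^sub>2 g = ent\<^sub>2\<^sub>1 g * ent\<^sub>1\<^sub>2 f + ent\<^sub>2\<^sub>2 g * ent\<^sub>2\<^sub>2 f"
proof -
  have eq: "f' \<circ> g = g \<circ> f" using g by (auto simp: f'_def fun_eq_iff)
  have l: "lin f'" unfolding f'_def by (rule conj_lin[OF g f])
  note * = ent_comp[OF l, of g, unfolded eq ent_comp[OF G_lin[OF g]]]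
  show "ent\<^sub>1\<^sub>1 f' * ent\<^sub>1\<^sub>1 g + ent\<^sub>1\<^sub>2 f' * ent\<^sub>2\<^sub>1 g = ent\<^sub>1\<^sub>1 g * ent\<^sub>1\<^sub>1 f + ent\<^sub>1\<^sub>2 g * ent\<^sub>2\<^sub>1 f"
    "ent\<^sub>1\<^sub>1 f' * ent\<^sub>1\<^sub>2 g + ent\<^sub>1\<^sub>2 f' * ent\<^sub>2\<^sub>2 g = ent\<^sub>1\<^sub>1 g * ent\<^sub>1\<^sub>2 f + ent\<^sub>1\<^sub>2 g * ent\<^sub>2\<^sub>2 f"
    "ent\<^sub>2\<^sub>1 f' * ent\<^sub>1\<^sub>1 g + ent\<^sub>2\<^sub>2 f' * ent\<^sub>2\<^sub>1 g = ent\<^sub>2\<^sub>1 g * ent\<^sub>1\<^sub>1 f + ent\<^sub>2\<^sub>2 g * ent\<^sub>2\<^sub>1 f"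
    "ent\<^sub>2\<^sub>1 f' * ent\<^sub>1\<^sub>2 g + ent\<^sub>2\<^sub>2 f' * ent\<^sub>2\<^sub>2 g = ent\<^sub>2\<^sub>1 g * ent\<^sub>1\<^sub>2 f + ent\<^sub>2\<^sub>2 g * ent\<^sub>2\<^sub>2 f"
    using * by simp_all
qed

lemma ent_sum_scale [simp]:
  "ent\<^sub>1\<^sub>1 (\<lambda>x. u x + v x) = ent\<^sub>1\<^sub>1 u + ent\<^sub>1\<^sub>1 v" "ent\<^sub>1\<^sub>2 (\<lambda>x. u x + v x) = ent\<^sub>1\<^sub>2 u + ent\<^sub>1\<^sub>2 v"
  "ent\<^sub>2\<^sub>1 (\<lambda>x. u x + v x) = ent\<^sub>2\<^sub>1 u + ent\<^sub>2\<^sub>1 v" "ent\<^sub>2\<^sub>2 (\<lambda>x. u x + v x) = ent\<^sub>2\<^sub>2 u + ent\<^sub>2\<^sub>2 v"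
  "ent\<^sub>1\<^sub>1 (\<lambda>x. c *s u x) = c * ent\<^sub>1\<^sub>1 u" "ent\<^sub>1\<^sub>2 (\<lambda>x. c *s u x) = c * ent\<^sub>1\<^sub>2 u"
  "ent\<^sub>2\<^sub>1 (\<lambda>x. c *s u x) = c * ent\<^sub>2\<^sub>1 u" "ent\<^sub>2\<^sub>2 (\<lambda>x. c *s u x) = c * ent\<^sub>2\<^sub>2 u"
  "ent\<^sub>1\<^sub>1 (\<lambda>x. 0) = 0" "ent\<^sub>1\<^sub>2 (\<lambda>x. 0) = 0" "ent\<^sub>2\<^sub>1 (\<lambda>x. 0) = 0" "ent\<^sub>2\<^sub>2 (\<lambda>x. 0) = 0"
  by (simp_all add: ent_defs)

lemma lin_sum_scale [simp]: "lin u \<Longrightarrow> lin v \<Longrightarrow> lin (\<lambda>x. u x + v x)"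
  "lin u \<Longrightarrow> lin (\<lambda>x. c *s u x)" "lin (\<lambda>x. 0)"
  by (auto simp: lin_iff algebra_simps scale_right_distrib)

text \<open>In this case \<open>ent\<^sub>1\<^sub>1\<close> is the character
  \<open>\<chi>\<^sub>1\<close> of the stable line and \<open>ent\<^sub>2\<^sub>2\<close> the
  character \<open>\<chi>\<^sub>2\<close> of the quotient.\<close>

definition "triangular \<longleftrightarrow> (\<forall>g\<in>G. ent\<^sub>2\<^sub>1 g = 0)"

lemma tri_nonzero:
  assumes "triangular" "g \<in> G"
  shows "ent\<^sub>1\<^sub>1 g \<noteq> 0" "ent\<^sub>2\<^sub>2 g \<noteq> 0"
  using assms det_nonzero[OF G_lin G_bij, of g] by (auto simp: triangular_def det_def)

text \<open>These are the actions on the graded pieces of End(V), filtered by strictly upper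
  triangular, upper triangular and all matrices: \<open>\<chi>\<^sub>1 / \<chi>\<^sub>2\<close> at
  the bottom, trivial on the diagonal, \<open>\<chi>\<^sub>2 / \<chi>\<^sub>1\<close> at the
  top.\<close>

lemma tri_conj:
  assumes "triangular" "g \<in> G" "lin f"
  shows "ent\<^sub>2\<^sub>1 (g \<circ> f \<circ> finv g) = ent\<^sub>2\<^sub>2 g / ent\<^sub>1\<^sub>1 g * ent\<^sub>2\<^sub>1 f"
    "ent\<^sub>2\<^sub>1 f = 0 \<Longrightarrow> ent\<^sub>1\<^sub>1 (g \<circ> f \<circ> finv g) = ent\<^sub>1\<^sub>1 f"
    "ent\<^sub>2\<^sub>1 f = 0 \<Longrightarrow> ent\<^sub>2\<^sub>2 (g \<circ> f \<circ> finv g) = ent\<^sub>2\<^sub>2 f"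
    "ent\<^sub>2\<^sub>1 f = 0 \<Longrightarrow> ent\<^sub>1\<^sub>1 f = 0 \<Longrightarrow> ent\<^sub>2\<^sub>2 f = 0 \<Longrightarrow>
      ent\<^sub>1\<^sub>2 (g \<circ> f \<circ> finv g) = ent\<^sub>1\<^sub>1 g / ent\<^sub>2\<^sub>2 g * ent\<^sub>1\<^sub>2 f"
proof -
  define f' where "f' = g \<circ> f \<circ> finv g"
  have c: "ent\<^sub>2\<^sub>1 g = 0" using assms by (simp add: triangular_def)
  note n = tri_nonzero[OF assms(1,2)]
  note e = conj_ent[OF assms(2,3), folded f'_def, unfolded c, simplified]
  have 1: "ent\<^sub>2\<^sub>1 f' = ent\<^sub>2\<^sub>2 g / ent\<^sub>1\<^sub>1 g * ent\<^sub>2\<^sub>1 f" using e(3) n by (simp add: field_simps)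
  moreover have 2: "ent\<^sub>1\<^sub>1 f' = ent\<^sub>1\<^sub>1 f" if "ent\<^sub>2\<^sub>1 f = 0" using e(1) n that by simp
  moreover have "ent\<^sub>2\<^sub>2 f' = ent\<^sub>2\<^sub>2 f" if "ent\<^sub>2\<^sub>1 f = 0" using e(4) 1 n that by simp
  moreover have "ent\<^sub>1\<^sub>2 f' = ent\<^sub>1\<^sub>1 g / ent\<^sub>2\<^sub>2 g * ent\<^sub>1\<^sub>2 f"
    if "ent\<^sub>2\<^sub>1 f = 0" "ent\<^sub>1\<^sub>1 f = 0" "ent\<^sub>2\<^sub>2 f = 0"
    using e(2) 2 n that by (simp add: field_simps)
  ultimately show "ent\<^sub>2\<^sub>1 (g \<circ> f \<circ> finv g) = ent\<^sub>2\<^sub>2 g / ent\<^sub>1\<^sub>1 g * ent\<^sub>2\<^sub>1 f"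
    "ent\<^sub>2\<^sub>1 f = 0 \<Longrightarrow> ent\<^sub>1\<^sub>1 (g \<circ> f \<circ> finv g) = ent\<^sub>1\<^sub>1 f"
    "ent\<^sub>2\<^sub>1 f = 0 \<Longrightarrow> ent\<^sub>2\<^sub>2 (g \<circ> f \<circ> finv g) = ent\<^sub>2\<^sub>2 f"
    "ent\<^sub>2\<^sub>1 f = 0 \<Longrightarrow> ent\<^sub>1\<^sub>1 f = 0 \<Longrightarrow> ent\<^sub>2\<^sub>2 f = 0 \<Longrightarrow>
      ent\<^sub>1\<^sub>2 (g \<circ> f \<circ> finv g) = ent\<^sub>1\<^sub>1 g / ent\<^sub>2\<^sub>2 g * ent\<^sub>1\<^sub>2 f"
    by (simp_all add: f'_def)
qed

lemma submod_line: "triangular \<Longrightarrow> submod \<Gamma> {v. Y v = 0} V"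
  by (rule V.submodI) (auto simp: coord_lin[OF G_lin] triangular_def)

lemma submod_scalars: "submod \<Gamma> {\<lambda>v. c *s v | c. True} E"
proof (rule E.submodI)
  show "{\<lambda>v. c *s v | c. True} \<subseteq> carrier E" by (auto simp: lin_iff scale_right_distrib mult.commute)
  show "\<one>\<^bsub>E\<^esub> \<in> {\<lambda>v. c *s v | c. True}" by (auto intro!: exI[of _ 0])
  show "x \<otimes>\<^bsub>E\<^esub> y \<in> {\<lambda>v. c *s v | c. True}"
    if "x \<in> {\<lambda>v. c *s v | c. True}" "y \<in> {\<lambda>v. c *s v | c. True}" for x y
    using that by (auto simp: scale_left_distrib[symmetric])
  show "scal E c x \<in> {\<lambda>v. c *s v | c. True}" if "x \<in> {\<lambda>v. c *s v | c. True}" for c x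
    using that by auto
  show "act E g x \<in> {\<lambda>v. c *s v | c. True}" if "g \<in> carrier \<Gamma>" "x \<in> {\<lambda>v. c *s v | c. True}" for g x
    using that by (auto simp: fun_eq_iff linD[OF G_lin])
qed

lemma submod_strict: "triangular \<Longrightarrow> submod \<Gamma> {f. lin f \<and> ent\<^sub>1\<^sub>1 f = 0 \<and> ent\<^sub>2\<^sub>1 f = 0 \<and> ent\<^sub>2\<^sub>2 f = 0} E"
  by (rule E.submodI) (auto simp: tri_conj conj_lin)

lemma submod_upper: "triangular \<Longrightarrow> submod \<Gamma> {f. lin f \<and> ent\<^sub>2\<^sub>1 f = 0} E"
  by (rule E.submodI) (auto simp: tri_conj conj_lin)

lemma conj_scalar: "g \<in> G \<Longrightarrow> g \<circ> (\<lambda>v. c *s v) \<circ> finv g = (\<lambda>v. c *s v)"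
  by (auto simp: fun_eq_iff linD[OF G_lin])

lemma ent_scalar: "ent\<^sub>1\<^sub>1 (\<lambda>v. c *s v) = c" "ent\<^sub>1\<^sub>1 (\<lambda>v. v) = 1"
  by (simp_all add: ent_defs)

text \<open>If \<open>\<chi>\<^sub>1 = 1\<close> the stable line, and if
  \<open>\<chi>\<^sub>2 = 1\<close> the quotient, matches the scalar matrices. The equation
  \<open>\<chi>\<^sub>1 = \<chi>\<^sub>2\<^sup>2\<close> reads
  \<open>\<chi>\<^sub>2 = \<chi>\<^sub>1 / \<chi>\<^sub>2\<close> and matches the quotient of V with
  the strictly upper triangular matrices; \<open>\<chi>\<^sub>2 = \<chi>\<^sub>1\<^sup>2\<close>
  reads \<open>\<chi>\<^sub>1 = \<chi>\<^sub>2 / \<chi>\<^sub>1\<close> and matches the line with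
  End(V) modulo the upper triangular ones.\<close>

lemma common_tri:
  assumes t: "triangular"
    and c: "(\<forall>g\<in>G. ent\<^sub>1\<^sub>1 g = 1) \<or> (\<forall>g\<in>G. ent\<^sub>1\<^sub>1 g = (ent\<^sub>2\<^sub>2 g)\<^sup>2) \<or> (\<forall>g\<in>G. ent\<^sub>2\<^sub>2 g = 1) \<or>
      (\<forall>g\<in>G. ent\<^sub>2\<^sub>2 g = (ent\<^sub>1\<^sub>1 g)\<^sup>2)"
  shows "common_composition_factor \<Gamma> V E"
  using c
proof (elim disjE)
  assume a: "\<forall>g\<in>G. ent\<^sub>1\<^sub>1 g = 1"
  show ?thesis
    \<comment> \<open>Writing the identity as \<open>1 *s v\<close> keeps it visibly a scalar map,
      whence the deletion of \<open>scale_one\<close>.\<close>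
    by (rule common_charI[OF submod_line[OF t], of X "\<lambda>_. 1" e\<^sub>1 _ ent\<^sub>1\<^sub>1 "\<lambda>v. 1 *s v", OF _ _ _ _ _ submod_scalars])
      (auto simp: coord_lin[OF G_lin] conj_scalar ent_scalar a[rule_format] simp del: scale_one)
next
  assume a: "\<forall>g\<in>G. ent\<^sub>2\<^sub>2 g = 1"
  show ?thesis
    by (rule common_charI[OF V.submod_carrier, of Y "\<lambda>_. 1" e\<^sub>2 _ ent\<^sub>1\<^sub>1 "\<lambda>v. 1 *s v", OF _ _ _ _ _ submod_scalars])
      (auto simp: coord_lin[OF G_lin] conj_scalar ent_scalar a[rule_format] t[unfolded triangular_def, rule_format]
        simp del: scale_one)
next
  assume a: "\<forall>g\<in>G. ent\<^sub>1\<^sub>1 g = (ent\<^sub>2\<^sub>2 g)\<^sup>2"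
  show ?thesis
    by (rule common_charI[OF V.submod_carrier, of Y ent\<^sub>2\<^sub>2 e\<^sub>2 _ ent\<^sub>1\<^sub>2 "\<lambda>v. Y v *s e\<^sub>1", OF _ _ _ _ _ submod_strict[OF t]])
      (simp_all add: coord_lin[OF G_lin] t[unfolded triangular_def, rule_format] tri_conj[OF t] a[rule_format]
        lin_iff[of "\<lambda>v. Y v *s e\<^sub>1"] scale_left_distrib ent_defs[of "\<lambda>v. Y v *s e\<^sub>1"] power2_eq_square
        tri_nonzero[OF t])
next
  assume a: "\<forall>g\<in>G. ent\<^sub>2\<^sub>2 g = (ent\<^sub>1\<^sub>1 g)\<^sup>2"
  show ?thesis
    by (rule common_charI[OF submod_line[OF t], of X ent\<^sub>1\<^sub>1 e\<^sub>1 _ ent\<^sub>2\<^sub>1 "\<lambda>v. X v *s e\<^sub>2", OF _ _ _ _ _ E.submod_carrier])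
      (simp_all add: coord_lin[OF G_lin] t[unfolded triangular_def, rule_format] tri_conj[OF t] a[rule_format]
        lin_iff[of "\<lambda>v. X v *s e\<^sub>2"] scale_left_distrib ent_defs[of "\<lambda>v. X v *s e\<^sub>2"] power2_eq_square
        tri_nonzero[OF t])
qed

text \<open>In a basis starting with the fixed vector all matrices are triangular with
  \<open>ent\<^sub>1\<^sub>1\<close> equal to 1, which is a case of
  \<open>common_tri\<close>.\<close>

lemma common_fixed:
  assumes "v \<noteq> 0" "\<And>g. g \<in> G \<Longrightarrow> g v = v"
  shows "common_composition_factor \<Gamma> V E"
proof -
  have "X v \<noteq> 0 \<or> Y v \<noteq> 0" using assms(1) by (auto simp: vec_eq_iff)
  then obtain w where "X v * Y w - Y v * X w \<noteq> 0"
  proof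
    assume "X v \<noteq> 0" then show thesis by (intro that[of e\<^sub>2]) simp
  next
    assume "Y v \<noteq> 0" then show thesis by (intro that[of e\<^sub>1]) simp
  qed
  then obtain X' Y' where F: "frame (*s) v w X' Y'" using new_frame by blast
  interpret F: frame "(*s)" v w X' Y' by (rule F)
  interpret P: plane_group "(*s)" v w X' Y' G by (intro plane_group.intro plane_group_axioms.intro F subG)
  show ?thesis
    by (rule P.common_tri) (auto simp: P.triangular_def F.ent_defs assms(2))
qed

definition "e\<^sub>3 = - (e\<^sub>1 + e\<^sub>2)"

text \<open>The image of \<open>e\<^sub>3\<close> is implied: the three vectors have sum 0, so a
  linear map with this property sends \<open>e\<^sub>3\<close> to the remaining one.\<close>

definition "triangle g \<longleftrightarrow> g e\<^sub>1 \<in> {e\<^sub>1, e\<^sub>2, e\<^sub>3} \<and> g e\<^sub>2 \<in> {e\<^sub>1, e\<^sub>2, e\<^sub>3} \<and> g e\<^sub>1 \<noteq> g e\<^sub>2"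

text \<open>The bilinear product with \<open>e\<^sub>i * e\<^sub>i = e\<^sub>i\<close> and \<open>e\<^sub>i * e\<^sub>j = e\<^sub>k\<close> for \<open>{i, j, k} = {1, 2, 3}\<close>; it is
  well defined because \<open>e\<^sub>1 + e\<^sub>2 + e\<^sub>3 = 0\<close>, and visibly invariant under permutations of the \<open>e\<^sub>i\<close>.\<close>

definition mul :: "'v \<Rightarrow> 'v \<Rightarrow> 'v" where
  "mul u v = (X u * X v) *s e\<^sub>1 + (Y u * Y v) *s e\<^sub>2 + (X u * Y v + Y u * X v) *s e\<^sub>3"

lemma mul_coord: "X (mul u v) = X u * X v - X u * Y v - Y u * X v"
  "Y (mul u v) = Y u * Y v - X u * Y v - Y u * X v"
  by (simp_all add: mul_def e\<^sub>3_def algebra_simps)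

lemma mul_triangle:
  assumes "lin g" "triangle g"
  shows "g (mul u v) = mul (g u) (g v)"
  using assms(2) unfolding triangle_def e\<^sub>3_def
  by (auto simp: vec_eq_iff mul_coord coord_lin[OF assms(1)] coord_lin[OF assms(1), of e\<^sub>1]
      coord_lin[OF assms(1), of e\<^sub>2] algebra_simps)

text \<open>\<open>V\<close> may be reducible here, so a minimal submodule \<open>L\<close>, the
  second term of a chain, serves as the common factor. It is a section of \<open>V\<close> over 0,
  and sending \<open>u\<close> to \<open>mul u\<close> carries it equivariantly into End(V).\<close>

lemma common_triangle:
  assumes tri: "\<And>g. g \<in> G \<Longrightarrow> triangle g"
  shows "common_composition_factor \<Gamma> V E"
proof -
  obtain Ns where Ns: "Ns \<noteq> []" "hd Ns = {0}" "last Ns = UNIV" "\<forall>N\<in>set Ns. submod \<Gamma> N V"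
    "successively V.simple_section Ns"
    using V.simple_sections_between[OF finite_V V.submod_one V.submod_carrier] by auto
  have ne: "e\<^sub>1 \<noteq> 0" by (auto simp: vec_eq_iff)
  obtain L where L: "V.simple_section {0} L"
  proof (cases Ns)
    case (Cons A Ms)
    then have "A = {0}" using Ns by simp
    moreover from this have "Ms \<noteq> []" using Cons Ns(3) ne by auto
    ultimately have "V.simple_section {0} (hd Ms)" using Cons Ns(5) by (auto simp: successively_Cons)
    then show thesis by (rule that)
  qed (use Ns in simp)
  then have Ls: "submod \<Gamma> L V" "L \<noteq> {0}" and Lmin: "\<And>K. submod \<Gamma> K V \<Longrightarrow> K \<subseteq> L \<Longrightarrow> K = {0} \<or> K = L"
    using V.submodD(2) by (auto simp: V.simple_section_def)
  note LD = V.submodD[OF Ls(1), simplified]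
  have gL: "gmod \<Gamma> (V\<lparr>carrier := L\<rparr>)" by (rule V.gmod_sub[OF Ls(1)])
  have irrL: "irreducible_gmodule \<Gamma> (V\<lparr>carrier := L\<rparr>)"
    unfolding irreducible_gmodule_def V.submod_sub_iff[OF Ls(1)] using Ls(2) Lmin by simp
  \<comment> \<open>A left inverse of \<open>mul\<close>: the first column of \<open>mul u\<close>
    has the entries \<open>X u - Y u\<close> and \<open>- Y u\<close>.\<close>
  define \<rho> where "\<rho> = (\<lambda>h. (ent\<^sub>1\<^sub>1 h - ent\<^sub>2\<^sub>1 h) *s e\<^sub>1 - ent\<^sub>2\<^sub>1 h *s e\<^sub>2)"
  have \<rho>: "\<rho> (mul u) = u" for u
    by (simp add: \<rho>_def vec_eq_iff ent_defs mul_coord)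
  have mulE: "mul u \<in> carrier E" for u by (auto simp: lin_iff vec_eq_iff mul_coord algebra_simps)
  have mul_add: "(\<lambda>x. mul u x + mul v x) = mul (u + v)" for u v
    by (auto simp: fun_eq_iff vec_eq_iff mul_coord algebra_simps)
  have mul_scale: "(\<lambda>x. c *s mul u x) = mul (c *s u)" for c u
    by (auto simp: fun_eq_iff vec_eq_iff mul_coord algebra_simps)
  have mul_act: "g \<circ> mul u \<circ> finv g = mul (g u)" if "g \<in> G" for g u
    using that by (auto simp: fun_eq_iff mul_triangle[OF G_lin tri])
  have mul_0: "mul 0 = (\<lambda>v. 0)" by (auto simp: fun_eq_iff vec_eq_iff mul_coord)
  have K: "submod \<Gamma> (mul ` L) E"
  proof (rule E.submodI)
    show "mul ` L \<subseteq> carrier E" using mulE by blast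
    show "\<one>\<^bsub>E\<^esub> \<in> mul ` L" using LD(2) by (simp add: mul_0[symmetric])
    show "x \<otimes>\<^bsub>E\<^esub> y \<in> mul ` L" if "x \<in> mul ` L" "y \<in> mul ` L" for x y
      using that LD(3) by (auto simp: mul_add)
    show "scal E c x \<in> mul ` L" if "x \<in> mul ` L" for c x
      using that LD(4) by (auto simp: mul_scale)
    show "act E g x \<in> mul ` L" if "g \<in> carrier \<Gamma>" "x \<in> mul ` L" for g x
      using that LD(5) by (auto simp: mul_act simp del: o_apply)
  qed
  show ?thesis
  proof (rule common_composition_factorI[OF V.gmod_axioms finite_V E.gmod_axioms finite_E gL irrL])
    show "submod \<Gamma> {0} V" using V.submod_one by simp
    show "submod \<Gamma> L V" by fact
    show "(\<lambda>x. x) \<in> gmodule_hom \<Gamma> (V\<lparr>carrier := L\<rparr>) (V\<lparr>carrier := L\<rparr>)"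
      by (rule gmodule_homI) auto
    show "submod \<Gamma> {\<lambda>v. 0} E" using E.submod_one by simp
    show "submod \<Gamma> (mul ` L) E" by fact
    show "\<rho> \<in> gmodule_hom \<Gamma> (E\<lparr>carrier := mul ` L\<rparr>) (V\<lparr>carrier := L\<rparr>)"
      by (rule gmodule_homI) (auto simp: \<rho> mul_add mul_scale mul_act)
    show "{0} = {x \<in> L. x = \<one>\<^bsub>V\<lparr>carrier := L\<rparr>\<^esub>}" using LD(2) by auto
    show "{\<lambda>v. 0} = {x \<in> mul ` L. \<rho> x = \<one>\<^bsub>V\<lparr>carrier := L\<rparr>\<^esub>}"
    proof -
      have "x = 0" if "\<rho> (mul x) = 0" for x using that by (simp add: \<rho>)
      then show ?thesis using LD(2) mul_0[symmetric] by (auto simp: \<rho>)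
    qed
  qed (auto simp: \<rho> image_image)
qed

text \<open>A factor of V has character \<open>\<chi>\<^sub>1\<close> or
  \<open>\<chi>\<^sub>2\<close>; one of End(V) has \<open>\<chi>\<^sub>2 / \<chi>\<^sub>1\<close>, 1
  or \<open>\<chi>\<^sub>1 / \<chi>\<^sub>2\<close>. A common factor equates one of the former with
  one of the latter, and each of the six equations contradicts one assumption.\<close>

lemma not_common_tri:
  assumes t: "triangular"
    and c: "\<exists>g\<in>G. ent\<^sub>1\<^sub>1 g \<noteq> 1" "\<exists>g\<in>G. ent\<^sub>1\<^sub>1 g \<noteq> (ent\<^sub>2\<^sub>2 g)\<^sup>2" "\<exists>g\<in>G. ent\<^sub>2\<^sub>2 g \<noteq> 1"
      "\<exists>g\<in>G. ent\<^sub>2\<^sub>2 g \<noteq> (ent\<^sub>1\<^sub>1 g)\<^sup>2"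
  shows "\<not> common_composition_factor \<Gamma> V E"
proof
  assume "common_composition_factor \<Gamma> V E"
  then obtain A1 A2 B1 B2 where A: "V.simple_section A1 A2" and B: "E.simple_section B1 B2"
    and eq: "\<And>g cs. g \<in> G \<Longrightarrow> (\<forall>x\<in>A2. peval V g cs x \<in> A1) \<longleftrightarrow> (\<forall>x\<in>B2. peval E g cs x \<in> B1)"
    using common_composition_factor_peval[OF V.gmod_axioms finite_V E.gmod_axioms finite_E] by auto
  have cG: "carrier \<Gamma> = G" by simp
  \<comment> \<open>Via the polynomial t - \<psi>(g), \<open>P \<psi>\<close> says that every
    \<open>g\<close> acts on the section as the scalar \<open>\<psi> g\<close>. By \<open>PB\<close>
    it may equally be tested on the section of End(V).\<close>
  define P where "P = (\<lambda>\<psi>. \<forall>g\<in>G. \<forall>x\<in>A2. peval V g [- \<psi> g, 1] x \<in> A1)"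
  have PB: "P \<psi> \<longleftrightarrow> (\<forall>g\<in>G. \<forall>x\<in>B2. peval E g [- \<psi> g, 1] x \<in> B1)" for \<psi>
    unfolding P_def using eq by blast
  have pV: "peval V g [- c, 1] x = g x - c *s x" if "g \<in> G" for g c x
    using that by (simp add: linD[OF G_lin])
  have pE: "peval E g [- c, 1] f = (\<lambda>v. (g \<circ> f \<circ> finv g) v + (- c) *s f v)" if "g \<in> G" for g c f
    using that by (simp add: linD[OF G_lin])
  have As: "submod \<Gamma> A1 V" "A1 \<subset> A2" using A by (auto simp: V.simple_section_def)
  note AD = V.submodD(3,4)[OF As(1), simplified]
  \<comment> \<open>Subtracting the two conditions puts a multiple of \<open>x\<close> into
    \<open>A1\<close>; if its coefficient were nonzero, \<open>x\<close> itself would lie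
    there.\<close>
  have uniq: "\<psi> g = \<psi>' g" if "P \<psi>" "P \<psi>'" "g \<in> G" for \<psi> \<psi>' g
  proof -
    obtain x where x: "x \<in> A2" "x \<notin> A1" using As(2) by blast
    have "g x - \<psi> g *s x \<in> A1" "g x - \<psi>' g *s x \<in> A1"
      using that x(1) unfolding P_def by (auto simp only: pV)
    then have "(g x - \<psi> g *s x) + (-1) *s (g x - \<psi>' g *s x) \<in> A1"
      by (intro AD)
    then have *: "(\<psi>' g - \<psi> g) *s x \<in> A1" by (simp add: scale_left_diff_distrib)
    show ?thesis
    proof (rule ccontr)
      assume "\<psi> g \<noteq> \<psi>' g"
      then have "inverse (\<psi>' g - \<psi> g) *s (\<psi>' g - \<psi> g) *s x = x" by simp
      then show False using AD(2)[OF *, of "inverse (\<psi>' g - \<psi> g)"] x(2) by metis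
    qed
  qed
  have Acase: "P ent\<^sub>1\<^sub>1 \<or> P ent\<^sub>2\<^sub>2"
  proof -
    have "P ent\<^sub>2\<^sub>2 \<or> (\<forall>x\<in>A2. \<exists>n\<in>A1. \<exists>k\<in>A2 \<inter> {v. Y v = 0}. x = n \<otimes>\<^bsub>V\<^esub> k)"
    proof -
      have "\<forall>g\<in>carrier \<Gamma>. \<forall>x\<in>carrier V. peval V g [- ent\<^sub>2\<^sub>2 g, 1] x \<in> {v. Y v = 0}"
        using t by (simp add: pV coord_lin[OF G_lin] triangular_def del: peval.simps)
      from V.scalar_section_step[OF A submod_line[OF t] V.simple_section_cover_carrier[OF A] this]
      show ?thesis unfolding P_def cG by argo
    qed
    moreover have "P ent\<^sub>1\<^sub>1" if cov: "\<forall>x\<in>A2. \<exists>n\<in>A1. \<exists>k\<in>A2 \<inter> {v. Y v = 0}. x = n \<otimes>\<^bsub>V\<^esub> k"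
    proof -
      have "\<forall>g\<in>carrier \<Gamma>. \<forall>x\<in>{v. Y v = 0}. peval V g [- ent\<^sub>1\<^sub>1 g, 1] x \<in> {\<one>\<^bsub>V\<^esub>}"
        using t by (simp add: pV coord_lin[OF G_lin] triangular_def vec_eq_iff del: peval.simps)
      from V.scalar_section_step[OF A V.submod_one cov this] V.simple_section_not_cover_one[OF A]
      show ?thesis unfolding P_def cG by argo
    qed
    ultimately show ?thesis by blast
  qed
  have Bcase: "P (\<lambda>g. ent\<^sub>2\<^sub>2 g / ent\<^sub>1\<^sub>1 g) \<or> P (\<lambda>g. 1) \<or> P (\<lambda>g. ent\<^sub>1\<^sub>1 g / ent\<^sub>2\<^sub>2 g)"
  proof -
    let ?U = "{f. lin f \<and> ent\<^sub>2\<^sub>1 f = 0}" and ?S = "{f. lin f \<and> ent\<^sub>1\<^sub>1 f = 0 \<and> ent\<^sub>2\<^sub>1 f = 0 \<and> ent\<^sub>2\<^sub>2 f = 0}"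
    \<comment> \<open>From the top of the filtration, each linear polynomial leads one step
      down.\<close>
    have s1: "\<forall>g\<in>carrier \<Gamma>. \<forall>f\<in>carrier E. peval E g [- (ent\<^sub>2\<^sub>2 g / ent\<^sub>1\<^sub>1 g), 1] f \<in> ?U"
      using t by (simp add: pE tri_conj[OF t] conj_lin del: peval.simps o_apply scale_minus_left)
    have s2: "\<forall>g\<in>carrier \<Gamma>. \<forall>f\<in>?U. peval E g [- 1, 1] f \<in> ?S"
      using t by (simp add: pE tri_conj[OF t] conj_lin del: peval.simps o_apply scale_minus_left)
    have s3: "\<forall>g\<in>carrier \<Gamma>. \<forall>f\<in>?S. peval E g [- (ent\<^sub>1\<^sub>1 g / ent\<^sub>2\<^sub>2 g), 1] f \<in> {\<one>\<^bsub>E\<^esub>}"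
      using t by (simp add: pE tri_conj[OF t] conj_lin lin_eq_iff del: peval.simps o_apply scale_minus_left)
    have "P (\<lambda>g. ent\<^sub>2\<^sub>2 g / ent\<^sub>1\<^sub>1 g) \<or> (\<forall>x\<in>B2. \<exists>n\<in>B1. \<exists>k\<in>B2 \<inter> ?U. x = n \<otimes>\<^bsub>E\<^esub> k)"
      using E.scalar_section_step[OF B submod_upper[OF t] E.simple_section_cover_carrier[OF B] s1]
      unfolding PB cG by argo
    moreover have "P (\<lambda>g. 1) \<or> (\<forall>x\<in>B2. \<exists>n\<in>B1. \<exists>k\<in>B2 \<inter> ?S. x = n \<otimes>\<^bsub>E\<^esub> k)"
      if cov: "\<forall>x\<in>B2. \<exists>n\<in>B1. \<exists>k\<in>B2 \<inter> ?U. x = n \<otimes>\<^bsub>E\<^esub> k"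
      using E.scalar_section_step[OF B submod_strict[OF t] cov s2] unfolding PB cG by argo
    moreover have "P (\<lambda>g. ent\<^sub>1\<^sub>1 g / ent\<^sub>2\<^sub>2 g)"
      if cov: "\<forall>x\<in>B2. \<exists>n\<in>B1. \<exists>k\<in>B2 \<inter> ?S. x = n \<otimes>\<^bsub>E\<^esub> k"
      using E.scalar_section_step[OF B E.submod_one cov s3] E.simple_section_not_cover_one[OF B]
      unfolding PB cG by argo
    ultimately show ?thesis by blast
  qed
  have nz: "ent\<^sub>1\<^sub>1 g \<noteq> 0" "ent\<^sub>2\<^sub>2 g \<noteq> 0" if "g \<in> G" for g using tri_nonzero[OF t that] .
  from Acase Bcase show False
  proof (elim disjE)
    assume "P ent\<^sub>1\<^sub>1" "P (\<lambda>g. ent\<^sub>2\<^sub>2 g / ent\<^sub>1\<^sub>1 g)"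
    then have "ent\<^sub>1\<^sub>1 g = ent\<^sub>2\<^sub>2 g / ent\<^sub>1\<^sub>1 g" if "g \<in> G" for g using uniq that by blast
    then show False using c(4) nz by (fastforce simp: field_simps power2_eq_square)
  next
    assume "P ent\<^sub>1\<^sub>1" "P (\<lambda>g. 1)"
    then show False using c(1) uniq[of ent\<^sub>1\<^sub>1 "\<lambda>g. 1"] by blast
  next
    assume "P ent\<^sub>1\<^sub>1" "P (\<lambda>g. ent\<^sub>1\<^sub>1 g / ent\<^sub>2\<^sub>2 g)"
    then have "ent\<^sub>1\<^sub>1 g = ent\<^sub>1\<^sub>1 g / ent\<^sub>2\<^sub>2 g" if "g \<in> G" for g using uniq that by blast
    then show False using c(3) nz by (fastforce simp: field_simps)
  next
    assume "P ent\<^sub>2\<^sub>2" "P (\<lambda>g. ent\<^sub>2\<^sub>2 g / ent\<^sub>1\<^sub>1 g)"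
    then have "ent\<^sub>2\<^sub>2 g = ent\<^sub>2\<^sub>2 g / ent\<^sub>1\<^sub>1 g" if "g \<in> G" for g using uniq that by blast
    then show False using c(1) nz by (fastforce simp: field_simps)
  next
    assume "P ent\<^sub>2\<^sub>2" "P (\<lambda>g. 1)"
    then show False using c(3) uniq[of ent\<^sub>2\<^sub>2 "\<lambda>g. 1"] by blast
  next
    assume "P ent\<^sub>2\<^sub>2" "P (\<lambda>g. ent\<^sub>1\<^sub>1 g / ent\<^sub>2\<^sub>2 g)"
    then have "ent\<^sub>2\<^sub>2 g = ent\<^sub>1\<^sub>1 g / ent\<^sub>2\<^sub>2 g" if "g \<in> G" for g using uniq that by blast
    then show False using c(2) nz by (fastforce simp: field_simps power2_eq_square)
  qed
qed

end

section \<open>Copies of the symmetric group on three letters\<close>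

lemma permutes3_cases:
  assumes "\<pi> permutes {1..3::nat}"
  shows "(\<pi> 1, \<pi> 2, \<pi> 3) \<in> {(1,2,3), (1,3,2), (2,1,3), (2,3,1), (3,1,2), (3,2,1)}"
proof -
  have in3: "\<pi> i = 1 \<or> \<pi> i = 2 \<or> \<pi> i = 3" if "i \<in> {1..3}" for i
  proof -
    have "\<pi> i \<in> {1..3}" using that by (simp only: permutes_in_image[OF assms])
    then show ?thesis unfolding atLeastAtMost_iff by arith
  qed
  have "\<pi> 1 \<noteq> \<pi> 2" "\<pi> 1 \<noteq> \<pi> 3" "\<pi> 2 \<noteq> \<pi> 3"
    using permutes_inj[OF assms] by (simp_all add: inj_eq)
  moreover have "\<pi> 1 = 1 \<or> \<pi> 1 = 2 \<or> \<pi> 1 = 3" "\<pi> 2 = 1 \<or> \<pi> 2 = 2 \<or> \<pi> 2 = 3"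
    "\<pi> 3 = 1 \<or> \<pi> 3 = 2 \<or> \<pi> 3 = 3"
    by (rule in3; simp)+
  ultimately show ?thesis unfolding insert_iff empty_iff prod.inject by metis
qed

lemma permutes3_eqI:
  assumes "\<pi> permutes {1..3::nat}" "\<rho> permutes {1..3}" "\<pi> 1 = \<rho> 1" "\<pi> 2 = \<rho> 2" "\<pi> 3 = \<rho> 3"
  shows "\<pi> = \<rho>"
proof
  fix i
  show "\<pi> i = \<rho> i"
  proof (cases "i \<in> {1..3}")
    case True
    then have "i = 1 \<or> i = 2 \<or> i = 3" by auto
    then show ?thesis using assms by auto
  next
    case False
    then show ?thesis using permutes_not_in[OF assms(1)] permutes_not_in[OF assms(2)] by simp
  qed
qed

lemma transpose_permutes3: "i \<in> {1..3::nat} \<Longrightarrow> j \<in> {1..3} \<Longrightarrow> transpose i j permutes {1..3}"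
  by (rule permutes_swap_id)

lemma permutes3_fix_1:
  assumes "\<pi> permutes {1..3::nat}" "\<pi> 1 = 1"
  shows "\<pi> = id \<or> \<pi> = transpose 2 3"
proof -
  have "\<pi> 2 = 2 \<and> \<pi> 3 = 3 \<or> \<pi> 2 = 3 \<and> \<pi> 3 = 2"
    using permutes3_cases[OF assms(1)] assms(2) by auto
  then show ?thesis
    using permutes3_eqI[OF assms(1) permutes_id] permutes3_eqI[OF assms(1) transpose_permutes3[of 2 3]]
      assms(2) by (auto simp: transpose_def)
qed

lemma permutes3_ex:
  assumes "i \<in> {1,2,3::nat}" "j \<in> {1,2,3}" "i \<noteq> j"
  shows "\<exists>\<pi>. \<pi> permutes {1..3} \<and> \<pi> 1 = i \<and> \<pi> 2 = j"
proof -
  note t = transpose_permutes3 permutes_compose[OF transpose_permutes3 transpose_permutes3]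
  have "(i, j) \<in> {(1,2), (1,3), (2,1), (2,3), (3,1), (3,2)}" using assms by auto
  moreover have "\<exists>\<pi>. \<pi> permutes {1..3::nat} \<and> \<pi> 1 = 1 \<and> \<pi> 2 = 2"
    by (rule exI[of _ id]) (simp add: permutes_id)
  moreover have "\<exists>\<pi>. \<pi> permutes {1..3::nat} \<and> \<pi> 1 = 1 \<and> \<pi> 2 = 3"
    by (rule exI[of _ "transpose 2 3"]) (simp add: t transpose_def del: One_nat_def)
  moreover have "\<exists>\<pi>. \<pi> permutes {1..3::nat} \<and> \<pi> 1 = 2 \<and> \<pi> 2 = 1"
    by (rule exI[of _ "transpose 1 2"]) (simp add: t transpose_def del: One_nat_def)
  moreover have "\<exists>\<pi>. \<pi> permutes {1..3::nat} \<and> \<pi> 1 = 2 \<and> \<pi> 2 = 3"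
    by (rule exI[of _ "transpose 1 2 \<circ> transpose 2 3"]) (simp add: t transpose_def del: One_nat_def)
  moreover have "\<exists>\<pi>. \<pi> permutes {1..3::nat} \<and> \<pi> 1 = 3 \<and> \<pi> 2 = 1"
    by (rule exI[of _ "transpose 2 3 \<circ> transpose 1 2"]) (simp add: t transpose_def del: One_nat_def)
  moreover have "\<exists>\<pi>. \<pi> permutes {1..3::nat} \<and> \<pi> 1 = 3 \<and> \<pi> 2 = 2"
    by (rule exI[of _ "transpose 1 3"]) (simp add: t transpose_def del: One_nat_def)
  ultimately show ?thesis by blast
qed

context plane_group
begin

text \<open>\<open>T\<close> lets permutations of three letters act on the vectors
  \<open>w i\<close> of sum 0. The action is faithful in every characteristic because these vectors
  are distinct, and every map satisfying \<open>triangle\<close> is in its image.\<close>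

lemma triangle_in_S3:
  assumes tri: "\<And>g. g \<in> G \<Longrightarrow> triangle g"
  shows "\<exists>S. subgroup S (GL scale) \<and> restr_GL scale S \<cong> sym_group 3 \<and> G \<subseteq> S"
proof -
  define w where "w = (\<lambda>i::nat. if i = 1 then e\<^sub>1 else if i = 2 then e\<^sub>2 else e\<^sub>3)"
  define T where "T = (\<lambda>(\<pi>::nat \<Rightarrow> nat) v. X v *s w (\<pi> 1) + Y v *s w (\<pi> 2))"
  have T_app: "T \<pi> v = X v *s w (\<pi> 1) + Y v *s w (\<pi> 2)" for \<pi> v by (simp add: T_def)
  have w_simps: "w 1 = e\<^sub>1" "w 2 = e\<^sub>2" "w 3 = e\<^sub>3" by (simp_all add: w_def)
  have w_inj: "i = j" if "w i = w j" "i \<in> {1,2,3}" "j \<in> {1,2,3}" for i j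
    using that by (auto simp: w_def e\<^sub>3_def vec_eq_iff split: if_splits)
  have T_lin: "lin (T \<pi>)" for \<pi>
    by (simp add: lin_iff T_def scale_left_distrib scale_right_distrib algebra_simps)
  \<comment> \<open>The vanishing sum enters for \<open>i = 3\<close>: the images of
    \<open>e\<^sub>1\<close> and \<open>e\<^sub>2\<close> determine that of
    \<open>e\<^sub>3\<close>.\<close>
  have T_w: "T \<pi> (w i) = w (\<pi> i)" if \<pi>: "\<pi> permutes {1..3}" and i: "i \<in> {1,2,3}" for \<pi> i
  proof -
    have "w (\<pi> 1) + w (\<pi> 2) + w (\<pi> 3) = 0"
      using permutes3_cases[OF \<pi>] by (auto simp: w_def e\<^sub>3_def)
    then have "w (\<pi> 3) = - w (\<pi> 1) - w (\<pi> 2)" by (simp add: eq_neg_iff_add_eq_0 algebra_simps)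
    then show ?thesis using i by (auto simp: T_def w_simps e\<^sub>3_def simp del: One_nat_def)
  qed
  have T_comp: "T (\<pi> \<circ> \<rho>) = T \<pi> \<circ> T \<rho>" if \<pi>: "\<pi> permutes {1..3}" and \<rho>: "\<rho> permutes {1..3}" for \<pi> \<rho>
  proof
    fix v
    have r: "\<rho> 1 \<in> {1,2,3}" "\<rho> 2 \<in> {1,2,3}" using permutes3_cases[OF \<rho>] by auto
    have "T \<pi> (T \<rho> v) = X v *s T \<pi> (w (\<rho> 1)) + Y v *s T \<pi> (w (\<rho> 2))"
      unfolding T_app[of \<rho>] by (simp only: linD[OF T_lin])
    also have "\<dots> = T (\<pi> \<circ> \<rho>) v"
      unfolding T_w[OF \<pi> r(1)] T_w[OF \<pi> r(2)] by (simp add: T_def)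
    finally show "T (\<pi> \<circ> \<rho>) v = (T \<pi> \<circ> T \<rho>) v" by simp
  qed
  have T_id: "T id = id" by (rule ext) (simp add: T_def w_simps decomp[symmetric] del: One_nat_def)
  have T_bij: "bij (T \<pi>)" if \<pi>: "\<pi> permutes {1..3}" for \<pi>
  proof -
    have "T \<pi> \<circ> T (finv \<pi>) = id" "T (finv \<pi>) \<circ> T \<pi> = id"
      using T_comp[OF \<pi> permutes_inv[OF \<pi>]] T_comp[OF permutes_inv[OF \<pi>] \<pi>] T_id permutes_inv_o[OF \<pi>]
      by simp_all
    then show ?thesis by (metis o_bij)
  qed
  have hom: "T \<in> hom (sym_group 3) (GL scale)"
    by (auto simp: hom_def sym_group_carrier sym_group_mult GL_carrier T_lin T_bij T_comp)
  interpret H: group_hom "sym_group 3" "GL scale" T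
    by (intro group_hom.intro sym_group_is_group group_GL group_hom_axioms.intro hom)
  define S where "S = T ` carrier (sym_group 3)"
  have inj: "inj_on T (carrier (sym_group 3))"
  proof (rule inj_onI)
    fix \<pi> \<rho> assume *: "\<pi> \<in> carrier (sym_group 3)" "\<rho> \<in> carrier (sym_group 3)" "T \<pi> = T \<rho>"
    then have p: "\<pi> permutes {1..3}" "\<rho> permutes {1..3}" by (simp_all add: sym_group_carrier)
    have "\<pi> i = \<rho> i" if i: "i \<in> {1,2,3}" for i
    proof (rule w_inj)
      show "w (\<pi> i) = w (\<rho> i)" using T_w[OF p(1) i] T_w[OF p(2) i] *(3) by simp
    qed (use permutes3_cases[OF p(1)] permutes3_cases[OF p(2)] i in auto)
    then show "\<pi> = \<rho>" by (intro permutes3_eqI[OF p]) auto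
  qed
  have "T \<in> iso (sym_group 3) (restr_GL scale S)"
    using hom inj by (auto simp: iso_def hom_def bij_betw_def S_def)
  then have "restr_GL scale S \<cong> sym_group 3"
    using group.iso_sym[OF sym_group_is_group] by (auto simp: is_iso_def)
  moreover have "subgroup S (GL scale)" unfolding S_def by (rule H.img_is_subgroup)
  moreover have "G \<subseteq> S"
  proof
    fix g assume g: "g \<in> G"
    have "\<exists>i\<in>{1,2,3}. v = w i" if "v \<in> {e\<^sub>1, e\<^sub>2, e\<^sub>3}" for v using that by (auto simp: w_simps simp del: One_nat_def)
    then obtain i j where ij: "i \<in> {1,2,3}" "j \<in> {1,2,3}" "g e\<^sub>1 = w i" "g e\<^sub>2 = w j" "i \<noteq> j"
      using tri[OF g] unfolding triangle_def by metis
    then obtain \<pi> where \<pi>: "\<pi> permutes {1..3}" "\<pi> 1 = i" "\<pi> 2 = j" using permutes3_ex by blast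
    have "g = T \<pi>"
      using T_w[OF \<pi>(1), of 1] T_w[OF \<pi>(1), of 2] \<pi> ij
      by (simp add: lin_eq_iff[OF G_lin[OF g] T_lin] ent_defs w_simps del: One_nat_def)
    then show "g \<in> S" using \<pi>(1) by (auto simp: S_def sym_group_carrier)
  qed
  ultimately show ?thesis by blast
qed

text \<open>The three vectors are translates of a nonzero \<open>v\<close> fixed by the image of
  \<open>transpose 2 3\<close>, the nontrivial permutation fixing 1; so a translate depends only on
  where the permutation sends 1. Their sum is fixed by \<open>G\<close>, and the triangle is needed
  only when it vanishes.\<close>

lemma S3_common:
  assumes S: "subgroup S (GL scale)" "restr_GL scale S \<cong> sym_group 3" "G \<subseteq> S"
  shows "common_composition_factor \<Gamma> V E"
proof -
  have "group (restr_GL scale S)" by (rule group.subgroup_imp_group[OF group_GL S(1)])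
  then obtain \<psi> where \<psi>: "\<psi> \<in> iso (sym_group 3) (restr_GL scale S)"
    using group.iso_sym S(2) unfolding is_iso_def by blast
  then have inj: "inj_on \<psi> {\<pi>. \<pi> permutes {1..3}}" and img: "\<psi> ` {\<pi>. \<pi> permutes {1..3}} = S"
    by (auto simp: iso_def bij_betw_def sym_group_def)
  have comp: "\<psi> (\<pi> \<circ> \<rho>) v = \<psi> \<pi> (\<psi> \<rho> v)" if "\<pi> permutes {1..3}" "\<rho> permutes {1..3}" for \<pi> \<rho> v
    using \<psi> that by (simp add: iso_def hom_def sym_group_def)
  have lin: "lin (\<psi> \<pi>)" and bij: "bij (\<psi> \<pi>)" if "\<pi> permutes {1..3}" for \<pi>
    using img that subgroup.subset[OF S(1)] GL_carrier by blast+
  have id: "\<psi> id = id"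
  proof
    fix v
    have "\<psi> id (\<psi> id v) = \<psi> id v" using comp[OF permutes_id permutes_id] by simp
    then show "\<psi> id v = id v" using bij[OF permutes_id] by (simp add: bij_def inj_eq)
  qed
  have t: "transpose i j permutes {1..3}" if "i \<in> {1,2,3}" "j \<in> {1,2,3}" for i j :: nat
    using that by (intro transpose_permutes3) auto
  have t23: "transpose 2 3 permutes {1..3::nat}" and t12: "transpose 1 2 permutes {1..3::nat}" by (rule t; simp)+
  define \<tau> where "\<tau> = \<psi> (transpose 2 3)"
  \<comment> \<open>Otherwise the transposition acts as -1 and commutes with every linear map, which
    injectivity of \<open>\<psi>\<close> forbids. Characteristic 2 is covered, with -1 the
    identity.\<close>
  have "\<exists>u. \<tau> u + u \<noteq> 0"
  proof (rule ccontr)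
    assume "\<not> ?thesis"
    then have m: "\<tau> u = - u" for u by (metis eq_neg_iff_add_eq_0)
    have "\<psi> (transpose 1 2 \<circ> transpose 2 3) = \<psi> (transpose 2 3 \<circ> transpose 1 2)"
    proof
      fix v
      show "\<psi> (transpose 1 2 \<circ> transpose 2 3) v = \<psi> (transpose 2 3 \<circ> transpose 1 2) v"
        unfolding comp[OF t12 t23] comp[OF t23 t12] \<tau>_def[symmetric] m by (rule linD(4)[OF lin[OF t12]])
    qed
    then have "transpose 1 2 \<circ> transpose 2 3 = transpose 2 3 \<circ> transpose 1 (2::nat)"
      using inj permutes_compose[OF t12 t23] permutes_compose[OF t23 t12] by (auto dest: inj_onD)
    from fun_cong[OF this, of 1] show False by (simp add: transpose_def)
  qed
  then obtain u where u: "\<tau> u + u \<noteq> 0" by blast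
  define v where "v = \<tau> u + u"
  have v0: "v \<noteq> 0" using u by (simp add: v_def)
  have "\<tau> (\<tau> u) = u" using comp[OF t23 t23] id by (simp add: \<tau>_def)
  then have \<tau>v: "\<tau> v = v" unfolding v_def by (simp add: linD[OF lin[OF t23, folded \<tau>_def]] add.commute)
  define w where "w = (\<lambda>i. \<psi> (transpose 1 i) v)"
  have w1: "w 1 = v" by (simp add: w_def id)
  have act: "\<psi> \<pi> (w i) = w (\<pi> i)" if \<pi>: "\<pi> permutes {1..3}" and i: "i \<in> {1,2,3}" for \<pi> i
  proof -
    have \<pi>i: "\<pi> i \<in> {1,2,3}" using permutes3_cases[OF \<pi>] i by auto
    \<comment> \<open>\<open>\<rho>\<close> fixes 1, so it is the identity or
      \<open>transpose 2 3\<close>, and its image fixes \<open>v\<close>.\<close>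
    define \<rho> where "\<rho> = transpose 1 (\<pi> i) \<circ> (\<pi> \<circ> transpose 1 i)"
    have p: "\<pi> \<circ> transpose 1 i permutes {1..3}" using t[of 1 i] \<pi> i by (simp add: permutes_compose)
    have \<rho>: "\<rho> permutes {1..3}" unfolding \<rho>_def using p t[of 1 "\<pi> i"] \<pi>i by (simp add: permutes_compose)
    moreover have "\<rho> 1 = 1" by (simp add: \<rho>_def)
    ultimately have "\<rho> = id \<or> \<rho> = transpose 2 3" by (rule permutes3_fix_1)
    then have \<rho>v: "\<psi> \<rho> v = v" using \<tau>v by (auto simp: id \<tau>_def)
    have "\<pi> \<circ> transpose 1 i = transpose 1 (\<pi> i) \<circ> \<rho>"
      by (auto simp: \<rho>_def fun_eq_iff)
    then have "\<psi> (\<pi> \<circ> transpose 1 i) v = \<psi> (transpose 1 (\<pi> i)) (\<psi> \<rho> v)"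
      using comp[OF t[of 1 "\<pi> i"] \<rho>] \<pi>i by simp
    then show ?thesis using comp[OF \<pi> t[of 1 i]] i \<rho>v by (simp add: w_def)
  qed
  have G\<psi>: "\<exists>\<pi>. \<pi> permutes {1..3} \<and> g = \<psi> \<pi>" if "g \<in> G" for g using that S(3) img by blast
  define s where "s = w 1 + w 2 + w 3"
  have s_fixed: "g s = s" if g: "g \<in> G" for g
  proof -
    obtain \<pi> where \<pi>: "\<pi> permutes {1..3}" "g = \<psi> \<pi>" using G\<psi>[OF g] by blast
    have "g s = w (\<pi> 1) + w (\<pi> 2) + w (\<pi> 3)"
      using act[OF \<pi>(1)] \<pi>(2) by (simp add: s_def linD[OF lin[OF \<pi>(1)]])
    also have "\<dots> = s" using permutes3_cases[OF \<pi>(1)] by (auto simp: s_def add_ac)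
    finally show ?thesis .
  qed
  show ?thesis
  proof (cases "s = 0")
    case False
    then show ?thesis using s_fixed by (rule common_fixed)
  next
    case s0: True
    show ?thesis
    proof (cases "X (w 1) * Y (w 2) - Y (w 1) * X (w 2) = 0")
      case True
      \<comment> \<open>\<open>transpose 2 3\<close> exchanges \<open>w 2\<close> and
        \<open>w 3\<close> and fixes \<open>w 1\<close>, so applying it to
        \<open>w 2 = \<alpha> *s w 1\<close> gives \<open>w 3 = w 2\<close>; then
        \<open>transpose 1 2\<close> gives \<open>w 3 = w 1\<close>. Hence all three equal
        \<open>v\<close>, which \<open>G\<close> fixes.\<close>
      then obtain \<alpha> where "w 2 = \<alpha> *s w 1" using parallel v0 w1 by metis
      then have "\<psi> (transpose 2 3) (w 2) = \<alpha> *s \<psi> (transpose 2 3) (w 1)"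
        by (simp add: linD[OF lin[OF t23]])
      then have "w 3 = w 2"
        using act[OF t23, of 1] act[OF t23, of 2] \<open>w 2 = \<alpha> *s w 1\<close> by (simp add: transpose_def)
      moreover have "\<psi> (transpose 1 2) (w 3) = w 3" "\<psi> (transpose 1 2) (w 2) = w 1"
        using act[OF t12, of 3] act[OF t12, of 2] by (simp_all add: transpose_def)
      ultimately have w: "w 1 = v" "w 2 = v" "w 3 = v" using w1 by simp_all
      have "g v = v" if g: "g \<in> G" for g
      proof -
        obtain \<pi> where \<pi>: "\<pi> permutes {1..3}" "g = \<psi> \<pi>" using G\<psi>[OF g] by blast
        have "g v = w (\<pi> 1)" using act[OF \<pi>(1), of 1] \<pi>(2) w by simp
        then show ?thesis using permutes3_cases[OF \<pi>(1)] w by auto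
      qed
      with v0 show ?thesis by (rule common_fixed)
    next
      case False
      then obtain X' Y' where F: "frame scale (w 1) (w 2) X' Y'" using new_frame by blast
      interpret P: plane_group scale "w 1" "w 2" X' Y' G
        by (intro plane_group.intro plane_group_axioms.intro F subG)
      have e3: "P.e\<^sub>3 = w 3" using minus_unique[of "w 1 + w 2" "w 3"] s0 by (simp only: P.e\<^sub>3_def s_def)
      have "w 1 \<noteq> w 2" by (metis P.coord_simps(7,9) zero_neq_one)
      have "P.triangle g" if g: "g \<in> G" for g
      proof -
        obtain \<pi> where \<pi>: "\<pi> permutes {1..3}" "g = \<psi> \<pi>" using G\<psi>[OF g] by blast
        have "g (w 1) = w (\<pi> 1)" "g (w 2) = w (\<pi> 2)" using act[OF \<pi>(1)] \<pi>(2) by simp_all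
        moreover have "g (w 1) \<noteq> g (w 2)" using G_bij[OF g] \<open>w 1 \<noteq> w 2\<close> by (simp add: bij_def inj_eq)
        ultimately show ?thesis
          unfolding P.triangle_def e3 using permutes3_cases[OF \<pi>(1)] by auto
      qed
      then show ?thesis by (rule P.common_triangle)
    qed
  qed
qed

text \<open>Over the field with two elements \<open>e\<^sub>1\<close>, \<open>e\<^sub>2\<close>,
  \<open>e\<^sub>3\<close> are all the nonzero vectors, and every invertible linear map permutes
  them. This is what excludes p = 2.\<close>

lemma card2_triangle:
  assumes "\<And>x::'k. x = 0 \<or> x = 1" "g \<in> G"
  shows "triangle g"
proof -
  have m: "(-1::'k) = 1" using assms(1)[of "-1"] by auto
  have inj: "g u = g v \<longleftrightarrow> u = v" for u v using G_bij[OF assms(2)] by (simp add: bij_def inj_eq)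
  have ne: "e\<^sub>1 \<noteq> e\<^sub>2" "e\<^sub>1 \<noteq> 0" "e\<^sub>2 \<noteq> 0" by (auto simp: vec_eq_iff)
  have "u \<in> {e\<^sub>1, e\<^sub>2, e\<^sub>3}" if "u \<noteq> 0" for u
    using that assms(1)[of "X u"] assms(1)[of "Y u"] m by (auto simp: vec_eq_iff e\<^sub>3_def)
  moreover have "g e\<^sub>1 \<noteq> 0" "g e\<^sub>2 \<noteq> 0" "g e\<^sub>1 \<noteq> g e\<^sub>2"
    using inj[of _ 0] linD(3)[OF G_lin[OF assms(2)]] ne inj by auto
  ultimately show ?thesis by (simp add: triangle_def)
qed

section \<open>First cohomology\<close>

lemma lin_sum: "lin f \<Longrightarrow> f (sum h A) = (\<Sum>x\<in>A. f (h x))"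
  by (induction A rule: infinite_finite_induct) (simp_all add: linD)

lemma finite_G: "finite G"
  by (rule finite_subset[of _ "{f. lin f}"]) (use G_lin finite_E in auto)

definition "cocycle f \<longleftrightarrow> (\<forall>g\<in>G. \<forall>h\<in>G. f (g \<circ> h) = f g + g (f h))"

lemma trivial_H1I_cocycle:
  assumes "\<And>f. cocycle f \<Longrightarrow> \<exists>v. \<forall>g\<in>G. f g = g v - v"
  shows "trivial_group (H1 \<Gamma> V)"
proof (rule V.trivial_H1I)
  fix f
  assume "\<And>g h. g \<in> carrier \<Gamma> \<Longrightarrow> h \<in> carrier \<Gamma> \<Longrightarrow> f (g \<otimes>\<^bsub>\<Gamma>\<^esub> h) = f g \<otimes>\<^bsub>V\<^esub> act V g (f h)"
  then have "cocycle f" by (simp add: cocycle_def)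
  from assms[OF this] show "\<exists>v\<in>carrier V. \<forall>g\<in>carrier \<Gamma>. f g = act V g v \<otimes>\<^bsub>V\<^esub> inv\<^bsub>V\<^esub> v" by simp
qed (auto simp: G_comp)

text \<open>Since -1 is central, a cocycle agrees on \<open>g \<circ> uminus\<close> and
  \<open>uminus \<circ> g\<close>. Expanding both sides gives
  \<open>2 *s f g = f uminus - g (f uminus)\<close>.\<close>

lemma trivial_H1_minus:
  assumes m: "uminus \<in> G" and two: "(2::'k) \<noteq> 0"
  shows "trivial_group (H1 \<Gamma> V)"
proof (rule trivial_H1I_cocycle)
  fix f assume f: "cocycle f"
  let ?v = "(- (1 / 2)) *s f uminus"
  have "f g = g ?v - ?v" if g: "g \<in> G" for g
  proof -
    have "g \<circ> uminus = uminus \<circ> g" by (rule ext) (simp add: linD[OF G_lin[OF g]])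
    then have "f g + g (f uminus) = f uminus + - f g"
      using f g m unfolding cocycle_def by (metis (no_types, lifting))
    then have "2 *s f g = f uminus - g (f uminus)"
      by (simp add: vec_eq_iff algebra_simps)
    then have "(1 / 2) *s 2 *s f g = (1 / 2) *s (f uminus - g (f uminus))" by simp
    then show ?thesis using two by (simp add: linD[OF G_lin[OF g]] scale_right_diff_distrib)
  qed
  then show "\<exists>v. \<forall>g\<in>G. f g = g v - v" by blast
qed

lemma trivial_H1_card:
  assumes n: "of_nat (card G) \<noteq> (0::'k)"
  shows "trivial_group (H1 \<Gamma> V)"
proof (rule trivial_H1I_cocycle)
  fix f assume f: "cocycle f"
  let ?n = "of_nat (card G) :: 'k"
  \<comment> \<open>Summing the cocycle identity over its second argument gives
    \<open>s = ?n *s f g + g s\<close>, which dictates \<open>?v\<close>.\<close>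
  define s where "s = (\<Sum>h\<in>G. f h)"
  let ?v = "(- (1 / ?n)) *s s"
  have "f g = g ?v - ?v" if g: "g \<in> G" for g
  proof -
    have "bij_betw (\<lambda>h. g \<circ> h) G G"
      by (rule bij_betwI[of _ _ _ "\<lambda>h. finv g \<circ> h"]) (auto simp: g G_comp G_inv fun_eq_iff)
    then have "s = (\<Sum>h\<in>G. f (g \<circ> h))"
      unfolding s_def by (rule sum.reindex_bij_betw[symmetric])
    also have "\<dots> = (\<Sum>h\<in>G. f g + g (f h))"
      using f g by (intro sum.cong) (auto simp: cocycle_def)
    also have "\<dots> = ?n *s f g + g s"
      by (simp only: sum.distrib sum_constant_scale lin_sum[OF G_lin[OF g]] s_def)
    finally have "?n *s f g = s - g s" by (simp add: algebra_simps)
    then have "(1 / ?n) *s ?n *s f g = (1 / ?n) *s (s - g s)" by simp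
    then show ?thesis using n by (simp add: linD[OF G_lin[OF g]] scale_right_diff_distrib)
  qed
  then show "\<exists>v. \<forall>g\<in>G. f g = g v - v" by blast
qed

text \<open>At g = -1 the polynomial t - 1 annihilates End(V), while on V it is multiplication by
  -2, which is invertible and so annihilates no section.\<close>

lemma not_common_minus:
  assumes m: "uminus \<in> G" and two: "(2::'k) \<noteq> 0"
  shows "\<not> common_composition_factor \<Gamma> V E"
proof
  assume "common_composition_factor \<Gamma> V E"
  then obtain A1 A2 B1 B2 where A: "V.simple_section A1 A2" and B: "E.simple_section B1 B2"
    and eq: "\<And>g cs. g \<in> G \<Longrightarrow> (\<forall>x\<in>A2. peval V g cs x \<in> A1) \<longleftrightarrow> (\<forall>x\<in>B2. peval E g cs x \<in> B1)"
    using common_composition_factor_peval[OF V.gmod_axioms finite_V E.gmod_axioms finite_E] by auto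
  have As: "submod \<Gamma> A1 V" "A1 \<subset> A2" using A by (auto simp: V.simple_section_def)
  have Bs: "submod \<Gamma> B1 E" "submod \<Gamma> B2 E" using B by (auto simp: E.simple_section_def)
  have "peval E uminus [- 1, 1] f \<in> B1" if "f \<in> B2" for f
  proof -
    have "lin f" using E.submodD(8)[OF Bs(2) that] by simp
    have "finv uminus (v :: 'v) = - v" for v by (rule inv_f_eq) simp_all
    then have "peval E uminus [- 1, 1] f = (\<lambda>v. 0)"
      by (auto simp: fun_eq_iff linD[OF \<open>lin f\<close>])
    then show ?thesis using E.submodD(2)[OF Bs(1)] by simp
  qed
  then have *: "\<forall>x\<in>A2. peval V uminus [- 1, 1] x \<in> A1" using eq[OF m] by blast
  have "x \<in> A1" if "x \<in> A2" for x
  proof -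
    have eq2: "peval V uminus [- 1, 1] x = (- 2) *s x" by (simp add: vec_eq_iff)
    have "(- 2) *s x \<in> A1" using * that unfolding eq2[symmetric] by blast
    then have "(- (1 / 2)) *s (- 2) *s x \<in> A1" by (rule V.submodD(4)[OF As(1), simplified])
    then show ?thesis using two by simp
  qed
  then show False using As(2) by blast
qed

end

section \<open>Unipotent elements and cohomology over the prime field\<close>

locale plane_group_p = plane_group scale e\<^sub>1 e\<^sub>2 X Y G
  for scale :: "'p::prime_card mod_ring \<Rightarrow> 'v::ab_group_add \<Rightarrow> 'v" (infixr "*s" 75)
    and e\<^sub>1 e\<^sub>2 X Y G
begin

text \<open>Conjugation by \<open>g\<^sub>0\<close> raises the unipotent \<open>u\<close> to the
  power m, a natural number representing the ratio of the diagonal entries of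
  \<open>g\<^sub>0\<close>. On unipotent elements \<open>\<phi>\<close> is additive, so evaluating
  it on both sides of \<open>g\<^sub>0 \<circ> u = (u ^^ m) \<circ> g\<^sub>0\<close> shows that
  \<open>\<psi> g\<^sub>0\<close> and this ratio multiply \<open>\<phi> u\<close> to the same value,
  though they differ.\<close>

lemma char_cocycle_zero:
  fixes \<phi> \<psi> :: "('v \<Rightarrow> 'v) \<Rightarrow> 'p mod_ring"
  assumes t: "triangular"
    and \<phi>: "\<And>g h. g \<in> G \<Longrightarrow> h \<in> G \<Longrightarrow> \<phi> (g \<circ> h) = \<phi> g + \<psi> g * \<phi> h"
    and \<psi>U: "\<And>u. u \<in> G \<Longrightarrow> ent\<^sub>1\<^sub>1 u = 1 \<Longrightarrow> ent\<^sub>2\<^sub>2 u = 1 \<Longrightarrow> \<psi> u = 1"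
    and ne: "g\<^sub>0 \<in> G" "\<psi> g\<^sub>0 \<noteq> ent\<^sub>1\<^sub>1 g\<^sub>0 / ent\<^sub>2\<^sub>2 g\<^sub>0"
    and u: "u \<in> G" "ent\<^sub>1\<^sub>1 u = 1" "ent\<^sub>2\<^sub>2 u = 1"
  shows "\<phi> u = 0"
proof -
  have c: "ent\<^sub>2\<^sub>1 g = 0" if "g \<in> G" for g using t that by (simp add: triangular_def)
  have \<phi>id: "\<phi> id = 0" using \<phi>[OF G_id G_id] \<psi>U[OF G_id] by (metis add_cancel_right_right comp_id ent_id(1,4) mult_1)
  have pow: "ent\<^sub>1\<^sub>1 (u ^^ m) = 1 \<and> ent\<^sub>2\<^sub>2 (u ^^ m) = 1 \<and> ent\<^sub>1\<^sub>2 (u ^^ m) = of_nat m * ent\<^sub>1\<^sub>2 u \<and>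
      \<phi> (u ^^ m) = of_nat m * \<phi> u" for m
  proof (induction m)
    case (Suc m)
    have e: "u ^^ Suc m = u \<circ> u ^^ m" by (rule funpow.simps(2))
    show ?case
      using Suc c[OF G_funpow[OF u(1)], of m] c[OF u(1)] u \<phi>[OF u(1) G_funpow[OF u(1)], of m, folded e]
        \<psi>U[OF u] ent_comp[OF G_lin[OF u(1)], of "u ^^ m", folded e]
      by (simp add: algebra_simps del: funpow.simps)
  next
    case 0
    have e: "u ^^ 0 = id" by (rule funpow.simps(1))
    show ?case by (simp only: e ent_id \<phi>id of_nat_0 mult_zero_left simp_thms)
  qed
  let ?r = "ent\<^sub>1\<^sub>1 g\<^sub>0 / ent\<^sub>2\<^sub>2 g\<^sub>0"
  obtain m where m: "?r = of_nat m" using surj_of_nat_mod_ring by blast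
  let ?u = "u ^^ m"
  have uG: "?u \<in> G" by (rule G_funpow[OF u(1)])
  note nz = tri_nonzero[OF t ne(1)]
  have "g\<^sub>0 \<circ> u = ?u \<circ> g\<^sub>0"
  proof -
    have "ent\<^sub>1\<^sub>1 g\<^sub>0 * ent\<^sub>1\<^sub>2 u = ent\<^sub>1\<^sub>2 ?u * ent\<^sub>2\<^sub>2 g\<^sub>0"
      using pow[of m] nz by (simp flip: m)
    then show ?thesis
      using pow[of m] u c[OF u(1)] c[OF uG] c[OF ne(1)]
      by (simp add: lin_eq_iff lin_comp G_lin u(1) uG ne(1) ent_comp[OF G_lin[OF ne(1)]]
          ent_comp[OF G_lin[OF uG]])
  qed
  then have "\<phi> g\<^sub>0 + \<psi> g\<^sub>0 * \<phi> u = \<phi> ?u + \<psi> ?u * \<phi> g\<^sub>0"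
    using \<phi>[OF ne(1) u(1)] \<phi>[OF uG ne(1)] by metis
  then have "\<psi> g\<^sub>0 * \<phi> u = \<phi> ?u" using \<psi>U[OF uG] pow[of m] by (metis add.commute add_left_cancel mult_1)
  then have "\<psi> g\<^sub>0 * \<phi> u = ?r * \<phi> u" using pow[of m] m by metis
  then show ?thesis using ne(2) by (metis mult_cancel_right)
qed

text \<open>Commutators of a triangular group are unipotent, so a cocycle vanishing on unipotent elements
  satisfies \<open>\<phi> (g \<circ> h) = \<phi> (h \<circ> g)\<close>; comparing both sides makes it a coboundary.\<close>

lemma char_cocycle_coboundary:
  fixes \<phi> \<psi> :: "('v \<Rightarrow> 'v) \<Rightarrow> 'p mod_ring"
  assumes t: "triangular"
    and \<phi>: "\<And>g h. g \<in> G \<Longrightarrow> h \<in> G \<Longrightarrow> \<phi> (g \<circ> h) = \<phi> g + \<psi> g * \<phi> h"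
    and U: "\<And>u. u \<in> G \<Longrightarrow> ent\<^sub>1\<^sub>1 u = 1 \<Longrightarrow> ent\<^sub>2\<^sub>2 u = 1 \<Longrightarrow> \<phi> u = 0"
    and ne: "h \<in> G" "\<psi> h \<noteq> 1"
  shows "\<exists>k. \<forall>g\<in>G. \<phi> g = k * (\<psi> g - 1)"
proof -
  have c: "ent\<^sub>2\<^sub>1 g = 0" if "g \<in> G" for g using t that by (simp add: triangular_def)
  have "\<phi> g = \<phi> h / (\<psi> h - 1) * (\<psi> g - 1)" if g: "g \<in> G" for g
  proof -
    define x where "x = h \<circ> g"
    define y where "y = g \<circ> h"
    define u where "u = finv x \<circ> y"
    have G: "x \<in> G" "y \<in> G" "u \<in> G" unfolding x_def y_def u_def using g ne(1) by (auto intro!: G_comp G_inv)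
    have xu: "x \<circ> u = y" using G(1) by (auto simp: u_def fun_eq_iff)
    have "ent\<^sub>1\<^sub>1 x = ent\<^sub>1\<^sub>1 y" "ent\<^sub>2\<^sub>2 x = ent\<^sub>2\<^sub>2 y"
      using c[OF g] c[OF ne(1)] by (simp_all add: x_def y_def ent_comp G_lin g ne(1))
    moreover have "ent\<^sub>1\<^sub>1 x * ent\<^sub>1\<^sub>1 u = ent\<^sub>1\<^sub>1 y" "ent\<^sub>2\<^sub>2 x * ent\<^sub>2\<^sub>2 u = ent\<^sub>2\<^sub>2 y"
      using ent_comp[OF G_lin[OF G(1)], of u] c[OF G(1)] c[OF G(3)] xu by simp_all
    ultimately have "ent\<^sub>1\<^sub>1 u = 1" "ent\<^sub>2\<^sub>2 u = 1" using tri_nonzero[OF t G(2)] by simp_all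
    then have "\<phi> u = 0" using U G(3) by blast
    then have "\<phi> y = \<phi> x" using \<phi>[OF G(1,3)] xu by simp
    then have "\<phi> g * (\<psi> h - 1) = \<phi> h * (\<psi> g - 1)"
      using \<phi>[OF g ne(1)] \<phi>[OF ne(1) g] by (simp add: x_def y_def algebra_simps)
    then show ?thesis using ne(2) by (simp add: field_simps)
  qed
  then show ?thesis by blast
qed

text \<open>The coordinate \<open>Y\<close> is treated with the character
  \<open>\<chi>\<^sub>2\<close>, then \<open>X\<close> with \<open>\<chi>\<^sub>1\<close>. Vanishing
  on unipotent elements uses that \<open>\<chi>\<^sub>2\<close> and \<open>\<chi>\<^sub>1\<close>
  differ from \<open>\<chi>\<^sub>1 / \<chi>\<^sub>2\<close>, and becoming a coboundary uses that
  they are nontrivial.\<close>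

lemma trivial_H1_tri:
  assumes t: "triangular"
    and ne: "\<exists>g\<in>G. ent\<^sub>1\<^sub>1 g \<noteq> 1" "\<exists>g\<in>G. ent\<^sub>1\<^sub>1 g \<noteq> (ent\<^sub>2\<^sub>2 g)\<^sup>2" "\<exists>g\<in>G. ent\<^sub>2\<^sub>2 g \<noteq> 1"
  shows "trivial_group (H1 \<Gamma> V)"
proof (rule trivial_H1I_cocycle)
  fix f assume "cocycle f"
  then have f: "f (g \<circ> h) = f g + g (f h)" if "g \<in> G" "h \<in> G" for g h
    using that by (simp add: cocycle_def)
  have c: "ent\<^sub>2\<^sub>1 g = 0" if "g \<in> G" for g using t that by (simp add: triangular_def)
  note nz = tri_nonzero[OF t]
  have f2: "Y (f (g \<circ> h)) = Y (f g) + ent\<^sub>2\<^sub>2 g * Y (f h)" if "g \<in> G" "h \<in> G" for g h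
    using that by (simp add: f coord_lin[OF G_lin] c)
  obtain g0 where g0: "g0 \<in> G" "ent\<^sub>1\<^sub>1 g0 \<noteq> (ent\<^sub>2\<^sub>2 g0)\<^sup>2" using ne(2) by blast
  then have g0': "ent\<^sub>2\<^sub>2 g0 \<noteq> ent\<^sub>1\<^sub>1 g0 / ent\<^sub>2\<^sub>2 g0"
    using nz[OF g0(1)] by (auto simp: field_simps power2_eq_square)
  obtain g1 where g1: "g1 \<in> G" "ent\<^sub>2\<^sub>2 g1 \<noteq> 1" using ne(3) by blast
  then have g1': "ent\<^sub>1\<^sub>1 g1 \<noteq> ent\<^sub>1\<^sub>1 g1 / ent\<^sub>2\<^sub>2 g1"
    using nz[OF g1(1)] by (auto simp: field_simps)
  obtain g2 where g2: "g2 \<in> G" "ent\<^sub>1\<^sub>1 g2 \<noteq> 1" using ne(1) by blast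
  have "Y (f u) = 0" if "u \<in> G" "ent\<^sub>1\<^sub>1 u = 1" "ent\<^sub>2\<^sub>2 u = 1" for u
    by (rule char_cocycle_zero[OF t, of "\<lambda>g. Y (f g)" ent\<^sub>2\<^sub>2 g0]) (use f2 g0(1) g0' that in auto)
  then obtain k where k: "\<And>g. g \<in> G \<Longrightarrow> Y (f g) = k * (ent\<^sub>2\<^sub>2 g - 1)"
    using char_cocycle_coboundary[OF t, of "\<lambda>g. Y (f g)" ent\<^sub>2\<^sub>2 g1] f2 g1 by blast
  \<comment> \<open>Removing the coboundary of \<open>k *s e\<^sub>2\<close> kills the second
    coordinate; only then is the first one a cocycle with values in a character.\<close>
  define f' where "f' = (\<lambda>g. f g - (g (k *s e\<^sub>2) - k *s e\<^sub>2))"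
  have Y0: "Y (f' g) = 0" if "g \<in> G" for g
    using that k by (simp add: f'_def coord_lin[OF G_lin] algebra_simps)
  have "f' (g \<circ> h) = f' g + g (f' h)" if "g \<in> G" "h \<in> G" for g h
    using that by (simp add: f'_def f linD[OF G_lin])
  then have f1: "X (f' (g \<circ> h)) = X (f' g) + ent\<^sub>1\<^sub>1 g * X (f' h)" if "g \<in> G" "h \<in> G" for g h
    using that by (simp add: coord_lin[OF G_lin] Y0)
  have "X (f' u) = 0" if "u \<in> G" "ent\<^sub>1\<^sub>1 u = 1" "ent\<^sub>2\<^sub>2 u = 1" for u
    by (rule char_cocycle_zero[OF t, of "\<lambda>g. X (f' g)" ent\<^sub>1\<^sub>1 g1]) (use f1 g1(1) g1' that in auto)
  then obtain k' where k': "\<And>g. g \<in> G \<Longrightarrow> X (f' g) = k' * (ent\<^sub>1\<^sub>1 g - 1)"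
    using char_cocycle_coboundary[OF t, of "\<lambda>g. X (f' g)" ent\<^sub>1\<^sub>1 g2] f1 g2 by blast
  have "f g = g (k' *s e\<^sub>1 + k *s e\<^sub>2) - (k' *s e\<^sub>1 + k *s e\<^sub>2)" if g: "g \<in> G" for g
  proof -
    have "f' g = g (k' *s e\<^sub>1) - k' *s e\<^sub>1"
      using g by (simp add: vec_eq_iff k' Y0 coord_lin[OF G_lin] c algebra_simps)
    moreover have "f g = f' g + (g (k *s e\<^sub>2) - k *s e\<^sub>2)" by (simp add: f'_def)
    ultimately show ?thesis using g by (simp add: linD[OF G_lin])
  qed
  then show "\<exists>v. \<forall>g\<in>G. f g = g v - v" by blast
qed

lemma minus_mem_of_transvections:
  assumes u: "u \<in> G" "ent\<^sub>1\<^sub>1 u = 1" "ent\<^sub>2\<^sub>1 u = 0" "ent\<^sub>2\<^sub>2 u = 1" "ent\<^sub>1\<^sub>2 u \<noteq> 0"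
    and u': "u' \<in> G" "ent\<^sub>1\<^sub>1 u' = 1" "ent\<^sub>1\<^sub>2 u' = 0" "ent\<^sub>2\<^sub>2 u' = 1" "ent\<^sub>2\<^sub>1 u' \<noteq> 0"
    and odd: "odd CARD('p)"
  shows "uminus \<in> G"
proof -
  \<comment> \<open>With b and c the off-diagonal entries of \<open>u\<close> and \<open>u'\<close>,
    the product \<open>(u ^^ m) \<circ> u'\<close> has determinant 1 and trace 2 + m b c; the
    constant -4 makes the trace -2.\<close>
  obtain m where m: "- 4 / (ent\<^sub>1\<^sub>2 u * ent\<^sub>2\<^sub>1 u') = of_nat m" using surj_of_nat_mod_ring by blast
  have pow: "ent\<^sub>1\<^sub>1 (u ^^ k) = 1 \<and> ent\<^sub>2\<^sub>2 (u ^^ k) = 1 \<and> ent\<^sub>2\<^sub>1 (u ^^ k) = 0 \<and>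
      ent\<^sub>1\<^sub>2 (u ^^ k) = of_nat k * ent\<^sub>1\<^sub>2 u" for k
  proof (induction k)
    case (Suc k)
    have e: "u ^^ Suc k = u \<circ> u ^^ k" by (rule funpow.simps(2))
    show ?case
      using Suc u ent_comp[OF G_lin[OF u(1)], of "u ^^ k", folded e]
      by (simp add: algebra_simps del: funpow.simps)
  next
    case 0
    have e: "u ^^ 0 = id" by (rule funpow.simps(1))
    show ?case by (simp only: e ent_id of_nat_0 mult_zero_left simp_thms)
  qed
  define x where "x = (u ^^ m) \<circ> u'"
  have xG: "x \<in> G" unfolding x_def by (intro G_comp G_funpow u(1) u'(1))
  have mm: "of_nat m * ent\<^sub>1\<^sub>2 u * ent\<^sub>2\<^sub>1 u' = - 4"
    using u(5) u'(5) by (simp flip: m)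
  have "ent\<^sub>1\<^sub>1 x = - 3" "ent\<^sub>2\<^sub>2 x = 1" "ent\<^sub>1\<^sub>2 x = of_nat m * ent\<^sub>1\<^sub>2 u" "ent\<^sub>2\<^sub>1 x = ent\<^sub>2\<^sub>1 u'"
    using pow[of m] u' mm by (simp_all add: x_def ent_comp[OF G_lin[OF G_funpow[OF u(1)]]])
  then have "tr x = - 2" "det x = 1" using mm by (simp_all add: tr_def det_def)
  then have xx: "x (x v) = (- 2) *s x v - v" for v using cayley_hamilton[OF G_lin[OF xG]] by simp
  \<comment> \<open>With N = -x - 1, whose square is 0, this is the expansion of
    \<open>(-1)^k (1 + N)^k\<close> as \<open>(-1)^k (1 + k N)\<close>; at k = p only the sign
    remains.\<close>
  have xpow: "(x ^^ k) v = (- 1) ^ k *s (v + of_nat k *s (- x v - v))" for k v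
  proof (induction k)
    case (Suc k)
    have "(x ^^ Suc k) v = x ((x ^^ k) v)" by simp
    also have "\<dots> = (- 1) ^ k *s (x v + of_nat k *s (- x (x v) - x v))"
      unfolding Suc by (simp only: linD[OF G_lin[OF xG]])
    also have "\<dots> = (- 1) ^ Suc k *s (v + of_nat (Suc k) *s (- x v - v))"
      unfolding xx by (simp add: vec_eq_iff algebra_simps)
    finally show ?case .
  qed simp
  have "(x ^^ CARD('p)) v = - v" for v
    unfolding xpow of_nat_card_eq_0 using odd by simp
  then have "x ^^ CARD('p) = uminus" by blast
  then show ?thesis using G_funpow[OF xG, of "CARD('p)"] by simp
qed

text \<open>An element of order \<open>p\<close> is unipotent because \<open>(x - 1)\<^sup>p = x\<^sup>p - 1\<close> in characteristic \<open>p\<close>; the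
  identity is transported from the polynomial ring by Horner evaluation.\<close>

lemma order_p_unipotent:
  assumes x: "x \<in> G" "x \<noteq> id" "x ^^ CARD('p) = id"
  shows "x (x v) = 2 *s x v - v"
proof -
  note xl = G_lin[OF x(1)]
  define N where "N = (\<lambda>v. x v - v)"
  define ev :: "'p mod_ring poly \<Rightarrow> 'v \<Rightarrow> 'v" where
    "ev = (\<lambda>q v. fold_coeffs (\<lambda>c w. c *s v + x w) q 0)"
  have ev0: "ev 0 v = 0" for v by (simp add: ev_def)
  have evC: "ev (pCons c q) v = c *s v + x (ev q v)" for c q v
    by (cases "c = 0 \<and> q = 0") (auto simp: ev_def linD[OF xl])
  have ev_add: "ev (q + r) v = ev q v + ev r v" for q r v
    by (induction q r rule: poly_induct2) (simp_all add: ev0 evC linD[OF xl] scale_left_distrib add_ac)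
  have ev_smult: "ev (Polynomial.smult c q) v = c *s ev q v" for c q v
    by (induction q) (simp_all add: ev0 evC linD[OF xl] scale_right_distrib)
  have ev_mult: "ev ([:- 1, 1:] * q) v = N (ev q v)" for q v
  proof -
    have "[:- 1, 1:] * q = Polynomial.smult (- 1) q + pCons 0 q"
      by (simp only: mult_pCons_left mult_zero_left pCons_0_0 add_0_right smult_1_left)
    then show ?thesis by (simp only: ev_add ev_smult evC) (simp add: N_def)
  qed
  have ev_N: "ev ([:- 1, 1:] ^ n) v = (N ^^ n) v" for n v
  proof (induction n)
    case 0
    have "ev [:1:] v = v" by (simp only: evC ev0 linD[OF xl] scale_one add_0_right)
    then show ?case by (simp only: power_0 funpow_0 one_pCons)
  next
    case (Suc n)
    then show ?case by (simp only: power_Suc ev_mult funpow.simps comp_apply)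
  qed
  have ev_x: "ev (monom 1 n) v = (x ^^ n) v" for n v
    by (induction n) (simp_all add: monom_0 monom_Suc evC ev0 linD[OF xl])
  have X_pow: "[:0, 1::'p mod_ring:] ^ n = monom 1 n" for n
    by (induction n) (simp_all add: monom_0 monom_Suc one_pCons)
  have "CHAR('p mod_ring poly) = CARD('p)" by simp
  then have "([:0, 1:] + [:- 1:]) ^ CARD('p) = [:0, 1:] ^ CARD('p) + [:- 1 :: 'p mod_ring:] ^ CARD('p)"
    using freshmans_dream[where 'a="'p mod_ring poly"] prime_card[where 'a='p] by metis
  then have eq: "[:- 1, 1:] ^ CARD('p) = monom 1 CARD('p) + [:(- 1) ^ CARD('p) :: 'p mod_ring:]"
    by (simp add: X_pow poly_const_pow)
  have "(N ^^ CARD('p)) v = v + (- 1) ^ CARD('p) *s v" for v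
    unfolding ev_N[symmetric] eq ev_add ev_x x(3) by (simp add: evC ev0 linD[OF xl])
  \<comment> \<open>Derived from additivity of the p-th power rather than from parity, so that p = 2
    is included.\<close>
  moreover have "(- 1) ^ CARD('p) = (- 1 :: 'p mod_ring)"
  proof -
    have "(- 1 + 1) ^ CARD('p) = (- 1) ^ CARD('p) + (1 :: 'p mod_ring) ^ CARD('p)"
      using freshmans_dream[where 'a="'p mod_ring"] prime_card[where 'a='p] semiring_char_mod_ring[where 'n='p]
      by metis
    then have "(- 1) ^ CARD('p) + (1 :: 'p mod_ring) = 0" by (simp add: power_0_left)
    then show ?thesis by (simp only: eq_neg_iff_add_eq_0)
  qed
  ultimately have Np: "(N ^^ CARD('p)) v = 0" for v by simp
  \<comment> \<open>A nilpotent map has a kernel, since otherwise its iterates on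
    \<open>e\<^sub>1\<close> never vanish; so 1 is an eigenvalue of \<open>x\<close>.\<close>
  have "\<exists>v. v \<noteq> 0 \<and> N v = 0"
  proof (rule ccontr)
    assume *: "\<not> ?thesis"
    have "(N ^^ n) e\<^sub>1 \<noteq> 0" for n
      by (induction n) (use * in \<open>auto simp: vec_eq_iff\<close>)
    then show False using Np by blast
  qed
  then obtain w where w: "w \<noteq> 0" "x w = w" by (auto simp: N_def)
  have "tr x *s w = (1 + det x) *s w"
    using cayley_hamilton[OF xl, of w] w by (simp add: scale_left_distrib algebra_simps)
  then have t: "tr x = 1 + det x" using w by simp
  \<comment> \<open>As 1 is an eigenvalue, \<open>det x - 1\<close> is the only other possible
    eigenvalue of \<open>N\<close>. Nilpotency of the nonzero map \<open>N\<close> makes it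
    0.\<close>
  have NN: "N (N v) = (det x - 1) *s N v" for v
    unfolding N_def linD[OF xl] cayley_hamilton[OF xl] t by (simp add: vec_eq_iff algebra_simps)
  have Nlin: "N (c *s v) = c *s N v" for c v by (simp add: N_def linD[OF xl] scale_right_diff_distrib)
  have Npow: "(N ^^ Suc n) v = (det x - 1) ^ n *s N v" for n v
    by (induction n) (simp_all add: NN Nlin mult.commute)
  obtain y where y: "N y \<noteq> 0" using x(2) by (auto simp: N_def fun_eq_iff)
  obtain n where n: "CARD('p) = Suc n" using zero_less_card_finite[where 'a='p] gr0_implies_Suc by blast
  have "det x = 1"
    using Npow[of n y] Np[of y] y unfolding n by auto
  then show ?thesis using cayley_hamilton[OF xl, of v] t by simp
qed

text \<open>Cauchy's theorem for p, from Sylow's theorem with exponent 1: every element x of a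
  subgroup of order p satisfies x^p = 1.\<close>

lemma ex_order_p:
  assumes "of_nat (card G) = (0 :: 'p mod_ring)"
  shows "\<exists>x\<in>G. x \<noteq> id \<and> x ^^ CARD('p) = id"
proof -
  have "CARD('p) dvd card G" using of_nat_0_mod_ring_dvd[OF assms] .
  then obtain m where m: "card G = CARD('p) ^ 1 * m" by auto
  have gG: "group \<Gamma>" by (rule group.subgroup_imp_group[OF group_GL subG])
  obtain H where H: "subgroup H \<Gamma>" "card H = CARD('p)"
    using sylow_thm[OF prime_card[where 'a='p] gG, of 1 m] m finite_G by (auto simp: Coset.order_def)
  have HG: "H \<subseteq> G" using subgroup.subset[OF H(1)] by simp
  have "card H > 1" using H(2) prime_card[where 'a='p] prime_gt_1_nat by metis
  then have "\<not> H \<subseteq> {id}" using card_mono[of "{id}" H] by fastforce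
  then obtain x where x: "x \<in> H" "x \<noteq> id" by blast
  interpret H: group "\<Gamma>\<lparr>carrier := H\<rparr>" by (rule group.subgroup_imp_group[OF gG H(1)])
  have "x [^]\<^bsub>\<Gamma>\<lparr>carrier := H\<rparr>\<^esub> Coset.order (\<Gamma>\<lparr>carrier := H\<rparr>) = id"
    using H.pow_order_eq_1[of x] x(1) by simp
  moreover have "x [^]\<^bsub>\<Gamma>\<lparr>carrier := H\<rparr>\<^esub> n = x ^^ n" for n :: nat
    by (induction n) (simp_all add: H.nat_pow_Suc funpow_swap1 funpow_Suc_right id_def del: funpow.simps(2))
  ultimately show ?thesis using x HG H(2) by (auto simp: Coset.order_def)
qed

end

context plane_group
begin

section \<open>Irreducible planes\<close>

lemma irreducible_submod:
  assumes "irreducible_gmodule \<Gamma> V" "submod \<Gamma> N V"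
  shows "N = {0} \<or> N = UNIV"
  using assms by (auto simp: irreducible_gmodule_def)

lemma irreducible_no_line:
  assumes irr: "irreducible_gmodule \<Gamma> V" and v: "v \<noteq> 0" and l: "\<And>g. g \<in> G \<Longrightarrow> \<exists>c. g v = c *s v"
  shows False
proof -
  let ?N = "range (\<lambda>c. c *s v)"
  have "submod \<Gamma> ?N V"
  proof (rule V.submodI)
    have "0 = 0 *s v" by simp
    then show "\<one>\<^bsub>V\<^esub> \<in> ?N" by (metis V_simps(3) rangeI)
    show "x \<otimes>\<^bsub>V\<^esub> y \<in> ?N" if "x \<in> ?N" "y \<in> ?N" for x y
      using that by (auto simp flip: scale_left_distrib)
    show "scal V c x \<in> ?N" if "x \<in> ?N" for c x using that by auto
    show "act V g x \<in> ?N" if g: "g \<in> carrier \<Gamma>" and x: "x \<in> ?N" for g x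
    proof -
      obtain c d where "x = c *s v" "g v = d *s v" using g x l[of g] by auto
      then show ?thesis using g by (auto simp: linD[OF G_lin])
    qed
  qed auto
  then have "?N = {0} \<or> ?N = UNIV" by (rule irreducible_submod[OF irr])
  moreover have "1 *s v \<in> ?N" by (rule rangeI)
  ultimately have "?N = UNIV" using v by auto
  then obtain a b where a: "e\<^sub>1 = a *s v" and b: "e\<^sub>2 = b *s v" by (metis UNIV_I rangeE)
  have "a * X v = 1" "a * Y v = 0" "b * Y v = 1"
    using arg_cong[OF a, of X] arg_cong[OF a, of Y] arg_cong[OF b, of Y] by simp_all
  then show False by auto
qed

text \<open>With a, b the eigenvalues of \<open>g\<close>, the polynomial is (t - 1)(t - a/b)(t -
  b/a) = t^3 - q t^2 + q t - 1, where q = 1 + a/b + b/a = (tr^2 - det)/det.\<close>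

lemma cubic_annihilates_E:
  assumes g: "g \<in> G" and f: "lin f" and q: "q * det g = tr g * tr g - det g"
  shows "peval E g [- 1, q, - q, 1] f = (\<lambda>v. 0)"
proof
  fix v
  note gl = linD[OF G_lin[OF g]] and fl = linD[OF f]
  \<comment> \<open>Writing the vector as the third iterate of \<open>g\<close> on \<open>w\<close>
    absorbs all inverses in the conjugations, so that Cayley-Hamilton applies.\<close>
  define w where "w = finv g (finv g (finv g v))"
  have v: "v = g (g (g w))" using g by (simp add: w_def)
  have "peval E g [- 1, q, - q, 1] f v =
      - f (g (g (g w))) + g (q *s f (g (g w)) + g ((- q) *s f (g w) + g (f w)))"
    unfolding v using g by (simp add: gl)
  also have "\<dots> = (tr g * tr g - det g - q * det g) *s (g (f w) - f (g w))"
    unfolding gl fl cayley_hamilton[OF G_lin[OF g]] by (simp add: vec_eq_iff algebra_simps)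
  also have "\<dots> = 0" by (simp add: q)
  finally show "peval E g [- 1, q, - q, 1] f v = 0" .
qed

text \<open>A polynomial in \<open>g\<close> annihilating \<open>End(V)\<close> annihilates a common factor, hence the irreducible
  \<open>V\<close>. With eigenvalues \<open>a, b\<close> of \<open>g\<close>, those on \<open>End(V)\<close> are \<open>1, 1, a/b, b/a\<close>.\<close>

lemma common_tr_det:
  assumes irr: "irreducible_gmodule \<Gamma> V" and common: "common_composition_factor \<Gamma> V E" and g: "g \<in> G"
  shows "tr g = 1 + det g \<or> tr g = - 1 \<and> det g = 1"
proof -
  note gl = linD[OF G_lin[OF g]]
  obtain A1 A2 B1 B2 where A: "V.simple_section A1 A2" and B: "E.simple_section B1 B2"
    and eq: "\<And>g cs. g \<in> G \<Longrightarrow> (\<forall>x\<in>A2. peval V g cs x \<in> A1) \<longleftrightarrow> (\<forall>x\<in>B2. peval E g cs x \<in> B1)"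
    using common_composition_factor_peval[OF V.gmod_axioms finite_V E.gmod_axioms finite_E common] by auto
  have As: "submod \<Gamma> A1 V" "submod \<Gamma> A2 V" "A1 \<subset> A2" using A by (auto simp: V.simple_section_def)
  have Bs: "submod \<Gamma> B1 E" "submod \<Gamma> B2 E" using B by (auto simp: E.simple_section_def)
  have "A1 = {0}" "A2 = UNIV"
    using irreducible_submod[OF irr As(1)] irreducible_submod[OF irr As(2)] As(3) by auto
  then have ann: "peval V g cs v = 0" if "\<And>f. lin f \<Longrightarrow> peval E g cs f = (\<lambda>v. 0)" for cs v
  proof -
    have "peval E g cs f \<in> B1" if "f \<in> B2" for f
      using E.submodD(8)[OF Bs(2) that] E.submodD(2)[OF Bs(1)] \<open>\<And>f. lin f \<Longrightarrow> peval E g cs f = (\<lambda>v. 0)\<close>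
      by simp
    then have "\<forall>x\<in>A2. peval V g cs x \<in> A1" using eq[OF g] by blast
    then show ?thesis using \<open>A1 = {0}\<close> \<open>A2 = UNIV\<close> by blast
  qed
  show ?thesis
  proof (cases "\<exists>c. \<forall>v. g v = c *s v")
    case True
    then obtain c where c: "\<And>v. g v = c *s v" by blast
    \<comment> \<open>A scalar acts trivially on End(V), so t - 1 already annihilates it, and
      \<open>g\<close> must be the identity.\<close>
    have "peval E g [- 1, 1] f = (\<lambda>v. 0)" if "lin f" for f
    proof
      fix v
      have "peval E g [- 1, 1] f (g (finv g v)) = - f (g (finv g v)) + g (f (finv g v))"
        using g by (simp add: gl del: G_inv_simps(2))
      also have "\<dots> = 0" by (simp add: c linD[OF that])
      finally show "peval E g [- 1, 1] f v = 0" using g by simp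
    qed
    then have "peval V g [- 1, 1] v = 0" for v by (rule ann)
    then have "g = id" by (auto simp: fun_eq_iff gl)
    then show ?thesis by simp
  next
    case False
    have d0: "det g \<noteq> 0" by (rule det_nonzero[OF G_lin[OF g] G_bij[OF g]])
    define q where "q = (tr g * tr g - det g) / det g"
    have q: "q * det g = tr g * tr g - det g" using d0 by (simp add: q_def)
    \<comment> \<open>Modulo the characteristic polynomial of \<open>g\<close> the cubic becomes
      \<open>k1\<close> times g plus \<open>k2\<close>; as \<open>g\<close> is not scalar, both
      coefficients must vanish.\<close>
    define k1 where "k1 = tr g * tr g - det g - q * tr g + q"
    define k2 where "k2 = q * det g - tr g * det g - 1"
    have k: "k1 *s g v + k2 *s v = 0" for v
    proof -
      have "- v + g (q *s v + g ((- q) *s v + g v)) = 0"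
        using ann[of "[- 1, q, - q, 1]" v, OF cubic_annihilates_E[OF g _ q]] by (simp add: gl)
      then show ?thesis
        unfolding gl cayley_hamilton[OF G_lin[OF g]] by (simp add: vec_eq_iff k1_def k2_def algebra_simps)
    qed
    have k1: "k1 = 0"
    proof (rule ccontr)
      assume "k1 \<noteq> 0"
      have "g v = (- k2 / k1) *s v" for v
      proof -
        have "k1 * X (g v) + k2 * X v = 0" "k1 * Y (g v) + k2 * Y v = 0"
          using arg_cong[OF k[of v], of X] arg_cong[OF k[of v], of Y] by simp_all
        then show ?thesis using \<open>k1 \<noteq> 0\<close>
          by (simp add: vec_eq_iff field_simps eq_neg_iff_add_eq_0)
      qed
      then show False using False by blast
    qed
    then have k2: "k2 = 0" using arg_cong[OF k[of e\<^sub>1], of X] by simp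
    have "(tr g + 1) * (tr g - (1 + det g)) = 0"
      using k2 unfolding k2_def q by (simp add: algebra_simps)
    then consider "tr g = - 1" | "tr g = 1 + det g"
      by (metis eq_neg_iff_add_eq_0 eq_iff_diff_eq_0 mult_eq_0_iff)
    then show ?thesis
    proof cases
      case 1
      have "k1 * det g = (1 - det g) * det g + 2 * (q * det g)"
        unfolding k1_def 1 by (simp add: algebra_simps)
      then have "(1 - det g) * (det g + 2) = 0"
        using k1 unfolding q 1 by (simp add: algebra_simps)
      \<comment> \<open>The value -2 is no exception: with trace -1 it satisfies
        \<open>tr g = 1 + det g\<close>.\<close>
      then have "det g = 1 \<or> det g = - 2" by (auto simp: eq_neg_iff_add_eq_0)
      then show ?thesis using 1 by auto
    qed simp
  qed
qed

text \<open>If only the identity has determinant 1, then \<open>G\<close> is abelian and fixed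
  vectors contradict irreducibility. Otherwise there is \<open>c\<close> with
  \<open>c\<^sup>2 + c + 1 = 0\<close>, and the triangle consists of \<open>v\<close>,
  \<open>c v\<close>, \<open>c (c v)\<close>, where \<open>v\<close> is fixed by an element
  inverting \<open>c\<close>, or is any nonzero vector if \<open>c\<close> is central in
  \<open>G\<close>.\<close>

lemma irreducible_triangle:
  assumes irr: "irreducible_gmodule \<Gamma> V"
    and td: "\<And>g. g \<in> G \<Longrightarrow> tr g = 1 + det g \<or> tr g = - 1 \<and> det g = 1"
    and nu: "\<And>g. g \<in> G \<Longrightarrow> tr g = 2 \<Longrightarrow> det g = 1 \<Longrightarrow> g = id"
  shows "\<exists>S. subgroup S (GL scale) \<and> restr_GL scale S \<cong> sym_group 3 \<and> G \<subseteq> S"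
proof (cases "\<forall>g\<in>G. det g = 1 \<longrightarrow> g = id")
  case True
  \<comment> \<open>Commutators have determinant 1, so they are trivial in this case.\<close>
  have comm: "g (h v) = h (g v)" if g: "g \<in> G" and h: "h \<in> G" for g h v
  proof -
    define u where "u = finv (h \<circ> g) \<circ> (g \<circ> h)"
    have uG: "u \<in> G" unfolding u_def using g h by (auto intro!: G_comp G_inv)
    have hu: "(h \<circ> g) \<circ> u = g \<circ> h"
      using G_inv_simps(2)[OF G_comp[OF h g]] by (auto simp: u_def fun_eq_iff)
    have "det (h \<circ> g) * det u = det (g \<circ> h)"
      using det_comp[OF G_lin[OF G_comp[OF h g]], of u] hu by simp
    moreover have "det (g \<circ> h) = det (h \<circ> g)" using g h by (simp add: det_comp G_lin)
    moreover have "det (h \<circ> g) \<noteq> 0" by (rule det_nonzero[OF G_lin G_bij]; rule G_comp[OF h g])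
    ultimately have "det u = 1" by simp
    then have "u = id" using True uG by blast
    then show ?thesis using fun_cong[OF hu, of v] by simp
  qed
  have "g = id" if g: "g \<in> G" for g
  proof (rule ccontr)
    assume ne: "g \<noteq> id"
    then have "tr g = 1 + det g" using td[OF g] True g by auto
    then obtain v where v: "v \<noteq> 0" "g v = v" using ex_fixed_vector[OF G_lin[OF g]] by blast
    \<comment> \<open>Commutativity makes the fixed space of \<open>g\<close> stable under the
      group.\<close>
    have "submod \<Gamma> {v. g v = v} V"
      by (rule V.submodI) (auto simp: linD[OF G_lin[OF g]] comm[OF g])
    then have "{v. g v = v} = {0} \<or> {v. g v = v} = UNIV" by (rule irreducible_submod[OF irr])
    then show False using v ne by (auto simp: fun_eq_iff)
  qed
  then have "g e\<^sub>1 = 1 *s e\<^sub>1" if "g \<in> G" for g using that by fastforce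
  moreover have "e\<^sub>1 \<noteq> 0" by (auto simp: vec_eq_iff)
  ultimately show ?thesis using irreducible_no_line[OF irr] by blast
next
  case False
  then obtain c where c: "c \<in> G" "det c = 1" "c \<noteq> id" by blast
  note cl = linD[OF G_lin[OF c(1)]]
  have order3: "tr h = - 1 \<and> (\<forall>v. h (h v) = - h v - v)" if h: "h \<in> G" "det h = 1" "h \<noteq> id" for h
  proof -
    have "tr h = - 1" using td[OF h(1)] nu[OF h(1)] h by auto
    then show ?thesis using cayley_hamilton[OF G_lin[OF h(1)]] h(2) by simp
  qed
  have tc: "tr c = - 1" and cc: "\<And>v. c (c v) = - c v - v" using order3[OF c] by blast+
  have ccc: "c (c (c v)) = v" for v by (simp add: cc cl)
  \<comment> \<open>In characteristic 3 the trace -1 equals 2, so \<open>c\<close> would be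
    unipotent, against \<open>nu\<close>.\<close>
  have three: "(3::'k) \<noteq> 0"
  proof
    assume "(3::'k) = 0"
    then have "(- 1 :: 'k) = 2" by (simp add: eq_neg_iff_add_eq_0 neg_eq_iff_add_eq_0)
    then show False using nu[OF c(1)] tc c by simp
  qed
  \<comment> \<open>Here the inverse of \<open>h\<close> is -h - 1, so the trace of
    \<open>c \<circ> finv h\<close> is minus the sum of the traces of \<open>c \<circ> h\<close> and
    \<open>c\<close>. Unless \<open>c \<circ> h\<close> is the identity, both are -1; the trace is
    then 2, and \<open>nu\<close> gives \<open>c = h\<close>.\<close>
  have SL: "h = id \<or> h = c \<or> h = c \<circ> c" if h: "h \<in> G" "det h = 1" for h
  proof (cases "h = id")
    case False
    note hl = linD[OF G_lin[OF h(1)]]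
    have th: "tr h = - 1" and hh: "\<And>v. h (h v) = - h v - v" using order3[OF h False] by blast+
    have hi: "finv h v = - h v - v" for v
    proof -
      have "h (- h v - v) = v" by (simp add: hl hh)
      then show ?thesis using G_inv_simps(1)[OF h(1), of "- h v - v"] by simp
    qed
    have chG: "c \<circ> h \<in> G" "c \<circ> finv h \<in> G" using c h by (auto intro!: G_comp G_inv)
    have d1: "det (c \<circ> h) = 1" using c h by (simp add: det_comp G_lin)
    have d2: "det (c \<circ> finv h) = 1"
      using det_inv[OF G_lin[OF h(1)] G_bij[OF h(1)]] c h by (simp add: det_comp G_lin)
    show ?thesis
    proof (cases "c \<circ> h = id")
      case True
      have "h v = c (c v)" for v
        using fun_cong[OF True, of v] ccc[of "h v"] by simp
      then show ?thesis by (auto simp: fun_eq_iff)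
    next
      case False
      then have "tr (c \<circ> h) = - 1" using order3[OF chG(1) d1] by blast
      moreover have "tr (c \<circ> finv h) = - tr (c \<circ> h) - tr c"
        by (simp add: tr_def ent_defs hi cl)
      ultimately have eq: "c \<circ> finv h = id" using nu[OF chG(2) _ d2] tc by simp
      have "c v = h v" for v using fun_cong[OF eq, of "h v"] h(1) by simp
      then show ?thesis by (auto simp: fun_eq_iff)
    qed
  qed simp
  \<comment> \<open>The conjugate of \<open>c\<close> has determinant 1, so it is \<open>c\<close>
    or its square, being nontrivial.\<close>
  have conj: "(\<forall>v. g (c v) = c (g v)) \<or> (\<forall>v. g (c v) = c (c (g v)))" if g: "g \<in> G" for g
  proof -
    define h where "h = g \<circ> c \<circ> finv g"
    have hG: "h \<in> G" unfolding h_def using g c by (auto intro!: G_comp G_inv)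
    have hg: "h (g v) = g (c v)" for v using g by (simp add: h_def)
    have "h \<circ> g = g \<circ> c" using hg by auto
    then have "det h * det g = det g * det c"
      using det_comp[OF G_lin[OF hG], of g] det_comp[OF G_lin[OF g], of c] by metis
    then have "det h = 1" using c(2) det_nonzero[OF G_lin[OF g] G_bij[OF g]] by simp
    then consider "h = id" | "h = c" | "h = c \<circ> c" using SL[OF hG] by blast
    then show ?thesis
    proof cases
      case 1
      have "finv g (g (c v)) = finv g (g v)" for v using hg[of v] 1 by simp
      then have "c v = v" for v unfolding G_inv_simps(1)[OF g] .
      then show ?thesis using c(3) by (auto simp: fun_eq_iff)
    qed (use hg in auto)
  qed
  \<comment> \<open>Since 1 + c + c^2 = 0, the traces of g, g c and g c^2 add up to 0. Outside
    determinant 1 each of them is 1 + det g, and 3 is invertible, so det g = -1 and the traces are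
    0. Then g and g c are involutions that commute, so c^2 = 1, against c^3 = 1.\<close>
  have cent: "g = id \<or> g = c \<or> g = c \<circ> c" if g: "g \<in> G" and gc: "\<And>v. g (c v) = c (g v)" for g
  proof (rule ccontr)
    assume "\<not> ?thesis"
    then have dg: "det g \<noteq> 1" using SL[OF g] by blast
    note gl = linD[OF G_lin[OF g]]
    have d: "det (g \<circ> c) = det g" "det (g \<circ> c \<circ> c) = det g"
      using g c by (simp_all add: det_comp G_lin G_comp)
    have t: "tr g = 1 + det g" "tr (g \<circ> c) = 1 + det g" "tr (g \<circ> c \<circ> c) = 1 + det g"
      using td[OF g] td[OF G_comp[OF g c(1)]] td[OF G_comp[OF G_comp[OF g c(1)] c(1)]] dg d by auto
    have "tr (g \<circ> c \<circ> c) = - tr (g \<circ> c) - tr g"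
      by (simp add: tr_def ent_defs cc gl)
    then have "3 * (1 + det g) = 0" unfolding t by (simp add: algebra_simps eq_neg_iff_add_eq_0)
    then have "1 + det g = 0" using three by (metis mult_eq_0_iff)
    then have dm: "det g = - 1" "tr g = 0" "tr (g \<circ> c) = 0" using t by (simp_all add: eq_neg_iff_add_eq_0 add.commute)
    have gg: "g (g v) = v" for v using cayley_hamilton[OF G_lin[OF g]] dm by simp
    have "g (c (g (c v))) = v" for v
      using cayley_hamilton[OF G_lin[OF G_comp[OF g c(1)]], of v] dm d by simp
    then have "c (c v) = v" for v by (simp add: gc gg)
    then have "c v = v" for v using ccc[of v] by simp
    then show False using c(3) by (auto simp: fun_eq_iff)
  qed
  \<comment> \<open>\<open>\<tau>\<close> represents the elements that invert \<open>c\<close>. Its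
    determinant is then not 1, so it has eigenvalue 1 and fixes a vector; if no element inverts
    \<open>c\<close>, the identity takes its place.\<close>
  obtain \<tau> v where \<tau>: "\<tau> \<in> G" "v \<noteq> 0" "\<tau> v = v" "\<tau> = id \<or> (\<forall>v. \<tau> (c v) = c (c (\<tau> v)))"
    and G\<tau>: "\<And>g. g \<in> G \<Longrightarrow> \<exists>h. (h = id \<or> h = c \<or> h = c \<circ> c) \<and> (g = h \<or> g = \<tau> \<circ> h)"
  proof (cases "\<forall>g\<in>G. \<forall>v. g (c v) = c (g v)")
    case True
    show thesis
    proof (rule that[of id e\<^sub>1])
      show "e\<^sub>1 \<noteq> 0" by (auto simp: vec_eq_iff)
      show "\<exists>h. (h = id \<or> h = c \<or> h = c \<circ> c) \<and> (g = h \<or> g = id \<circ> h)" if "g \<in> G" for g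
        using cent[OF that] True that by blast
    qed (auto simp: G_id)
  next
    case False
    then obtain \<tau> where \<tau>: "\<tau> \<in> G" "\<not> (\<forall>v. \<tau> (c v) = c (\<tau> v))" by blast
    then have \<tau>c: "\<forall>v. \<tau> (c v) = c (c (\<tau> v))" using conj by blast
    have "det \<tau> \<noteq> 1" using SL[OF \<tau>(1)] \<tau>(2) by auto
    then obtain v where v: "v \<noteq> 0" "\<tau> v = v"
      using td[OF \<tau>(1)] ex_fixed_vector[OF G_lin[OF \<tau>(1)]] by blast
    show thesis
    proof (rule that[OF \<tau>(1) v])
      show "\<tau> = id \<or> (\<forall>v. \<tau> (c v) = c (c (\<tau> v)))" using \<tau>c by blast
      fix g assume g: "g \<in> G"
      show "\<exists>h. (h = id \<or> h = c \<or> h = c \<circ> c) \<and> (g = h \<or> g = \<tau> \<circ> h)"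
      proof (cases "\<forall>v. g (c v) = c (g v)")
        case True
        then show ?thesis using cent[OF g] by blast
      next
        case False
        then have gc: "g (c v) = c (c (g v))" for v using conj[OF g] by blast
        define h where "h = finv \<tau> \<circ> g"
        have hG: "h \<in> G" unfolding h_def using \<tau>(1) g by (auto intro!: G_comp G_inv)
        have \<tau>h: "\<tau> (h v) = g v" for v using \<tau>(1) by (simp add: h_def)
        have "\<tau> (h (c v)) = \<tau> (c (h v))" for v using \<tau>h \<tau>c gc by simp
        then have "finv \<tau> (\<tau> (h (c v))) = finv \<tau> (\<tau> (c (h v)))" for v by simp
        then have "h (c v) = c (h v)" for v unfolding G_inv_simps(1)[OF \<tau>(1)] .
        then have "h = id \<or> h = c \<or> h = c \<circ> c" by (rule cent[OF hG])
        moreover have "g = \<tau> \<circ> h" using \<tau>h by auto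
        ultimately show ?thesis by blast
      qed
    qed
  qed
  \<comment> \<open>If \<open>v\<close> and \<open>c v\<close> were parallel, the line of
    \<open>v\<close> would be stable under \<open>c\<close> and \<open>\<tau>\<close>, hence under
    \<open>G\<close>.\<close>
  have cv: "X v * Y (c v) - Y v * X (c v) \<noteq> 0"
  proof
    assume "X v * Y (c v) - Y v * X (c v) = 0"
    then obtain \<alpha> where \<alpha>: "c v = \<alpha> *s v" using parallel \<tau>(2) by blast
    have "\<exists>\<beta>. g v = \<beta> *s v" if "g \<in> G" for g
    proof -
      obtain h where h: "h = id \<or> h = c \<or> h = c \<circ> c" "g = h \<or> g = \<tau> \<circ> h" using G\<tau>[OF \<open>g \<in> G\<close>] by blast
      have "\<exists>\<beta>. h v = \<beta> *s v" using h(1)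
      proof (elim disjE)
        assume "h = id" then show ?thesis by (intro exI[of _ 1]) simp
      next
        assume "h = c" then show ?thesis using \<alpha> by blast
      next
        assume "h = c \<circ> c" then show ?thesis using \<alpha> by (intro exI[of _ "\<alpha> * \<alpha>"]) (simp add: cl)
      qed
      then obtain \<beta> where \<beta>: "h v = \<beta> *s v" by blast
      then have "g v = \<beta> *s v" using h(2) \<tau>(3) by (auto simp: linD[OF G_lin[OF \<tau>(1)]])
      then show ?thesis by blast
    qed
    then show False by (rule irreducible_no_line[OF irr \<tau>(2)])
  qed
  then obtain X' Y' where F: "frame scale v (c v) X' Y'" using new_frame by blast
  interpret P: plane_group scale v "c v" X' Y' G
    by (intro plane_group.intro plane_group_axioms.intro F subG)
  have e3: "P.e\<^sub>3 = c (c v)" by (simp add: P.e\<^sub>3_def cc)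
  have vne: "v \<noteq> c v" by (metis P.coord_simps(7,9) zero_neq_one)
  show ?thesis
  proof (rule P.triangle_in_S3)
    fix g assume g: "g \<in> G"
    let ?W = "{v, c v, c (c v)}"
    obtain h where h: "h = id \<or> h = c \<or> h = c \<circ> c" "g = h \<or> g = \<tau> \<circ> h" using G\<tau>[OF g] by blast
    have "c x \<in> ?W" if "x \<in> ?W" for x
      using that unfolding insert_iff empty_iff by (elim disjE) (simp_all add: ccc)
    then have hW: "h x \<in> ?W" if "x \<in> ?W" for x
      using h(1) that by (elim disjE) (simp_all only: id_apply comp_apply)
    have \<tau>W: "\<tau> x \<in> ?W" if "x \<in> ?W" for x
      using \<tau>(4)
    proof
      assume *: "\<forall>v. \<tau> (c v) = c (c (\<tau> v))"
      then have 1: "\<tau> (c v) = c (c v)" using \<tau>(3) by metis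
      have "\<tau> (c (c v)) = c (c (\<tau> (c v)))" using * by blast
      then have "\<tau> (c (c v)) = c v" unfolding 1 ccc .
      then show ?thesis
        using that 1 \<tau>(3) unfolding insert_iff empty_iff by (elim disjE) (simp_all only:, simp_all)
    qed (use that in simp)
    have "g x \<in> ?W" if "x \<in> ?W" for x
      using h(2) hW[OF that] \<tau>W[OF hW[OF that]] by (elim disjE) (simp_all only: comp_apply)
    from this[of v] this[of "c v"] have "g v \<in> ?W" "g (c v) \<in> ?W" by blast+
    moreover have "g v \<noteq> g (c v)" using G_bij[OF g] vne by (simp add: bij_def inj_eq)
    ultimately show "P.triangle g" unfolding P.triangle_def e3 by blast
  qed
qed

section \<open>Reducible planes and extensions of characters\<close>

lemma reducible_frame:
  assumes "\<not> irreducible_gmodule \<Gamma> V"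
  shows "\<exists>e e' X' Y'. frame scale e e' X' Y' \<and> (\<forall>g\<in>G. Y' (g e) = 0)"
proof -
  have "(UNIV :: 'v set) \<noteq> {0}"
  proof
    assume "(UNIV :: 'v set) = {0}"
    then have "e\<^sub>1 = 0" by blast
    then show False by (auto simp: vec_eq_iff)
  qed
  then obtain N where N: "submod \<Gamma> N V" "N \<noteq> {0}" "N \<noteq> UNIV"
    using assms by (auto simp: irreducible_gmodule_def)
  note D = V.submodD[OF N(1), simplified]
  obtain u where u: "u \<in> N" "u \<noteq> 0" using D(2) N(2) by blast
  obtain w where w: "w \<notin> N" using N(3) by blast
  have "X u * Y w - Y u * X w \<noteq> 0"
  proof
    assume "X u * Y w - Y u * X w = 0"
    then obtain c where "w = c *s u" using parallel u(2) by blast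
    then show False using w D(4)[OF u(1)] by blast
  qed
  then obtain X' Y' where F: "frame scale u w X' Y'" using new_frame by blast
  interpret F: frame scale u w X' Y' by (rule F)
  have "Y' x = 0" if "x \<in> N" for x
  proof (rule ccontr)
    assume y: "Y' x \<noteq> 0"
    have "x + (- X' x) *s u \<in> N" using that u(1) by (intro D(3) D(4))
    moreover have "x + (- X' x) *s u = Y' x *s w" by (simp add: F.vec_eq_iff)
    ultimately have "Y' x *s w \<in> N" by simp
    then have "inverse (Y' x) *s Y' x *s w \<in> N" by (rule D(4))
    then show False using y w by simp
  qed
  then show ?thesis using F D(5) u(1) by blast
qed

text \<open>As a sequence of vector spaces the extension splits: \<open>e\<close> is the image of 1,
  \<open>e'\<close> a preimage of 1, and \<pi> itself is the second coordinate. The two characters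
  then appear as diagonal entries.\<close>

lemma extension_frame:
  assumes "is_extension \<Gamma> (char_gmodule \<chi>\<^sub>1) V (char_gmodule \<chi>\<^sub>2)"
  shows "\<exists>e e' X' Y'. frame scale e e' X' Y' \<and> (\<forall>g\<in>G. g e = \<chi>\<^sub>1 g *s e \<and> Y' (g e') = \<chi>\<^sub>2 g)"
proof -
  obtain \<iota> \<pi> where hom: "\<iota> \<in> gmodule_hom \<Gamma> (char_gmodule \<chi>\<^sub>1) V" "\<pi> \<in> gmodule_hom \<Gamma> V (char_gmodule \<chi>\<^sub>2)"
    and *: "inj_on \<iota> (carrier (char_gmodule \<chi>\<^sub>1))" "\<pi> ` carrier V = carrier (char_gmodule \<chi>\<^sub>2)"
      "\<iota> ` carrier (char_gmodule \<chi>\<^sub>1) = kernel V (char_gmodule \<chi>\<^sub>2) \<pi>"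
    using assms unfolding is_extension_def by blast
  have inj: "inj \<iota>" and onto: "range \<pi> = UNIV" and ex: "range \<iota> = {v. \<pi> v = 0}"
    using * by (simp_all add: char_gmodule_def kernel_def)
  have i: "\<iota> (c * a) = c *s \<iota> a" "g \<in> G \<Longrightarrow> \<iota> (\<chi>\<^sub>1 g * a) = g (\<iota> a)" for c a g
    using gmodule_homD(3,4)[OF hom(1) gmod_char V.gmod_axioms] by (simp_all add: char_gmodule_def)
  have p: "\<pi> (u + v) = \<pi> u + \<pi> v" "\<pi> (c *s v) = c * \<pi> v" "g \<in> G \<Longrightarrow> \<pi> (g v) = \<chi>\<^sub>2 g * \<pi> v" for u v c g
    using gmodule_homD(2,3,4)[OF hom(2) V.gmod_axioms gmod_char] by (simp_all add: char_gmodule_def)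
  define e where "e = \<iota> 1"
  have \<iota>e: "\<iota> c = c *s e" for c using i(1)[of c 1] by (simp add: e_def)
  obtain e' where e': "\<pi> e' = 1" using onto by (metis UNIV_I rangeE)
  define X' where "X' = (\<lambda>v. finv \<iota> (v + (- \<pi> v) *s e'))"
  have "frame scale e e' X' \<pi>"
  proof unfold_locales
    fix v a b
    have "\<pi> (v + (- \<pi> v) *s e') = 0" by (simp add: p e' del: scale_minus_left)
    then have "v + (- \<pi> v) *s e' \<in> range \<iota>" using ex by blast
    then have "X' v *s e = v + (- \<pi> v) *s e'"
      unfolding X'_def \<iota>e[symmetric] by (rule f_inv_into_f)
    then show "v = X' v *s e + \<pi> v *s e'" by simp
    have "\<iota> a \<in> range \<iota>" by (rule rangeI)
    then have \<pi>e: "\<pi> (a *s e) = 0" unfolding ex \<iota>e by simp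
    then show pb: "\<pi> (a *s e + b *s e') = b" by (simp add: p e')
    show "X' (a *s e + b *s e') = a"
      unfolding X'_def pb using inv_f_f[OF inj, of a] by (simp add: \<iota>e)
  qed
  moreover have "g e = \<chi>\<^sub>1 g *s e \<and> \<pi> (g e') = \<chi>\<^sub>2 g" if "g \<in> G" for g
    using i(2)[OF that, of 1] p(3)[OF that, of e'] e' by (simp add: \<iota>e)
  ultimately show ?thesis by blast
qed

lemma triangular_extension:
  assumes t: "triangular"
  shows "ent\<^sub>1\<^sub>1 \<in> characters \<Gamma>" "ent\<^sub>2\<^sub>2 \<in> characters \<Gamma>"
    "is_extension \<Gamma> (char_gmodule ent\<^sub>1\<^sub>1) V (char_gmodule ent\<^sub>2\<^sub>2)"
proof -
  have c: "ent\<^sub>2\<^sub>1 g = 0" if "g \<in> G" for g using t that by (simp add: triangular_def)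
  show "ent\<^sub>1\<^sub>1 \<in> characters \<Gamma>" "ent\<^sub>2\<^sub>2 \<in> characters \<Gamma>"
    by (auto simp: characters_def hom_def ent_comp G_lin c tri_nonzero[OF t])
  have "(\<lambda>a. a *s e\<^sub>1) \<in> gmodule_hom \<Gamma> (char_gmodule ent\<^sub>1\<^sub>1) V"
    by (rule gmodule_homI)
      (auto simp: char_gmodule_def scale_left_distrib vec_eq_iff coord_lin[OF G_lin] c)
  moreover have "Y \<in> gmodule_hom \<Gamma> V (char_gmodule ent\<^sub>2\<^sub>2)"
    by (rule gmodule_homI) (auto simp: char_gmodule_def coord_lin[OF G_lin] c)
  moreover have "inj (\<lambda>a. a *s e\<^sub>1)" by (auto intro!: injI simp: vec_eq_iff)
  moreover have "range Y = UNIV" using coord_simps(4)[of _ e\<^sub>2] by (metis coord_simps(10) mult_1_right surj_def)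
  moreover have "range (\<lambda>a. a *s e\<^sub>1) = {v. Y v = 0}"
  proof (intro equalityI subsetI)
    fix v assume "v \<in> {v. Y v = 0}"
    then have "v = X v *s e\<^sub>1" by (simp add: vec_eq_iff)
    then show "v \<in> range (\<lambda>a. a *s e\<^sub>1)" by (metis rangeI)
  qed auto
  ultimately show "is_extension \<Gamma> (char_gmodule ent\<^sub>1\<^sub>1) V (char_gmodule ent\<^sub>2\<^sub>2)"
    unfolding is_extension_def
    by (intro bexI[of _ "\<lambda>a. a *s e\<^sub>1"] bexI[of _ Y]) (simp_all add: char_gmodule_def kernel_def)
qed

end

section \<open>Transvections in irreducible planes, and the equivalence\<close>

context plane_group_p
begin

text \<open>Irreducibility provides a conjugate of the given transvection with a different axis.\<close>

lemma unipotent_minus: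
  assumes irr: "irreducible_gmodule \<Gamma> V" and odd: "odd CARD('p)"
    and u: "u \<in> G" "u \<noteq> id" "\<And>v. u (u v) = 2 *s u v - v"
  shows "uminus \<in> G"
proof -
  obtain w where w: "u w \<noteq> w" using u(2) by (auto simp: fun_eq_iff)
  \<comment> \<open>\<open>l\<close> spans the image of u - 1, which is also the line fixed by the
    transvection.\<close>
  define l where "l = u w - w"
  have l0: "l \<noteq> 0" using w by (simp add: l_def)
  have ul: "u l = l"
    by (simp add: l_def linD[OF G_lin[OF u(1)]] u(3)) (simp add: vec_eq_iff algebra_simps)
  obtain g where g: "g \<in> G" "\<not> (\<exists>c. g l = c *s l)"
    using irreducible_no_line[OF irr l0] by blast
  then have "X l * Y (g l) - Y l * X (g l) \<noteq> 0" using parallel l0 by blast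
  then obtain X' Y' where F: "frame scale l (g l) X' Y'" using new_frame by blast
  \<comment> \<open>In the basis \<open>l\<close>, \<open>g l\<close> the element \<open>u\<close>
    is upper and its conjugate \<open>u'\<close> lower unitriangular, as
    \<open>minus_mem_of_transvections\<close> requires.\<close>
  interpret P: plane_group scale l "g l" X' Y' G
    by (intro plane_group.intro plane_group_axioms.intro F subG)
  interpret P: plane_group_p scale l "g l" X' Y' G by unfold_locales
  define u' where "u' = g \<circ> u \<circ> finv g"
  have u'G: "u' \<in> G" unfolding u'_def using g u by (auto intro!: G_comp G_inv)
  have u'g: "u' (g v) = g (u v)" for v using g by (simp add: u'_def)
  have u'u': "u' (u' v) = 2 *s u' v - v" for v
  proof -
    have "u' (u' (g (finv g v))) = 2 *s u' (g (finv g v)) - g (finv g v)"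
      unfolding u'g u(3) by (simp only: linD[OF G_lin[OF g(1)]])
    then show ?thesis using g(1) by simp
  qed
  have one: "P.ent\<^sub>1\<^sub>1 u = 1" "P.ent\<^sub>2\<^sub>1 u = 0" by (simp_all add: P.ent_defs ul)
  have one': "P.ent\<^sub>1\<^sub>2 u' = 0" "P.ent\<^sub>2\<^sub>2 u' = 1" by (simp_all add: P.ent_defs u'g ul)
  have "(P.ent\<^sub>2\<^sub>2 u - 1) * (P.ent\<^sub>2\<^sub>2 u - 1) = 0"
    using arg_cong[OF u(3)[of "g l"], of Y'] one
    by (simp add: P.coord_lin[OF P.G_lin[OF u(1)]] algebra_simps)
  then have d: "P.ent\<^sub>2\<^sub>2 u = 1" by simp
  have "(P.ent\<^sub>1\<^sub>1 u' - 1) * (P.ent\<^sub>1\<^sub>1 u' - 1) = 0"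
    using arg_cong[OF u'u'[of l], of X'] one'
    by (simp add: P.coord_lin[OF P.G_lin[OF u'G]] algebra_simps)
  then have a: "P.ent\<^sub>1\<^sub>1 u' = 1" by simp
  have b: "P.ent\<^sub>1\<^sub>2 u \<noteq> 0"
    using u(2) one d by (auto simp: P.lin_eq_iff[OF P.G_lin[OF u(1)] P.lin_id(1)])
  have "u' \<noteq> id"
  proof
    assume "u' = id"
    then have "g (u v) = g v" for v using u'g[of v] by simp
    then have "u v = v" for v using G_inv_simps(1)[OF g(1)] by metis
    then show False using u(2) by (auto simp: fun_eq_iff)
  qed
  then have c: "P.ent\<^sub>2\<^sub>1 u' \<noteq> 0"
    using one' a by (auto simp: P.lin_eq_iff[OF P.G_lin[OF u'G] P.lin_id(1)])
  show ?thesis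
    by (rule P.minus_mem_of_transvections[OF u(1) one d b u'G a one' c odd])
qed

lemma card_gt_2:
  assumes "\<nexists>S. subgroup S (GL scale) \<and> restr_GL scale S \<cong> sym_group 3 \<and> G \<subseteq> S"
  shows "CARD('p) > 2"
proof (rule ccontr)
  assume "\<not> ?thesis"
  then have "CARD('p) = 2" using prime_ge_2_nat[OF prime_card[where 'a='p]] by simp
  then have "x = 0 \<or> x = 1" for x :: "'p mod_ring"
  proof -
    obtain i where i: "i < CARD('p)" "x = of_nat i" using surj_of_nat_mod_ring by blast
    then have "i = 0 \<or> i = 1" using \<open>CARD('p) = 2\<close> by arith
    then show ?thesis using i(2) by auto
  qed
  then show False using assms triangle_in_S3 card2_triangle by blast
qed

text \<open>The ambient frame is arbitrary; every reducible situation is treated in a frame adapted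
  to its own stable line, by interpreting the locale again.\<close>

lemma main_equiv:
  "(\<not> common_composition_factor \<Gamma> V E \<and> trivial_group (H1 \<Gamma> V)) \<longleftrightarrow>
     (\<nexists>S. subgroup S (GL scale) \<and> restr_GL scale S \<cong> sym_group 3 \<and> G \<subseteq> S) \<and>
     (\<not> irreducible_gmodule \<Gamma> V \<longrightarrow>
       (\<forall>\<chi>\<^sub>1\<in>characters \<Gamma>. \<forall>\<chi>\<^sub>2\<in>characters \<Gamma>.
         is_extension \<Gamma> (char_gmodule \<chi>\<^sub>1) V (char_gmodule \<chi>\<^sub>2) \<longrightarrow>
           (\<exists>g\<in>G. \<chi>\<^sub>1 g \<noteq> 1) \<and> (\<exists>g\<in>G. \<chi>\<^sub>1 g \<noteq> (\<chi>\<^sub>2 g)\<^sup>2) \<and>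
           (\<exists>g\<in>G. \<chi>\<^sub>2 g \<noteq> 1) \<and> (\<exists>g\<in>G. \<chi>\<^sub>2 g \<noteq> (\<chi>\<^sub>1 g)\<^sup>2)))"
  (is "?L \<longleftrightarrow> ?S \<and> ?C")
proof
  assume L: ?L
  have ?S using L S3_common by blast
  moreover have "(\<exists>g\<in>G. \<chi>\<^sub>1 g \<noteq> 1) \<and> (\<exists>g\<in>G. \<chi>\<^sub>1 g \<noteq> (\<chi>\<^sub>2 g)\<^sup>2) \<and>
      (\<exists>g\<in>G. \<chi>\<^sub>2 g \<noteq> 1) \<and> (\<exists>g\<in>G. \<chi>\<^sub>2 g \<noteq> (\<chi>\<^sub>1 g)\<^sup>2)"
    if ext: "is_extension \<Gamma> (char_gmodule \<chi>\<^sub>1) V (char_gmodule \<chi>\<^sub>2)" for \<chi>\<^sub>1 \<chi>\<^sub>2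
  proof -
    obtain e e' X' Y' where F: "frame scale e e' X' Y'"
      and \<chi>: "\<And>g. g \<in> G \<Longrightarrow> g e = \<chi>\<^sub>1 g *s e" "\<And>g. g \<in> G \<Longrightarrow> Y' (g e') = \<chi>\<^sub>2 g"
      using extension_frame[OF ext] by blast
    interpret P: plane_group scale e e' X' Y' G
      by (intro plane_group.intro plane_group_axioms.intro F subG)
    have e: "P.ent\<^sub>1\<^sub>1 g = \<chi>\<^sub>1 g" "P.ent\<^sub>2\<^sub>1 g = 0" "P.ent\<^sub>2\<^sub>2 g = \<chi>\<^sub>2 g" if "g \<in> G" for g
      using \<chi>[OF that] by (simp_all add: P.ent_defs)
    have "P.triangular" using e by (simp add: P.triangular_def)
    then have "\<not> ((\<forall>g\<in>G. P.ent\<^sub>1\<^sub>1 g = 1) \<or> (\<forall>g\<in>G. P.ent\<^sub>1\<^sub>1 g = (P.ent\<^sub>2\<^sub>2 g)\<^sup>2) \<or>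
        (\<forall>g\<in>G. P.ent\<^sub>2\<^sub>2 g = 1) \<or> (\<forall>g\<in>G. P.ent\<^sub>2\<^sub>2 g = (P.ent\<^sub>1\<^sub>1 g)\<^sup>2))"
      using P.common_tri L by blast
    then show ?thesis using e by simp
  qed
  ultimately show "?S \<and> ?C" by blast
next
  assume R: "?S \<and> ?C"
  have gt2: "CARD('p) > 2" using R card_gt_2 by blast
  then have odd: "odd CARD('p)" using prime_card[where 'a='p] prime_odd_nat by blast
  have two: "(2 :: 'p mod_ring) \<noteq> 0"
  proof
    assume "(2 :: 'p mod_ring) = 0"
    then have "CARD('p) dvd 2" using of_nat_0_mod_ring_dvd[where 'a='p, of 2] by simp
    then show False using gt2 by (auto dest: dvd_imp_le)
  qed
  show ?L
  proof (cases "irreducible_gmodule \<Gamma> V")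
    case irr: True
    show ?thesis
    proof (cases "uminus \<in> G")
      case True
      then show ?thesis using not_common_minus trivial_H1_minus two by blast
    next
      case False
      \<comment> \<open>By \<open>unipotent_minus\<close> only the identity satisfies (g - 1)^2 = 0.
        This excludes elements of order p, so p does not divide the order of \<open>G\<close>, and
        it also provides the last assumption of \<open>irreducible_triangle\<close>.\<close>
      then have nu: "g = id" if "g \<in> G" "\<And>v. g (g v) = 2 *s g v - v" for g
        using unipotent_minus[OF irr odd that(1)] that by blast
      have "of_nat (card G) \<noteq> (0 :: 'p mod_ring)"
        using ex_order_p order_p_unipotent nu by blast
      then have "trivial_group (H1 \<Gamma> V)" by (rule trivial_H1_card)
      moreover have "\<not> common_composition_factor \<Gamma> V E"
      proof
        assume c: "common_composition_factor \<Gamma> V E"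
        have "g = id" if "g \<in> G" "tr g = 2" "det g = 1" for g
          using nu[OF that(1)] cayley_hamilton[OF G_lin[OF that(1)]] that by simp
        then have "\<not> ?S" using irreducible_triangle[OF irr common_tr_det[OF irr c]] by blast
        then show False using R by blast
      qed
      ultimately show ?thesis by blast
    qed
  next
    case False
    then obtain e e' X' Y' where F: "frame scale e e' X' Y'" and t: "\<forall>g\<in>G. Y' (g e) = 0"
      using reducible_frame by blast
    interpret P: plane_group scale e e' X' Y' G
      by (intro plane_group.intro plane_group_axioms.intro F subG)
    interpret P: plane_group_p scale e e' X' Y' G by unfold_locales
    have tri: "P.triangular" using t by (simp add: P.triangular_def P.ent_defs)
    have "(\<exists>g\<in>G. P.ent\<^sub>1\<^sub>1 g \<noteq> 1) \<and> (\<exists>g\<in>G. P.ent\<^sub>1\<^sub>1 g \<noteq> (P.ent\<^sub>2\<^sub>2 g)\<^sup>2) \<and>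
      (\<exists>g\<in>G. P.ent\<^sub>2\<^sub>2 g \<noteq> 1) \<and> (\<exists>g\<in>G. P.ent\<^sub>2\<^sub>2 g \<noteq> (P.ent\<^sub>1\<^sub>1 g)\<^sup>2)"
      using R False P.triangular_extension[OF tri] by blast
    then show ?thesis using P.not_common_tri[OF tri] P.trivial_H1_tri[OF tri] by blast
  qed
qed

end

lemma ex_frame:
  fixes scale :: "'k::field \<Rightarrow> 'v::ab_group_add \<Rightarrow> 'v"
  assumes "vector_space scale" "vector_space.dim scale (UNIV :: 'v set) = 2"
  shows "\<exists>e\<^sub>1 e\<^sub>2 X Y. frame scale e\<^sub>1 e\<^sub>2 X Y"
proof -
  interpret vector_space scale by fact
  obtain B where B: "independent B" "span B = UNIV" "card B = 2"
    using basis_exists[of UNIV] assms(2) by (metis UNIV_eq_I subset_eq UNIV_I)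
  then obtain e1 e2 where e: "B = {e1, e2}" "e1 \<noteq> e2" by (auto simp: card_2_iff)
  have fin: "finite B" using e by simp
  let ?X = "\<lambda>v. representation B v e1" and ?Y = "\<lambda>v. representation B v e2"
  have "frame scale e1 e2 ?X ?Y"
  proof unfold_locales
    fix v a b
    have "(\<Sum>b\<in>B. scale (representation B v b) b) = v"
      using sum_representation_eq[OF B(1) _ fin order_refl] B(2) by simp
    then show "v = scale (?X v) e1 + scale (?Y v) e2" using e by simp
    have "representation B (scale a e1 + scale b e2) x = a * representation B e1 x + b * representation B e2 x" for x
      using representation_add[OF B(1)] representation_scale[OF B(1)] B(2) by simp
    then show "?X (scale a e1 + scale b e2) = a" "?Y (scale a e1 + scale b e2) = b"
      using representation_basis[OF B(1)] e by simp_all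
  qed
  then show ?thesis by blast
qed

theorem theorem34:
  fixes scale :: "'p::prime_card mod_ring \<Rightarrow> 'v::ab_group_add \<Rightarrow> 'v"
    and G :: "('v \<Rightarrow> 'v) set"
  assumes "vector_space scale"
    and "vector_space.dim scale (UNIV :: 'v set) = 2"
    and "subgroup G (GL scale)"
  shows "((\<not> common_composition_factor (restr_GL scale G) (std_gmodule scale) (End_gmodule scale) \<and>
          trivial_group (H1 (restr_GL scale G) (std_gmodule scale)))
         \<longleftrightarrow>
         ((\<nexists>S. subgroup S (GL scale) \<and> restr_GL scale S \<cong> sym_group 3 \<and> G \<subseteq> S) \<and>
          (\<not> irreducible_gmodule (restr_GL scale G) (std_gmodule scale) \<longrightarrow>
            (\<forall>\<chi>\<^sub>1\<in>characters (restr_GL scale G). \<forall>\<chi>\<^sub>2\<in>characters (restr_GL scale G).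
              is_extension (restr_GL scale G) (char_gmodule \<chi>\<^sub>1) (std_gmodule scale) (char_gmodule \<chi>\<^sub>2) \<longrightarrow>
                (\<exists>g\<in>G. \<chi>\<^sub>1 g \<noteq> 1) \<and> (\<exists>g\<in>G. \<chi>\<^sub>1 g \<noteq> (\<chi>\<^sub>2 g)\<^sup>2) \<and>
                (\<exists>g\<in>G. \<chi>\<^sub>2 g \<noteq> 1) \<and> (\<exists>g\<in>G. \<chi>\<^sub>2 g \<noteq> (\<chi>\<^sub>1 g)\<^sup>2)))))
         \<and>
         ((\<nexists>S. subgroup S (GL scale) \<and> restr_GL scale S \<cong> sym_group 3 \<and> G \<subseteq> S)
         \<longrightarrow> CARD('p) > 2)"
proof -
  obtain e\<^sub>1 e\<^sub>2 X Y where F: "frame scale e\<^sub>1 e\<^sub>2 X Y" using ex_frame[OF assms(1,2)] by blast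
  interpret plane_group_p scale e\<^sub>1 e\<^sub>2 X Y G
    by (intro plane_group_p.intro plane_group.intro plane_group_axioms.intro F assms(3))
  show ?thesis using main_equiv card_gt_2 by blast
qed

end
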